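(* Let $\mathbb K$ be a field of characteristic zero. Let $R$ be either $U(W_+)$, $U(Vir)$, or $U(Vir)/(c-\kappa)$ for some $\kappa\in\mathbb K$. Then any epimorphism of $R$, i.e. any surjective $\mathbb K$-algebra homomorphism $R\to R$, is an isomorphism.
   Context: Let $\mathbb K$ be a field of characteristic zero. The positive Witt algebra $W_+$ is the Lie algebra over $\mathbb K$ with basis $\{e_n : n\ge 1\}$ and bracket $[e_i,e_j]=(j-i)e_{i+j}$. The Virasoro algebra $Vir$ is the Lie algebra with basis $\{e_n : n\in\mathbb Z\}\cup\{c\}$ and bracket $[e_i,e_j]=(j-i)e_{i+j}+\frac{i^3-i}{12}\delta_{i+j,0}\,c$, with $c$ central. $U(\cdot)$ denotes the universal enveloping algebra, and $(c-\kappa)$ the two-sided ideal generated by $c-\kappa$. *)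

theory Defs
  imports Complex_Main "HOL-Library.Poly_Mapping" "HOL-Algebra.QuotRing" "HOL-Algebra.Module"
begin

section \<open>Lie algebras\<close>

text \<open>
  A Lie algebra is a subspace \<open>carrier L\<close> of a vector space over the field \<open>'k\<close>, whose
  addition is that of the type \<open>'g\<close>.
\<close>

record ('k, 'g) lie_alg = "'g partial_object" +
  lie_scale :: "'k \<Rightarrow> 'g \<Rightarrow> 'g"
  lie_bracket :: "'g \<Rightarrow> 'g \<Rightarrow> 'g"

locale lie_algebra = vector_space "lie_scale L"
  for L :: "('k::field, 'g::ab_group_add) lie_alg" +
  assumes subspace_carrier: "subspace (carrier L)"
    and bracket_closed: "\<lbrakk>x \<in> carrier L; y \<in> carrier L\<rbrakk> \<Longrightarrow> lie_bracket L x y \<in> carrier L"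
    and bracket_add_left: "\<lbrakk>x \<in> carrier L; y \<in> carrier L; z \<in> carrier L\<rbrakk>
      \<Longrightarrow> lie_bracket L (x + y) z = lie_bracket L x z + lie_bracket L y z"
    and bracket_add_right: "\<lbrakk>x \<in> carrier L; y \<in> carrier L; z \<in> carrier L\<rbrakk>
      \<Longrightarrow> lie_bracket L x (y + z) = lie_bracket L x y + lie_bracket L x z"
    and bracket_scale_left: "\<lbrakk>x \<in> carrier L; y \<in> carrier L\<rbrakk>
      \<Longrightarrow> lie_bracket L (lie_scale L a x) y = lie_scale L a (lie_bracket L x y)"
    and bracket_scale_right: "\<lbrakk>x \<in> carrier L; y \<in> carrier L\<rbrakk>
      \<Longrightarrow> lie_bracket L x (lie_scale L a y) = lie_scale L a (lie_bracket L x y)"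
    and bracket_self: "x \<in> carrier L \<Longrightarrow> lie_bracket L x x = 0"
    and jacobi: "\<lbrakk>x \<in> carrier L; y \<in> carrier L; z \<in> carrier L\<rbrakk>
      \<Longrightarrow> lie_bracket L x (lie_bracket L y z) + lie_bracket L y (lie_bracket L z x)
        + lie_bracket L z (lie_bracket L x y) = 0"


section \<open>Associative algebras over a field\<close>

text \<open>
  Associative unital \<open>'k\<close>-algebras, not necessarily commutative, are represented by the records
  of type \<open>('k, 'a) module\<close>, i.e. rings with a scalar multiplication. (The library locale
  \<open>algebra\<close> is restricted to commutative rings.)
\<close>

definition quot_alg :: "('k, 'a) module \<Rightarrow> 'a set \<Rightarrow> ('k, 'a set) module" where
  "quot_alg A I =
    \<lparr>carrier = carrier (A Quot I), mult = mult (A Quot I), one = one (A Quot I),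
     zero = zero (A Quot I), add = add (A Quot I),
     smult = (\<lambda>a X. \<Union>x\<in>X. I +>\<^bsub>A\<^esub> (a \<odot>\<^bsub>A\<^esub> x))\<rparr>"

lemma ring_quot_alg:
  assumes "ideal I A"
  shows "ring (quot_alg A I)"
proof -
  interpret Q: ring "A Quot I"
    using assms by (rule ideal.quotient_is_ring)
  have sel: "carrier (quot_alg A I) = carrier (A Quot I)" "mult (quot_alg A I) = mult (A Quot I)"
    "one (quot_alg A I) = one (A Quot I)" "zero (quot_alg A I) = zero (A Quot I)"
    "add (quot_alg A I) = add (A Quot I)"
    by (simp_all add: quot_alg_def)
  show ?thesis
    by (intro ringI abelian_groupI monoidI; unfold sel)
      (simp_all add: Q.a_ac Q.m_assoc Q.l_distr Q.r_distr)
qed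

definition alg_hom :: "('k, 'a) module \<Rightarrow> ('k, 'b) module \<Rightarrow> ('a \<Rightarrow> 'b) set" where
  "alg_hom A B = {h. h \<in> ring_hom A B \<and> (\<forall>a. \<forall>x\<in>carrier A. h (a \<odot>\<^bsub>A\<^esub> x) = a \<odot>\<^bsub>B\<^esub> h x)}"

definition alg_epi :: "('k, 'a) module \<Rightarrow> ('k, 'b) module \<Rightarrow> ('a \<Rightarrow> 'b) set" where
  "alg_epi A B = {h. h \<in> alg_hom A B \<and> h ` carrier A = carrier B}"

definition alg_iso :: "('k, 'a) module \<Rightarrow> ('k, 'b) module \<Rightarrow> ('a \<Rightarrow> 'b) set" where
  "alg_iso A B = {h. h \<in> alg_hom A B \<and> bij_betw h (carrier A) (carrier B)}"


section \<open>Free algebras\<close>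

text \<open>
  Words are wrapped in a datatype so that no global \<open>monoid_add\<close> instance for lists is needed.
  With concatenation as \<open>+\<close>, the convolution product of \<^typ>\<open>'a \<Rightarrow>\<^sub>0 'k\<close> is the product of
  noncommutative polynomials.
\<close>

datatype 'a free_word = Word (letters: "'a list")

instantiation free_word :: (type) monoid_add
begin

definition "0 = Word []"
definition "v + w = Word (letters v @ letters w)"

instance
  by standard (simp_all add: zero_free_word_def plus_free_word_def)

end

definition free_algebra :: "'x set \<Rightarrow> ('k::field, 'x free_word \<Rightarrow>\<^sub>0 'k) module" where
  "free_algebra X =
    \<lparr>carrier = {p. \<forall>w\<in>Poly_Mapping.keys p. set (letters w) \<subseteq> X}, mult = (*), one = 1, zero = 0,
     add = (+), smult = (\<lambda>a. Poly_Mapping.map ((*) a))\<rparr>"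

definition letter :: "'x \<Rightarrow> 'x free_word \<Rightarrow>\<^sub>0 'k::field" where
  "letter x = Poly_Mapping.single (Word [x]) 1"

lemma ring_free_algebra: "ring (free_algebra X :: ('k::field, 'x free_word \<Rightarrow>\<^sub>0 'k) module)"
proof -
  let ?F = "free_algebra X :: ('k, 'x free_word \<Rightarrow>\<^sub>0 'k) module"
  have sel: "mult ?F = (*)" "one ?F = 1" "zero ?F = 0" "add ?F = (+)"
    by (simp_all add: free_algebra_def)
  have mem: "p \<in> carrier ?F \<longleftrightarrow> (\<forall>w\<in>Poly_Mapping.keys p. set (letters w) \<subseteq> X)" for p
    by (simp add: free_algebra_def)
  have zero: "0 \<in> carrier ?F" and one: "1 \<in> carrier ?F"
    by (simp_all add: mem zero_free_word_def)
  have plus: "p + q \<in> carrier ?F" if "p \<in> carrier ?F" "q \<in> carrier ?F" for p q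
    using that Poly_Mapping.keys_add[of p q] unfolding mem by blast
  have uminus: "- p \<in> carrier ?F" if "p \<in> carrier ?F" for p
    using that unfolding mem by simp
  have times: "p * q \<in> carrier ?F" if "p \<in> carrier ?F" "q \<in> carrier ?F" for p q
    unfolding mem
  proof
    fix w assume "w \<in> Poly_Mapping.keys (p * q)"
    then obtain u v where "u \<in> Poly_Mapping.keys p" "v \<in> Poly_Mapping.keys q" "w = u + v"
      using keys_mult[of p q] by blast
    then show "set (letters w) \<subseteq> X"
      using that by (simp add: mem plus_free_word_def)
  qed
  have inv: "\<exists>q\<in>carrier ?F. q + p = 0" if "p \<in> carrier ?F" for p
    using uminus[OF that] by (intro bexI[of _ "- p"]) simp_all
  show ?thesis
    by (intro ringI abelian_groupI monoidI; unfold sel)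
      (simp_all add: zero one plus times inv add.assoc mult.assoc distrib_left
        distrib_right)
qed


section \<open>Universal enveloping algebras\<close>

text \<open>
  The tensor algebra of \<open>L\<close> is the free algebra on the set \<open>carrier L\<close> modulo the relations that
  make \<^const>\<open>letter\<close> linear; the last set imposes \<open>x y - y x = [x, y]\<close>.
\<close>

definition env_relations ::
    "('k::field, 'g::ab_group_add) lie_alg \<Rightarrow> ('g free_word \<Rightarrow>\<^sub>0 'k) set" where
  "env_relations L =
    {letter (x + y) - letter x - letter y | x y. x \<in> carrier L \<and> y \<in> carrier L} \<union>
    {letter (lie_scale L a x) - Poly_Mapping.map ((*) a) (letter x) | a x. x \<in> carrier L} \<union>
    {letter x * letter y - letter y * letter x - letter (lie_bracket L x y) | x y.
      x \<in> carrier L \<and> y \<in> carrier L}"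

definition env_ideal ::
    "('k::field, 'g::ab_group_add) lie_alg \<Rightarrow> ('g free_word \<Rightarrow>\<^sub>0 'k) set" where
  "env_ideal L = Idl\<^bsub>free_algebra (carrier L)\<^esub> (env_relations L)"

definition univ_env ::
    "('k::field, 'g::ab_group_add) lie_alg \<Rightarrow> ('k, ('g free_word \<Rightarrow>\<^sub>0 'k) set) module" where
  "univ_env L = quot_alg (free_algebra (carrier L)) (env_ideal L)"

definition env_incl ::
    "('k::field, 'g::ab_group_add) lie_alg \<Rightarrow> 'g \<Rightarrow> ('g free_word \<Rightarrow>\<^sub>0 'k) set" where
  "env_incl L x = env_ideal L +>\<^bsub>free_algebra (carrier L)\<^esub> letter x"

lemma ring_univ_env:
  assumes "lie_algebra (L :: ('k::field, 'g::ab_group_add) lie_alg)"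
  shows "ring (univ_env L)"
proof -
  interpret L: lie_algebra L by fact
  interpret F: ring "free_algebra (carrier L) :: ('k, 'g free_word \<Rightarrow>\<^sub>0 'k) module"
    by (rule ring_free_algebra)
  let ?C = "carrier (free_algebra (carrier L) :: ('k, 'g free_word \<Rightarrow>\<^sub>0 'k) module)"
  have letter: "letter x \<in> ?C" if "x \<in> carrier L" for x
    using that by (simp add: free_algebra_def letter_def)
  have scale: "Poly_Mapping.map ((*) a) p \<in> ?C" if "p \<in> ?C" for a :: 'k and p
    using that by (auto simp: free_algebra_def in_keys_iff Poly_Mapping.map.rep_eq when_def)
  have minus: "p - q \<in> ?C" if "p \<in> ?C" "q \<in> ?C" for p q :: "'g free_word \<Rightarrow>\<^sub>0 'k"
    using that keys_diff[of p q] by (auto simp: free_algebra_def)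
  have times: "p * q \<in> ?C" if "p \<in> ?C" "q \<in> ?C" for p q :: "'g free_word \<Rightarrow>\<^sub>0 'k"
    using F.m_closed[OF that] by (simp add: free_algebra_def)
  have "env_relations L \<subseteq> ?C"
    unfolding env_relations_def
    by (auto intro!: letter minus scale times L.bracket_closed
        L.subspace_add[OF L.subspace_carrier] L.subspace_scale[OF L.subspace_carrier])
  then have "ideal (env_ideal L) (free_algebra (carrier L))"
    unfolding env_ideal_def by (rule F.genideal_ideal)
  then show ?thesis
    unfolding univ_env_def by (rule ring_quot_alg)
qed


section \<open>Lie algebras given by a basis and structure constants\<close>

definition bilinear_ext ::
    "('b \<Rightarrow> 'b \<Rightarrow> 'b \<Rightarrow>\<^sub>0 'k::field) \<Rightarrow> ('b \<Rightarrow>\<^sub>0 'k) \<Rightarrow> ('b \<Rightarrow>\<^sub>0 'k) \<Rightarrow> 'b \<Rightarrow>\<^sub>0 'k" where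
  "bilinear_ext s x y =
    (\<Sum>i\<in>Poly_Mapping.keys x. \<Sum>j\<in>Poly_Mapping.keys y.
      Poly_Mapping.map ((*) (Poly_Mapping.lookup x i * Poly_Mapping.lookup y j)) (s i j))"

lemma lookup_map_scale [simp]:
  "Poly_Mapping.lookup (Poly_Mapping.map ((*) (a::'k::field)) p) i = a * Poly_Mapping.lookup p i"
  by (simp add: Poly_Mapping.map.rep_eq when_def)

lemma vector_space_poly_mapping:
  "vector_space (\<lambda>a::'k::field. Poly_Mapping.map ((*) a) :: ('b \<Rightarrow>\<^sub>0 'k) \<Rightarrow> _)"
  by standard (auto intro!: poly_mapping_eqI simp: lookup_add algebra_simps)

lemma lookup_bilinear_ext:
  assumes "finite I" "finite J" "Poly_Mapping.keys x \<subseteq> I" "Poly_Mapping.keys y \<subseteq> J"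
  shows "Poly_Mapping.lookup (bilinear_ext s x y) b =
    (\<Sum>i\<in>I. \<Sum>j\<in>J. Poly_Mapping.lookup x i * Poly_Mapping.lookup y j * Poly_Mapping.lookup (s i j) b)"
proof -
  let ?t = "\<lambda>i j. Poly_Mapping.lookup x i * Poly_Mapping.lookup y j * Poly_Mapping.lookup (s i j) b"
  have "Poly_Mapping.lookup (bilinear_ext s x y) b =
      (\<Sum>i\<in>Poly_Mapping.keys x. \<Sum>j\<in>Poly_Mapping.keys y. ?t i j)"
    by (simp add: bilinear_ext_def lookup_sum)
  also have "\<dots> = (\<Sum>i\<in>Poly_Mapping.keys x. \<Sum>j\<in>J. ?t i j)"
    using assms by (intro sum.cong refl sum.mono_neutral_left) (auto simp: in_keys_iff)
  also have "\<dots> = (\<Sum>i\<in>I. \<Sum>j\<in>J. ?t i j)"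
    using assms by (intro sum.mono_neutral_left) (auto simp: in_keys_iff)
  finally show ?thesis .
qed

lemma bilinear_ext_add_left:
  "bilinear_ext s (x + y) z = bilinear_ext s x z + bilinear_ext s y z"
proof (rule poly_mapping_eqI)
  fix b
  let ?I = "Poly_Mapping.keys x \<union> Poly_Mapping.keys y"
  have "Poly_Mapping.keys (x + y) \<subseteq> ?I" by (rule Poly_Mapping.keys_add)
  then show "Poly_Mapping.lookup (bilinear_ext s (x + y) z) b =
      Poly_Mapping.lookup (bilinear_ext s x z + bilinear_ext s y z) b"
    by (simp add: lookup_bilinear_ext[of ?I "Poly_Mapping.keys z"] lookup_add sum.distrib algebra_simps)
qed

lemma bilinear_ext_add_right:
  "bilinear_ext s x (y + z) = bilinear_ext s x y + bilinear_ext s x z"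
proof (rule poly_mapping_eqI)
  fix b
  let ?J = "Poly_Mapping.keys y \<union> Poly_Mapping.keys z"
  have "Poly_Mapping.keys (y + z) \<subseteq> ?J" by (rule Poly_Mapping.keys_add)
  then show "Poly_Mapping.lookup (bilinear_ext s x (y + z)) b =
      Poly_Mapping.lookup (bilinear_ext s x y + bilinear_ext s x z) b"
    by (simp add: lookup_bilinear_ext[of "Poly_Mapping.keys x" ?J] lookup_add sum.distrib algebra_simps)
qed

lemma keys_map_scale: "Poly_Mapping.keys (Poly_Mapping.map ((*) (a::'k::field)) p) \<subseteq> Poly_Mapping.keys p"
  by (auto simp: in_keys_iff)

lemma bilinear_ext_scale_left:
  "bilinear_ext s (Poly_Mapping.map ((*) a) x) y = Poly_Mapping.map ((*) a) (bilinear_ext s x y)"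
  by (rule poly_mapping_eqI)
    (simp add: lookup_bilinear_ext[of "Poly_Mapping.keys x" "Poly_Mapping.keys y"] keys_map_scale
      sum_distrib_left ac_simps)

lemma bilinear_ext_scale_right:
  "bilinear_ext s x (Poly_Mapping.map ((*) a) y) = Poly_Mapping.map ((*) a) (bilinear_ext s x y)"
  by (rule poly_mapping_eqI)
    (simp add: lookup_bilinear_ext[of "Poly_Mapping.keys x" "Poly_Mapping.keys y"] keys_map_scale
      sum_distrib_left ac_simps)

lemma bilinear_ext_single:
  "bilinear_ext s (Poly_Mapping.single i a) (Poly_Mapping.single j b) = Poly_Mapping.map ((*) (a * b)) (s i j)"
  by (rule poly_mapping_eqI) (simp add: lookup_bilinear_ext[of "{i}" "{j}"])

lemma poly_mapping_linear_induct [case_names zero single add]: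
  assumes "P 0" "\<And>i a. P (Poly_Mapping.single i a)" "\<And>x y. P x \<Longrightarrow> P y \<Longrightarrow> P (x + y)"
  shows "P (x :: 'b \<Rightarrow>\<^sub>0 'k::comm_monoid_add)"
proof -
  have "P (\<Sum>i\<in>F. Poly_Mapping.single i (f i))" if "finite F" for F f
    using that by (induction F rule: finite_induct) (auto intro: assms)
  moreover have "x = (\<Sum>i\<in>Poly_Mapping.keys x. Poly_Mapping.single i (Poly_Mapping.lookup x i))"
    by (rule poly_mapping_eqI)
      (auto simp: lookup_sum lookup_single when_def sum.delta in_keys_iff)
  ultimately show ?thesis by (metis finite_keys)
qed

lemma bilinear_ext_zero [simp]: "bilinear_ext s 0 y = 0" "bilinear_ext s x 0 = 0"
  by (simp_all add: bilinear_ext_def)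

lemma lie_algebra_bilinear_ext:
  fixes s :: "'b \<Rightarrow> 'b \<Rightarrow> 'b \<Rightarrow>\<^sub>0 'k::field_char_0"
  defines "e \<equiv> \<lambda>i. Poly_Mapping.single i (1::'k)"
  assumes anti: "\<And>i j. s i j = - s j i"
    and jac: "\<And>i j k. bilinear_ext s (e i) (s j k) + bilinear_ext s (e j) (s k i)
      + bilinear_ext s (e k) (s i j) = 0"
    and V: "module.subspace (\<lambda>a. Poly_Mapping.map ((*) a)) V"
    and closed: "\<And>x y. x \<in> V \<Longrightarrow> y \<in> V \<Longrightarrow> bilinear_ext s x y \<in> V"
  shows "lie_algebra \<lparr>carrier = V, lie_scale = (\<lambda>a. Poly_Mapping.map ((*) a)),
    lie_bracket = bilinear_ext s\<rparr>"
proof -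
  let ?B = "bilinear_ext s"
  have self: "?B x x = 0" for x
  proof (rule poly_mapping_eqI)
    fix b
    let ?K = "Poly_Mapping.keys x" and ?x = "Poly_Mapping.lookup x"
    have s: "Poly_Mapping.lookup (s i j) b = - Poly_Mapping.lookup (s j i) b" for i j
      using anti[of i j] by (metis lookup_uminus)
    let ?S = "\<Sum>i\<in>?K. \<Sum>j\<in>?K. ?x i * ?x j * Poly_Mapping.lookup (s i j) b"
    have "?S = (\<Sum>i\<in>?K. \<Sum>j\<in>?K. ?x j * ?x i * Poly_Mapping.lookup (s j i) b)"
      by (rule sum.swap)
    also have "\<dots> = - ?S"
      unfolding sum_negf[symmetric] by (intro sum.cong refl) (subst s, simp)
    finally have "?S = 0" by simp
    then show "Poly_Mapping.lookup (?B x x) b = Poly_Mapping.lookup 0 b"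
      by (simp add: lookup_bilinear_ext[of ?K ?K])
  qed
  have single_e: "Poly_Mapping.single i a = Poly_Mapping.map ((*) a) (e i)" for i a
    by (rule poly_mapping_eqI) (simp add: e_def lookup_single when_def)
  have jacobi: "?B x (?B y z) + ?B y (?B z x) + ?B z (?B x y) = 0" (is "?J x y z = 0") for x y z
  proof (induction x rule: poly_mapping_linear_induct)
    case (single i a)
    show ?case
    proof (induction y rule: poly_mapping_linear_induct)
      case (single j b)
      show ?case
      proof (induction z rule: poly_mapping_linear_induct)
        case (single k c)
        have *: "?B (Poly_Mapping.single i a) (?B (Poly_Mapping.single j b) (Poly_Mapping.single k c)) =
            Poly_Mapping.map ((*) (a * b * c)) (?B (e i) (s j k))" for i j k a b c
          unfolding bilinear_ext_single bilinear_ext_scale_right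
          unfolding single_e[of i a] bilinear_ext_scale_left
          by (rule poly_mapping_eqI) simp
        interpret vector_space "\<lambda>a::'k. Poly_Mapping.map ((*) a) :: ('b \<Rightarrow>\<^sub>0 'k) \<Rightarrow> _"
          by (rule vector_space_poly_mapping)
        have "b * c * a = a * b * c" "c * a * b = a * b * c" by (simp_all add: ac_simps)
        then show ?case
          unfolding * by (simp only: scale_right_distrib[symmetric] jac scale_zero_right)
      next
        case (add z z')
        have "?J (Poly_Mapping.single i a) (Poly_Mapping.single j b) (z + z') =
            ?J (Poly_Mapping.single i a) (Poly_Mapping.single j b) z
            + ?J (Poly_Mapping.single i a) (Poly_Mapping.single j b) z'"
          by (simp add: bilinear_ext_add_left bilinear_ext_add_right)
        then show ?case using add by simp
      qed simp
    next
      case (add y y')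
      have "?J (Poly_Mapping.single i a) (y + y') z =
          ?J (Poly_Mapping.single i a) y z + ?J (Poly_Mapping.single i a) y' z"
        by (simp add: bilinear_ext_add_left bilinear_ext_add_right)
      then show ?case using add by simp
    qed simp
  next
    case (add x x')
    have "?J (x + x') y z = ?J x y z + ?J x' y z"
      by (simp add: bilinear_ext_add_left bilinear_ext_add_right)
    then show ?case using add by simp
  qed simp
  show ?thesis
    by (intro lie_algebra.intro lie_algebra_axioms.intro)
      (simp_all add: vector_space_poly_mapping V closed self jacobi bilinear_ext_add_left
        bilinear_ext_add_right bilinear_ext_scale_left bilinear_ext_scale_right)
qed


section \<open>The positive Witt algebra and the Virasoro algebra\<close>

text \<open>
  The basis vector $e_n$ of $W_+$ is \<open>single n 1\<close>; indices are natural numbers, so the structure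
  constant $j - i$ has to be formed in the field.
\<close>

definition witt_pos :: "('k::field_char_0, nat \<Rightarrow>\<^sub>0 'k) lie_alg" where
  "witt_pos =
    \<lparr>carrier = {x. Poly_Mapping.keys x \<subseteq> {1..}},
     lie_scale = (\<lambda>a. Poly_Mapping.map ((*) a)),
     lie_bracket = bilinear_ext (\<lambda>i j. Poly_Mapping.single (i + j) (of_nat j - of_nat i))\<rparr>"

lemma lie_algebra_witt_pos: "lie_algebra (witt_pos :: ('k::field_char_0, _) lie_alg)"
  unfolding witt_pos_def
proof (rule lie_algebra_bilinear_ext)
  let ?s = "\<lambda>i j::nat. Poly_Mapping.single (i + j) (of_nat j - of_nat i :: 'k)"
  show "?s i j = - ?s j i" for i j
    by (simp add: add.commute flip: single_uminus)
  have B: "bilinear_ext ?s (Poly_Mapping.single i 1) (Poly_Mapping.single m a) =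
      Poly_Mapping.single (i + m) (a * (of_nat m - of_nat i))" for i m a
    by (simp add: bilinear_ext_single)
  show "bilinear_ext ?s (Poly_Mapping.single i 1) (?s j k) +
      bilinear_ext ?s (Poly_Mapping.single j 1) (?s k i) +
      bilinear_ext ?s (Poly_Mapping.single k 1) (?s i j) = 0" for i j k
  proof -
    have *: "j + (k + i) = i + (j + k)" "k + (i + j) = i + (j + k)" by auto
    show ?thesis
      unfolding B * single_add[symmetric] by (simp add: algebra_simps)
  qed
  interpret vector_space "\<lambda>a::'k. Poly_Mapping.map ((*) a) :: (nat \<Rightarrow>\<^sub>0 'k) \<Rightarrow> _"
    by (rule vector_space_poly_mapping)
  show "subspace {x :: nat \<Rightarrow>\<^sub>0 'k. Poly_Mapping.keys x \<subseteq> {1..}}"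
    using Poly_Mapping.keys_add keys_map_scale by (force simp: subspace_def)
  show "bilinear_ext ?s x y \<in> {x. Poly_Mapping.keys x \<subseteq> {1..}}"
    if "x \<in> {x. Poly_Mapping.keys x \<subseteq> {1..}}" "y \<in> {x. Poly_Mapping.keys x \<subseteq> {1..}}" for x y
  proof -
    have "Poly_Mapping.lookup (bilinear_ext ?s x y) 0 = 0"
      unfolding lookup_bilinear_ext[OF finite_keys finite_keys subset_refl subset_refl]
      using that by (auto intro!: sum.neutral simp: lookup_single when_def)
    then show ?thesis
      by (auto simp: in_keys_iff Suc_le_eq intro!: Nat.gr0I)
  qed
qed

datatype vir_basis = E int | C

fun vir_struct :: "vir_basis \<Rightarrow> vir_basis \<Rightarrow> vir_basis \<Rightarrow>\<^sub>0 'k::field_char_0" where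
  "vir_struct (E i) (E j) =
    Poly_Mapping.single (E (i + j)) (of_int (j - i)) +
    Poly_Mapping.single C (if i + j = 0 then of_int (i ^ 3 - i) / 12 else 0)"
| "vir_struct C _ = 0"
| "vir_struct _ C = 0"

definition virasoro :: "('k::field_char_0, vir_basis \<Rightarrow>\<^sub>0 'k) lie_alg" where
  "virasoro =
    \<lparr>carrier = UNIV,
     lie_scale = (\<lambda>a. Poly_Mapping.map ((*) a)),
     lie_bracket = bilinear_ext vir_struct\<rparr>"

lemma lie_algebra_virasoro: "lie_algebra (virasoro :: ('k::field_char_0, _) lie_alg)"
  unfolding virasoro_def
proof (rule lie_algebra_bilinear_ext)
  let ?s = "vir_struct :: _ \<Rightarrow> _ \<Rightarrow> vir_basis \<Rightarrow>\<^sub>0 'k"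
  let ?e = "\<lambda>i. Poly_Mapping.single i (1::'k)"
  show anti: "?s i j = - ?s j i" for i j
  proof (cases i; cases j)
    fix m n assume [simp]: "i = E m" "j = E n"
    show ?thesis
    proof (cases "m + n = 0")
      case True
      then have "n = - m" by simp
      then show ?thesis
        by (auto intro!: poly_mapping_eqI simp: lookup_add lookup_minus lookup_single when_def
            field_simps)
    next
      case False
      then show ?thesis
        by (auto intro!: poly_mapping_eqI simp: lookup_add lookup_single when_def add.commute)
    qed
  qed simp_all
  have B: "bilinear_ext ?s (?e (E i)) (Poly_Mapping.single (E m) a + Poly_Mapping.single C b) =
      Poly_Mapping.single (E (i + m)) (a * of_int (m - i)) +
      Poly_Mapping.single C (if i + m = 0 then a * of_int (i ^ 3 - i) / 12 else 0)" for i m a b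
    unfolding bilinear_ext_add_right bilinear_ext_single
    by (rule poly_mapping_eqI) (simp add: lookup_add lookup_single when_def)
  have C: "bilinear_ext ?s (?e C) x = 0" for x
    by (rule poly_mapping_eqI)
      (simp add: lookup_bilinear_ext[OF finite_keys finite_keys subset_refl subset_refl])
  show "bilinear_ext ?s (?e i) (?s j k) + bilinear_ext ?s (?e j) (?s k i) +
      bilinear_ext ?s (?e k) (?s i j) = 0" for i j k
  proof (cases i; cases j; cases k)
    fix l m n assume [simp]: "i = E l" "j = E m" "k = E n"
    have *: "m + (n + l) = l + (m + n)" "n + (l + m) = l + (m + n)" by auto
    have 1: "of_int (n - m) * of_int (m + n - l) + of_int (l - n) * of_int (n + l - m) +
        of_int (m - l) * of_int (l + m - n) = (0::'k)"
      by (simp add: algebra_simps)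
    have 2: "of_int (n - m) * of_int (l ^ 3 - l) / 12 + of_int (l - n) * of_int (m ^ 3 - m) / 12 +
        of_int (m - l) * of_int (n ^ 3 - n) / 12 = (0::'k)" if "l + (m + n) = 0"
    proof -
      from that have n: "n = - l - m" by simp
      have "(n - m) * (l ^ 3 - l) + (l - n) * (m ^ 3 - m) + (m - l) * (n ^ 3 - n) = 0"
        unfolding n by (simp add: algebra_simps power3_eq_cube)
      then have "of_int ((n - m) * (l ^ 3 - l) + (l - n) * (m ^ 3 - m) + (m - l) * (n ^ 3 - n)) = (0::'k)"
        by simp
      then show ?thesis
        by (simp only: of_int_add of_int_mult add_divide_distrib[symmetric] div_0)
    qed
    show ?thesis
      by (rule poly_mapping_eqI)
        (use 1 2 in \<open>auto simp: B * lookup_add lookup_single when_def simp del: of_int_diff of_int_add\<close>)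
  qed (simp_all add: C)
  interpret vector_space "\<lambda>a::'k. Poly_Mapping.map ((*) a) :: (vir_basis \<Rightarrow>\<^sub>0 'k) \<Rightarrow> _"
    by (rule vector_space_poly_mapping)
  show "subspace (UNIV :: (vir_basis \<Rightarrow>\<^sub>0 'k) set)" by simp
qed simp

definition vir_c :: "((vir_basis \<Rightarrow>\<^sub>0 'k::field_char_0) free_word \<Rightarrow>\<^sub>0 'k) set" where
  "vir_c = env_incl virasoro (Poly_Mapping.single C 1)"

text \<open>
  \<^const>\<open>genideal\<close> is the two-sided ideal generated by a set, so this is $U(Vir)/(c - \<kappa>)$.
\<close>

definition univ_env_vir_at ::
    "'k::field_char_0 \<Rightarrow> ('k, ((vir_basis \<Rightarrow>\<^sub>0 'k) free_word \<Rightarrow>\<^sub>0 'k) set set) module" where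
  "univ_env_vir_at \<kappa> =
    quot_alg (univ_env virasoro)
      (Idl\<^bsub>univ_env virasoro\<^esub>
        {vir_c \<ominus>\<^bsub>univ_env virasoro\<^esub> (\<kappa> \<odot>\<^bsub>univ_env virasoro\<^esub> \<one>\<^bsub>univ_env virasoro\<^esub>)})"

end

theory Submission
  imports Defs "HOL-Library.Multiset_Order" "HOL-Computational_Algebra.Polynomial"
begin

text \<open>
  All three algebras are treated through one concrete model. Let \<open>'z\<close> be a ring of coefficients
  (\<open>K[c]\<close> for $U(Vir)$, \<open>K\<close> with $c = \kappa$ for the central quotients, \<open>K\<close> with $c = 0$ for $W_+$) and
  put \<open>\<delta> = c / 12\<close>. Sorting a word in the letters $e_i$ with the commutation relations gives a normal form
  \<open>nf\<close> in the symmetric algebra \<open>'z sym\<close>; the Jacobi identity makes it independent of the order of the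
  rewriting steps (\<open>nf_swap\<close>). Hence left multiplication by $e_i$ defines operators \<open>sym_gen\<close> on the symmetric
  algebra that satisfy the Virasoro relations, and the sorted words form a basis of the algebra generated by
  them. The abstract enveloping algebras of the statement are mapped isomorphically onto this algebra, or onto its positive
  part (\<open>env_model.H_kernel\<close>, \<open>env_model.H_image\<close>), so it remains to prove that a surjective endomorphism \<open>f\<close> of the
  model is injective.

  For the Virasoro algebra, $e_0$ acts locally finitely by commutators, and a surjective \<open>f\<close> transports this property
  to $f(e_0)$. Comparing leading symbols shows that every such element has the form $\alpha e_0 + z$ with
  \<open>\<alpha>\<close>, \<open>z\<close> central (\<open>loc_fin_affine\<close>), and integrality of the eigenvalues forces $\alpha = \pm 1$ (\<open>f_gen0\<close>). The automorphism
  $e_n \mapsto - e_{-n}$, $c \mapsto - c$ reduces to $\alpha = 1$, so that \<open>f\<close> respects the grading by weight; it also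
  maps the centre to itself. For a point \<open>\<chi>\<close> of the coefficient ring and a scalar \<open>h\<close>, reduce the algebra
  modulo the left ideal generated by $e_0 - h$, the kernel of \<open>\<chi>\<close> and the words in positive letters of total weight
  at least \<open>m\<close>.
  The weight spaces of this quotient are finite dimensional, with a dimension that does not depend on
  \<open>h\<close> and \<open>\<chi>\<close>, and \<open>f\<close> induces surjections between them. These are therefore bijective, and the
  kernel of \<open>f\<close> lies in all the left ideals in question, hence it is zero (\<open>kernel_trivial\<close>).

  For $W_+$, composing \<open>f\<close> with an automorphism $e_i \mapsto e_i - \chi(e_i)$ makes \<open>f\<close> compatible with the augmentation. Then \<open>f\<close> preserves
  every power of the augmentation ideal. These powers have finite codimension since $W_+$ is generated
  by $e_1$ and $e_2$, so \<open>f\<close> induces bijections on the quotients, and the kernel of \<open>f\<close> lies in the intersection of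
  all powers, which is zero because the \<open>n\<close>-th power lives in weights at least \<open>n\<close> (\<open>augmented_epi_injective\<close>).
\<close>

section \<open>Sorting words modulo the Virasoro relations\<close>

abbreviation coef :: "('b \<Rightarrow>\<^sub>0 'c::zero) \<Rightarrow> 'b \<Rightarrow> 'c" where
  "coef \<equiv> Poly_Mapping.lookup"

abbreviation supp :: "('b \<Rightarrow>\<^sub>0 'c::zero) \<Rightarrow> 'b set" where
  "supp \<equiv> Poly_Mapping.keys"

definition cst :: "'z \<Rightarrow> 'b::monoid_add \<Rightarrow>\<^sub>0 'z::comm_ring_1" where
  "cst r = Poly_Mapping.single 0 r"

lemma cst_simps [simp]:
  "cst 0 = 0" "cst 1 = 1" "cst (r + s) = cst r + cst s" "cst (r * s) = cst r * cst s"
  "cst (- r) = - cst r" "cst (r - s) = cst r - cst s"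
  by (simp_all add: cst_def single_add mult_single single_uminus single_diff)

lemma cst_of_int [simp]: "cst (of_int n) = of_int n"
  by (simp add: cst_def single_of_int)

lemma coef_cst_mult [simp]: "coef (cst r * p) M = r * coef p M"
proof (induction p rule: poly_mapping_linear_induct)
  case (single i a)
  then show ?case by (simp add: cst_def mult_single lookup_single when_def)
qed (simp_all add: lookup_add distrib_left)

lemma coef_of_int_mult:
  fixes p :: "'b::monoid_add \<Rightarrow>\<^sub>0 'z::comm_ring_1"
  shows "coef (of_int n * p) M = of_int n * coef p M"
  using coef_cst_mult[of "of_int n" p M] by simp

lemma cst_mult_single: "cst r * Poly_Mapping.single M s = Poly_Mapping.single M (r * s)"
  by (simp add: cst_def mult_single)

type_synonym 'z sym = "int multiset \<Rightarrow>\<^sub>0 'z"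

definition mon :: "int multiset \<Rightarrow> 'z::comm_ring_1 sym" where
  "mon M = Poly_Mapping.single M 1"

fun inversions :: "int list \<Rightarrow> nat" where
  "inversions [] = 0"
| "inversions (x # xs) = length (filter (\<lambda>y. y < x) xs) + inversions xs"

lemma inversions_swap: "a < b \<Longrightarrow> inversions (u @ b # a # v) = Suc (inversions (u @ a # b # v))"
  by (induction u) auto

definition smaller :: "(int list \<times> int list) set" where
  "smaller = measures [length, inversions]"

lemma wf_smaller: "wf smaller"
  by (simp add: smaller_def)

lemma trans_smaller: "trans smaller"
  by (auto simp: smaller_def intro!: transI)

lemma smaller_simps:
  "a < b \<Longrightarrow> (u @ a # b # v, u @ b # a # v) \<in> smaller"
  "length w < length w' \<Longrightarrow> (w, w') \<in> smaller"
  by (simp_all add: smaller_def inversions_swap)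

definition first_descent :: "int list \<Rightarrow> int list \<times> int \<times> int \<times> int list" where
  "first_descent w = (SOME (u, b, a, v). w = u @ b # a # v \<and> a < b \<and> sorted (u @ [b]))"

lemma ex_first_descent:
  "\<not> sorted w \<Longrightarrow> \<exists>u b a v. w = u @ b # a # v \<and> a < b \<and> sorted (u @ [b])"
proof (induction w rule: rev_induct)
  case (snoc x w)
  show ?case
  proof (cases "sorted w")
    case True
    with snoc.prems have "w \<noteq> []" by auto
    then obtain w' y where w: "w = w' @ [y]" by (metis rev_exhaust)
    have "x < y"
    proof (rule ccontr)
      assume "\<not> x < y"
      then have "\<forall>t\<in>set w. t \<le> x" using True by (auto simp: w sorted_append)
      then show False using True snoc.prems by (auto simp: sorted_append)
    qed
    then show ?thesis using True w by (intro exI[of _ w'] exI[of _ y] exI[of _ x] exI[of _ "[]"]) simp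
  next
    case False
    then obtain u b a v where "w = u @ b # a # v" "a < b" "sorted (u @ [b])" using snoc.IH by blast
    then show ?thesis by (intro exI[of _ u] exI[of _ b] exI[of _ a] exI[of _ "v @ [x]"]) simp
  qed
qed simp

lemma first_descent:
  assumes "\<not> sorted w" "first_descent w = (u, b, a, v)"
  shows "w = u @ b # a # v" "a < b" "sorted (u @ [b])"
proof -
  from ex_first_descent[OF assms(1)] have "\<exists>t. case t of (u, b, a, v) \<Rightarrow> w = u @ b # a # v \<and> a < b \<and> sorted (u @ [b])"
    by auto
  from someI_ex[OF this] assms(2) show "w = u @ b # a # v" "a < b" "sorted (u @ [b])"
    by (simp_all add: first_descent_def)
qed

lemma descent_smaller:
  assumes "\<not> sorted w" "first_descent w = (u, b, a, v)"
  shows "(u @ a # b # v, w) \<in> smaller" "(u @ (a + b) # v, w) \<in> smaller" "(u @ v, w) \<in> smaller"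
  unfolding first_descent(1)[OF assms]
  by (auto intro: smaller_simps(1)[OF first_descent(2)[OF assms]] smaller_simps(2))

text \<open>
  The central term of $[e_b, e_a]$, with \<open>\<delta>\<close> standing for $c / 12$.
\<close>

definition cocyc :: "'z \<Rightarrow> int \<Rightarrow> int \<Rightarrow> 'z::comm_ring_1" where
  "cocyc \<delta> b a = (if a + b = 0 then of_int (b ^ 3 - b) * \<delta> else 0)"

function nf :: "'z \<Rightarrow> int list \<Rightarrow> 'z::comm_ring_1 sym" where
  "nf \<delta> w = (if sorted w then mon (mset w) else
     case first_descent w of (u, b, a, v) \<Rightarrow>
       nf \<delta> (u @ a # b # v) + (of_int (a - b) * nf \<delta> (u @ (a + b) # v) + cst (cocyc \<delta> b a) * nf \<delta> (u @ v)))"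
  by auto
termination
proof (relation "inv_image smaller snd")
  show "wf (inv_image smaller snd)" by (intro wf_inv_image wf_smaller)
qed (auto simp: in_inv_image intro: descent_smaller[OF _ sym])

declare nf.simps [simp del]

definition nf_bracket :: "'z \<Rightarrow> int list \<Rightarrow> int \<Rightarrow> int \<Rightarrow> int list \<Rightarrow> 'z::comm_ring_1 sym" where
  "nf_bracket \<delta> u b a v = of_int (a - b) * nf \<delta> (u @ (a + b) # v) + cst (cocyc \<delta> b a) * nf \<delta> (u @ v)"

lemma nf_sorted: "sorted w \<Longrightarrow> nf \<delta> w = mon (mset w)"
  by (subst nf.simps) simp

lemma nf_first_descent:
  "\<not> sorted w \<Longrightarrow> first_descent w = (u, b, a, v) \<Longrightarrow> nf \<delta> w = nf \<delta> (u @ a # b # v) + nf_bracket \<delta> u b a v"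
  by (subst nf.simps) (simp add: nf_bracket_def)

lemma cocyc_anti: "cocyc \<delta> a b = - cocyc \<delta> b a"
proof (cases "a + b = 0")
  case True
  then have "a = - b" by simp
  then show ?thesis by (simp add: cocyc_def algebra_simps)
qed (simp add: cocyc_def add.commute)

lemma nf_bracket_anti: "nf_bracket \<delta> u a b v = - nf_bracket \<delta> u b a v"
  by (simp add: nf_bracket_def cocyc_anti[of \<delta> a b] add.commute[of b a] algebra_simps)

lemma cocyc_jacobi:
  "of_int (b - c) * cocyc \<delta> (b + c) a + of_int (a - b) * cocyc \<delta> (a + b) c
    + of_int (a - c) * cocyc \<delta> b (a + c) = 0"
proof (cases "a + b + c = 0")
  case True
  then have a: "a = - b - c" by simp
  have "(b - c) * ((b + c) ^ 3 - (b + c)) + (a - b) * ((a + b) ^ 3 - (a + b)) + (a - c) * (b ^ 3 - b) = 0"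
    unfolding a by (simp add: algebra_simps power3_eq_cube)
  then have "of_int ((b - c) * ((b + c) ^ 3 - (b + c)) + (a - b) * ((a + b) ^ 3 - (a + b)) + (a - c) * (b ^ 3 - b)) * \<delta> = 0"
    by simp
  then have "of_int (b - c) * (of_int ((b + c) ^ 3 - (b + c)) * \<delta>) + of_int (a - b) * (of_int ((a + b) ^ 3 - (a + b)) * \<delta>)
      + of_int (a - c) * (of_int (b ^ 3 - b) * \<delta>) = 0"
    by (simp only: of_int_add of_int_mult distrib_right mult.assoc)
  moreover have "a + (b + c) = 0" "c + (a + b) = 0" "a + c + b = 0" using True by auto
  ultimately show ?thesis unfolding cocyc_def by (simp only: if_True refl)
next
  case False
  then have "a + (b + c) \<noteq> 0" "c + (a + b) \<noteq> 0" "a + c + b \<noteq> 0" by auto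
  then show ?thesis by (simp add: cocyc_def)
qed

text \<open>
  The confluence of the two ways to reverse \<open>c b a\<close>, isolated as an identity in a
  commutative ring. The letters \<open>P\<close> and \<open>R\<close> stand for words with one
  bracket contracted and \<open>S\<close> for double contractions, whose combination in
  \<open>J\<close> vanishes by the Jacobi identity.
\<close>

lemma nf_overlap:
  fixes W :: "'r::comm_ring_1"
  assumes "W = X1 + (\<beta> * P1 + k1 * Qa)" "X1 = X2 + (\<gamma> * P2 + k2 * Qb)" "X2 = X3 + (\<alpha> * P3 + k3 * Qc)"
    "Y1 = Y2 + (\<gamma> * R1 + k2 * Qb)" "Y2 = X3 + (\<beta> * R2 + k1 * Qa)"
    "P1 = R2 + S1" "P3 = R3 + S3" "P2 = R1 + S2"
    and J: "\<beta> * S1 + \<alpha> * S3 + \<gamma> * S2 = 0"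
  shows "W = Y1 + (\<alpha> * R3 + k3 * Qc)"
proof -
  have "W - (Y1 + (\<alpha> * R3 + k3 * Qc)) = \<beta> * S1 + \<alpha> * S3 + \<gamma> * S2"
    unfolding assms(1-8) by (simp add: algebra_simps)
  then show ?thesis using J by simp
qed

lemma coef_mon_size: "size M \<noteq> size K \<Longrightarrow> coef (mon K) M = 0"
  by (auto simp: mon_def lookup_single when_def)

text \<open>
  The defining recursion swaps the first descent only; the point is that it holds at every position.
  Disjoint swaps commute by induction, and for adjacent ones the two results agree by
  \<open>nf_overlap\<close>. This carries the Poincare--Birkhoff--Witt theorem: the normal form is a
  function on the quotient by the relations.
\<close>

lemma nf_swap:
  "nf \<delta> (u @ b # a # v) = nf \<delta> (u @ a # b # v) + nf_bracket \<delta> u b a v"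
proof -
  have "\<forall>u b a v. w = u @ b # a # v \<longrightarrow> a < b \<longrightarrow>
      nf \<delta> (u @ b # a # v) = nf \<delta> (u @ a # b # v) + nf_bracket \<delta> u b a v" for w
  proof (induction w rule: wf_induct[OF wf_smaller])
    case (1 w)
    have IH: "nf \<delta> (u @ b # a # v) = nf \<delta> (u @ a # b # v) + nf_bracket \<delta> u b a v"
      if "(u @ b # a # v, w) \<in> smaller" "(u @ a # b # v, w) \<in> smaller" for u b a v
    proof (cases b a rule: linorder_cases)
      case greater
      then show ?thesis using 1 that by blast
    next
      case less
      then have "nf \<delta> (u @ a # b # v) = nf \<delta> (u @ b # a # v) + nf_bracket \<delta> u a b v"
        using 1 that by blast
      then show ?thesis by (simp add: nf_bracket_anti[of \<delta> u a b])
    next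
      case equal
      then show ?thesis by (simp add: nf_bracket_def cocyc_def)
    qed
    have shorter: "nf \<delta> (u @ b # a # v) = nf \<delta> (u @ a # b # v) + nf_bracket \<delta> u b a v"
      if "length u + length v + 2 < length w" for u b a v
      using that by (intro IH smaller_simps) simp_all
    show ?case
    proof (intro allI impI)
      fix u b a v assume w: "w = u @ b # a # v" and ab: "a < b"
      then have ns: "\<not> sorted w" by (auto simp: sorted_append)
      obtain u0 b0 a0 v0 where fd: "first_descent w = (u0, b0, a0, v0)" by (metis prod_cases4)
      note w0 = first_descent[OF ns fd]
      have red: "nf \<delta> w = nf \<delta> (u0 @ a0 # b0 # v0) + nf_bracket \<delta> u0 b0 a0 v0"
        by (rule nf_first_descent[OF ns fd])
      have le: "length u0 \<le> length u"
      proof (rule ccontr)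
        assume "\<not> ?thesis"
        then have len: "Suc (length u) < length (u0 @ [b0])" by simp
        have w0': "w = (u0 @ [b0]) @ a0 # v0" using w0(1) by simp
        have "(u0 @ [b0]) ! length u = w ! length u" "(u0 @ [b0]) ! Suc (length u) = w ! Suc (length u)"
          by (simp_all only: w0' nth_append[of "u0 @ [b0]"] len Suc_lessD[OF len] if_True)
        moreover have "w ! length u = b" "w ! Suc (length u) = a" unfolding w by (simp_all add: nth_append)
        ultimately have "b \<le> a" using sorted_nth_mono[OF w0(3), of "length u" "Suc (length u)"] len by simp
        then show False using ab by simp
      qed
      from w w0(1) have eq: "u0 @ b0 # a0 # v0 = u @ b # a # v" by simp
      consider "u0 = u" | c where "u = u0 @ [c]" | m where "u = u0 @ b0 # a0 # m"
      proof -
        from le eq obtain m where u: "u = u0 @ m"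
          by (metis append_eq_append_conv_if append_take_drop_id)
        with eq have "b0 # a0 # v0 = m @ b # a # v" by simp
        then show ?thesis using u that by (cases m rule: list.exhaust; cases "tl m") auto
      qed
      then have "nf \<delta> w = nf \<delta> (u @ a # b # v) + nf_bracket \<delta> u b a v"
      proof cases
        case 1
        then show ?thesis using eq red by simp
      next
        case (2 c)
        then have [simp]: "b0 = c" "a0 = b" "v0 = a # v" using eq by auto
        have bc: "b < c" using w0(2) by simp
        let ?u = u0
        have w: "w = u0 @ c # b # a # v" using w0(1) by simp
        have s: "(u0 @ b # c # a # v, w) \<in> smaller" "(u0 @ c # a # b # v, w) \<in> smaller"
          unfolding w using smaller_simps(1)[OF bc, of u0 "a # v"] smaller_simps(1)[OF ab, of "u0 @ [c]" v] by simp_all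
        note tr = trans_smaller
        have s2: "(u0 @ b # a # c # v, w) \<in> smaller" "(u0 @ a # c # b # v, w) \<in> smaller"
          using smaller_simps(1)[of a c "u0 @ [b]" v] smaller_simps(1)[of a c u0 "b # v"] ab bc s
          by (auto intro: transD[OF tr])
        have s3: "(u0 @ a # b # c # v, w) \<in> smaller"
          using smaller_simps(1)[OF ab, of u0 "c # v"] s2(1) by (auto intro: transD[OF tr])
        have 1: "nf \<delta> w = nf \<delta> (u0 @ b # c # a # v) + nf_bracket \<delta> u0 c b (a # v)" using red by simp
        have 2: "nf \<delta> (u0 @ b # c # a # v) = nf \<delta> (u0 @ b # a # c # v) + nf_bracket \<delta> (u0 @ [b]) c a v"
          using IH[of "u0 @ [b]" c a v] s s2 by simp
        have 3: "nf \<delta> (u0 @ b # a # c # v) = nf \<delta> (u0 @ a # b # c # v) + nf_bracket \<delta> u0 b a (c # v)"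
          using IH[of "u0" b a "c # v"] s2 s3 by simp
        have 4: "nf \<delta> (u0 @ c # a # b # v) = nf \<delta> (u0 @ a # c # b # v) + nf_bracket \<delta> u0 c a (b # v)"
          using IH[of "u0" c a "b # v"] s s2 by simp
        have 5: "nf \<delta> (u0 @ a # c # b # v) = nf \<delta> (u0 @ a # b # c # v) + nf_bracket \<delta> (u0 @ [a]) c b v"
          using IH[of "u0 @ [a]" c b v] s2 s3 by simp
        have len: "length u0 + length v + 2 < length w" using w by simp
        note 6 = shorter[OF len, of "b + c" a] shorter[OF len, of "a + b" c] shorter[OF len, of b "a + c"]
        have J: "of_int (b - c) * nf_bracket \<delta> u0 (b + c) a v + of_int (a - b) * nf_bracket \<delta> u0 (a + b) c v
            + of_int (a - c) * nf_bracket \<delta> u0 b (a + c) v = 0" (is "?J = 0")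
        proof -
          have "?J = of_int ((b - c) * (a - (b + c)) + (a - b) * (c - (a + b)) + (a - c) * (a + c - b))
                * nf \<delta> (u0 @ (a + b + c) # v)
              + cst (of_int (b - c) * cocyc \<delta> (b + c) a + of_int (a - b) * cocyc \<delta> (a + b) c
                + of_int (a - c) * cocyc \<delta> b (a + c)) * nf \<delta> (u0 @ v)"
            unfolding nf_bracket_def cst_simps cst_of_int
            by (simp add: ac_simps distrib_left distrib_right)
          also have "(b - c) * (a - (b + c)) + (a - b) * (c - (a + b)) + (a - c) * (a + c - b) = 0"
            by (simp add: algebra_simps)
          finally show ?thesis by (simp only: cocyc_jacobi) simp
        qed
        have "nf \<delta> w = nf \<delta> (u0 @ c # a # b # v) + nf_bracket \<delta> (u0 @ [c]) b a v"
          unfolding nf_bracket_def[of \<delta> "u0 @ [c]"] append_assoc append.simps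
          by (rule nf_overlap[where \<beta> = "of_int (b - c)" and \<alpha> = "of_int (a - b)" and \<gamma> = "of_int (a - c)"])
            (use 1 2 3 4 5 6 J in \<open>simp_all add: nf_bracket_def[of \<delta> "u0 @ [b]"] nf_bracket_def[of \<delta> "u0 @ [a]"]
              nf_bracket_def[of \<delta> u0 c] nf_bracket_def[of \<delta> u0 b a] add.commute[of b c] add.commute[of a c]\<close>)
        then show ?thesis by (simp add: \<open>u = u0 @ [c]\<close>)
      next
        case (3 m)
        then have [simp]: "v0 = m @ b # a # v" using eq by simp
        have w: "w = u0 @ b0 # a0 # m @ b # a # v" using w0(1) by simp
        note tr = trans_smaller
        have s: "(u0 @ a0 # b0 # m @ b # a # v, w) \<in> smaller" "(u0 @ b0 # a0 # m @ a # b # v, w) \<in> smaller"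
          unfolding w using smaller_simps(1)[OF w0(2), of u0 "m @ b # a # v"]
             smaller_simps(1)[OF ab, of "u0 @ b0 # a0 # m" v] by simp_all
        have s2: "(u0 @ a0 # b0 # m @ a # b # v, w) \<in> smaller"
          using smaller_simps(1)[OF ab, of "u0 @ a0 # b0 # m" v] s(1) by (auto intro: transD[OF tr])
        have 1: "nf \<delta> w = nf \<delta> (u0 @ a0 # b0 # m @ b # a # v) + nf_bracket \<delta> u0 b0 a0 (m @ b # a # v)"
          using red by simp
        have 2: "nf \<delta> (u0 @ a0 # b0 # m @ b # a # v)
            = nf \<delta> (u0 @ a0 # b0 # m @ a # b # v) + nf_bracket \<delta> (u0 @ a0 # b0 # m) b a v"
          using IH[of "u0 @ a0 # b0 # m" b a v] s s2 by simp
        have 3: "nf \<delta> (u0 @ b0 # a0 # m @ a # b # v)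
            = nf \<delta> (u0 @ a0 # b0 # m @ a # b # v) + nf_bracket \<delta> u0 b0 a0 (m @ a # b # v)"
          using IH[of "u0" b0 a0 "m @ a # b # v"] s s2 by simp
        have 4: "nf \<delta> (u0 @ x # m @ b # a # v)
            = nf \<delta> (u0 @ x # m @ a # b # v) + nf_bracket \<delta> (u0 @ x # m) b a v" for x
          using shorter[of "u0 @ x # m" v b a] by (simp add: w)
        have 5: "nf \<delta> (u0 @ m @ b # a # v)
            = nf \<delta> (u0 @ m @ a # b # v) + nf_bracket \<delta> (u0 @ m) b a v"
          using shorter[of "u0 @ m" v b a] by (simp add: w)
        have 6: "nf \<delta> (u0 @ b0 # a0 # m @ x # v)
            = nf \<delta> (u0 @ a0 # b0 # m @ x # v) + nf_bracket \<delta> u0 b0 a0 (m @ x # v)" for x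
          using shorter[of "u0" "m @ x # v" b0 a0] by (simp add: w)
        have 7: "nf \<delta> (u0 @ b0 # a0 # m @ v)
            = nf \<delta> (u0 @ a0 # b0 # m @ v) + nf_bracket \<delta> u0 b0 a0 (m @ v)"
          using shorter[of "u0" "m @ v" b0 a0] by (simp add: w)
        show ?thesis unfolding 1 2 3 \<open>u = u0 @ b0 # a0 # m\<close> append_assoc append_Cons
          by (simp add: nf_bracket_def 3 4 5 6 7 algebra_simps)
      qed
      then show "nf \<delta> (u @ b # a # v) = nf \<delta> (u @ a # b # v) + nf_bracket \<delta> u b a v"
        by (simp add: w)
    qed
  qed
  then have *: "a < b \<Longrightarrow> nf \<delta> (u @ b # a # v) = nf \<delta> (u @ a # b # v) + nf_bracket \<delta> u b a v" for u b a v
    by blast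
  show ?thesis
  proof (cases b a rule: linorder_cases)
    case less
    from *[OF this, of u v] show ?thesis by (simp add: nf_bracket_anti[of \<delta> u a b])
  qed (simp_all add: * nf_bracket_def cocyc_def)
qed

text \<open>
  Every contraction of a bracket shortens the word, so up to smaller monomials sorting is
  commutative multiplication.
\<close>

lemma nf_leading: "M \<in> supp (nf \<delta> w - mon (mset w)) \<Longrightarrow> size M < length w"
proof (induction \<delta> w arbitrary: M rule: nf.induct)
  case (1 \<delta> w)
  show ?case
  proof (cases "sorted w")
    case True
    then show ?thesis using 1 by (simp add: nf_sorted)
  next
    case False
    obtain u b a v where fd: "first_descent w = (u, b, a, v)" by (metis prod_cases4)
    note w = first_descent[OF False fd]
    note IH = "1.IH"[OF False fd[symmetric] refl refl]
    show ?thesis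
    proof (rule ccontr)
      assume large: "\<not> size M < length w"
      have 1: "coef (nf \<delta> (u @ a # b # v)) M = coef (mon (mset w)) M"
        using IH(1)[of M] large by (auto simp: w(1) in_keys_iff lookup_minus add_mset_commute)
      have 2: "coef (nf \<delta> (u @ (a + b) # v)) M = 0"
        using IH(2)[of M] large by (auto simp: w(1) in_keys_iff lookup_minus coef_mon_size)
      have 3: "coef (nf \<delta> (u @ v)) M = 0"
        using IH(3)[of M] large by (auto simp: w(1) in_keys_iff lookup_minus coef_mon_size)
      have "coef (of_int (a - b) * nf \<delta> (u @ (a + b) # v)) M = 0"
        by (simp only: coef_of_int_mult 2 mult_zero_right)
      then have "coef (nf \<delta> w) M = coef (mon (mset w)) M"
        using 1 3 by (simp add: nf_first_descent[OF False fd] nf_bracket_def lookup_add)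
      then show False using "1.prems" by (simp add: in_keys_iff lookup_minus)
    qed
  qed
qed

section \<open>Additive extension from the monomials\<close>

lemma supp_induct [consumes 1, case_names zero single add]:
  assumes "supp p \<subseteq> S"
    and "P 0" "\<And>M r. M \<in> S \<Longrightarrow> P (Poly_Mapping.single M r)" "\<And>p q. P p \<Longrightarrow> P q \<Longrightarrow> P (p + q)"
  shows "P (p :: 'b \<Rightarrow>\<^sub>0 'c::comm_monoid_add)"
proof -
  have "P (\<Sum>i\<in>F. Poly_Mapping.single i (f i))" if "finite F" "F \<subseteq> S" for F f
    using that by (induction F rule: finite_induct) (auto intro: assms)
  moreover have "p = (\<Sum>i\<in>supp p. Poly_Mapping.single i (coef p i))"
    by (rule poly_mapping_eqI) (auto simp: lookup_sum lookup_single when_def sum.delta in_keys_iff)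
  ultimately show ?thesis using assms(1) by (metis finite_keys)
qed

definition ext_sum :: "('b \<Rightarrow> 'c \<Rightarrow> 'd) \<Rightarrow> ('b \<Rightarrow>\<^sub>0 'c::comm_monoid_add) \<Rightarrow> 'd::comm_monoid_add" where
  "ext_sum h p = (\<Sum>i\<in>supp p. h i (coef p i))"

lemma ext_sum_superset:
  assumes "\<And>i. h i 0 = 0" "finite S" "supp p \<subseteq> S"
  shows "ext_sum h p = (\<Sum>i\<in>S. h i (coef p i))"
  unfolding ext_sum_def using assms by (intro sum.mono_neutral_left) (auto simp: in_keys_iff)

lemma ext_sum_0 [simp]: "ext_sum h 0 = 0"
  by (simp add: ext_sum_def)

lemma ext_sum_single [simp]: "h i 0 = 0 \<Longrightarrow> ext_sum h (Poly_Mapping.single i r) = h i r"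
  by (simp add: ext_sum_def)

lemma ext_sum_add:
  assumes "\<And>i. h i 0 = 0" "\<And>i r s. h i (r + s) = h i r + h i s"
  shows "ext_sum h (p + q) = ext_sum h p + ext_sum h q"
proof -
  let ?S = "supp p \<union> supp q"
  have "supp (p + q) \<subseteq> ?S" by (rule Poly_Mapping.keys_add)
  then show ?thesis
    using assms by (simp add: ext_sum_superset[where S = ?S] lookup_add sum.distrib)
qed

section \<open>Additive endomorphisms\<close>

text \<open>
  Composition of additive maps, packaged as a type so that it forms a ring in the sense of the type
  class \<open>ring_1\<close>.
\<close>

typedef (overloaded) 'v endo = "{f :: 'v::ab_group_add \<Rightarrow> 'v. \<forall>x y. f (x + y) = f x + f y}"
  morphisms app Endo
  by (rule exI[of _ "\<lambda>_. 0"]) simp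

lemma app_add [simp]: "app f (x + y) = app f x + app f y"
  using app[of f] by simp

lemma app_zero [simp]: "app f 0 = 0"
  using app_add[of f 0 0] by simp

lemma app_uminus [simp]: "app f (- x) = - app f x"
  using app_add[of f x "- x"] by (simp add: eq_neg_iff_add_eq_0 add.commute)

lemma app_Endo: "(\<And>x y. f (x + y) = f x + f y) \<Longrightarrow> app (Endo f) = f"
  by (simp add: Endo_inverse)

lemma endo_eqI: "(\<And>x. app f x = app g x) \<Longrightarrow> f = g"
  by (metis app_inverse ext)

instantiation endo :: ("{ab_group_add, zero_neq_one}") ring_1
begin

definition "0 = Endo (\<lambda>_. 0)"
definition "1 = Endo (\<lambda>x. x)"
definition "f + g = Endo (\<lambda>x. app f x + app g x)"
definition "- f = Endo (\<lambda>x. - app f x)"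
definition "(f :: 'a endo) - g = f + - g"
definition "f * g = Endo (\<lambda>x. app f (app g x))"

lemma app_ring [simp]:
  shows "app 0 x = (0 :: 'a)" "app 1 x = (x :: 'a)" "app (f + g) x = app f x + app g (x :: 'a)" "app (- f) x = - app f (x :: 'a)"
    and "app (f * g) x = app f (app g (x :: 'a))"
proof -
  show "app 0 x = (0 :: 'a)" unfolding zero_endo_def by (subst app_Endo) simp_all
  show "app 1 x = x" unfolding one_endo_def by (subst app_Endo) simp_all
  show "app (f + g) x = app f x + app g x" unfolding plus_endo_def by (subst app_Endo) (simp_all add: ac_simps)
  show "app (- f) x = - app f x" unfolding uminus_endo_def by (subst app_Endo) simp_all
  show "app (f * g) x = app f (app g x)" unfolding times_endo_def by (subst app_Endo) simp_all
qed

lemma app_minus [simp]: "app (f - g) x = app f x - app g (x :: 'a)"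
  unfolding minus_endo_def by simp

instance
proof
  show "(0 :: 'a endo) \<noteq> 1"
    using app_ring(1)[of 1] app_ring(2)[of 1] zero_neq_one by metis
qed (rule endo_eqI, simp add: add.assoc add.commute; fail)+

end

section \<open>The Virasoro operators on the symmetric algebra\<close>

definition sym_scale :: "'z \<Rightarrow> 'z::comm_ring_1 sym endo" where
  "sym_scale r = Endo ((*) (cst r))"

text \<open>
  Left multiplication by $e_i$, read off on the basis of sorted words.
\<close>

definition sym_gen :: "'z \<Rightarrow> int \<Rightarrow> 'z::comm_ring_1 sym endo" where
  "sym_gen \<delta> i = Endo (ext_sum (\<lambda>M r. cst r * nf \<delta> (i # sorted_list_of_multiset M)))"

lemma app_sym_scale [simp]: "app (sym_scale r) p = cst r * p"
  unfolding sym_scale_def by (subst app_Endo) (simp_all add: distrib_left)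

lemma app_sym_gen: "app (sym_gen \<delta> i) p = ext_sum (\<lambda>M r. cst r * nf \<delta> (i # sorted_list_of_multiset M)) p"
  unfolding sym_gen_def by (subst app_Endo) (simp_all add: ext_sum_add distrib_right)

lemma sym_scale_hom:
  "sym_scale (r + s) = sym_scale r + sym_scale s" "sym_scale (r * s) = sym_scale r * sym_scale s"
  "sym_scale 1 = 1"
  by (auto intro!: endo_eqI simp: distrib_right mult.assoc)

lemma mon_eq_nf: "mon M = nf \<delta> (sorted_list_of_multiset M)"
  by (simp add: nf_sorted)

lemma single_eq_cst_mon: "Poly_Mapping.single M r = cst r * mon M"
  by (simp add: mon_def cst_mult_single)

lemma sym_scale_gen: "sym_scale r * sym_gen \<delta> i = sym_gen \<delta> i * sym_scale r"
proof (rule endo_eqI)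
  fix p
  show "app (sym_scale r * sym_gen \<delta> i) p = app (sym_gen \<delta> i * sym_scale r) p"
  proof (induction p rule: poly_mapping_linear_induct)
    case (single M s)
    show ?case by (simp add: app_sym_gen cst_mult_single mult.assoc)
  qed (simp_all add: distrib_left)
qed

lemma app_sym_gen_cst: "app (sym_gen \<delta> i) (cst r * p) = cst r * app (sym_gen \<delta> i) p"
  using arg_cong[OF sym_scale_gen[of r \<delta> i], of "\<lambda>f. app f p"] by simp

lemma app_sym_gen_nf: "app (sym_gen \<delta> i) (nf \<delta> w) = nf \<delta> (i # w)"
proof (induction \<delta> w rule: nf.induct)
  case (1 \<delta> w)
  show ?case
  proof (cases "sorted w")
    case True
    then show ?thesis
      by (simp add: nf_sorted mon_def app_sym_gen sorted_list_of_multiset_mset sorted_sort_id)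
  next
    case False
    obtain u b a v where fd: "first_descent w = (u, b, a, v)" by (metis prod_cases4)
    note IH = "1.IH"[OF False fd[symmetric] refl refl]
    have "app (sym_gen \<delta> i) (nf \<delta> w) = nf \<delta> ((i # u) @ a # b # v) + nf_bracket \<delta> (i # u) b a v"
      unfolding nf_first_descent[OF False fd] nf_bracket_def
      using IH by (simp only: app_add app_sym_gen_cst flip: cst_of_int) simp
    also have "\<dots> = nf \<delta> ((i # u) @ b # a # v)" by (rule nf_swap[symmetric])
    finally show ?thesis by (simp add: first_descent(1)[OF False fd])
  qed
qed

text \<open>
  Since every element of the symmetric algebra is a combination of normal forms, this is
  \<open>nf_swap\<close> at the front of a word.
\<close>

lemma sym_gen_rel:
  "sym_gen \<delta> b * sym_gen \<delta> a =
    sym_gen \<delta> a * sym_gen \<delta> b + sym_scale (of_int (a - b)) * sym_gen \<delta> (a + b) + sym_scale (cocyc \<delta> b a)"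
  (is "?l = ?r")
proof (rule endo_eqI)
  fix p
  show "app ?l p = app ?r p"
  proof (induction p rule: poly_mapping_linear_induct)
    case (single M s)
    have swap: "nf \<delta> (b # a # w) = nf \<delta> (a # b # w) + nf_bracket \<delta> [] b a w" for w
      using nf_swap[of \<delta> "[]" b a w] by simp
    show ?case
      unfolding single_eq_cst_mon mon_eq_nf[of _ \<delta>]
      by (simp add: app_sym_gen_cst app_sym_gen_nf swap[of "sorted_list_of_multiset M"] nf_bracket_def algebra_simps)
  qed (simp_all add: algebra_simps)
qed

lemma app_sym_gen_word: "app (prod_list (map (sym_gen \<delta>) w)) 1 = nf \<delta> w"
proof (induction w)
  case Nil
  show ?case by (simp add: nf_sorted mon_def)
qed (simp add: app_sym_gen_nf)

lemma sorting_induct [case_names sorted descent]: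
  assumes "\<And>w. sorted w \<Longrightarrow> P w"
    and "\<And>u b a v. a < b \<Longrightarrow> sorted (u @ [b]) \<Longrightarrow>
      nf \<delta> (u @ b # a # v) = nf \<delta> (u @ a # b # v) + nf_bracket \<delta> u b a v \<Longrightarrow>
      P (u @ a # b # v) \<Longrightarrow> P (u @ (a + b) # v) \<Longrightarrow> P (u @ v) \<Longrightarrow> P (u @ b # a # v)"
  shows "P w"
proof (induction w rule: wf_induct[OF wf_smaller])
  case (1 w)
  show ?case
  proof (cases "sorted w")
    case True
    then show ?thesis by (rule assms(1))
  next
    case False
    obtain u b a v where fd: "first_descent w = (u, b, a, v)" by (metis prod_cases4)
    show ?thesis unfolding first_descent(1)[OF False fd]
      by (rule assms(2)) (use first_descent[OF False fd] descent_smaller[OF False fd] 1 nf_swap in auto)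
  qed
qed

lemma length_sorted_list_of_multiset [simp]: "length (sorted_list_of_multiset M) = size M"
  by (metis mset_sorted_list_of_multiset size_mset)

lemma supp_cst_mult: "supp (cst r * p) \<subseteq> supp p"
  by (auto simp: in_keys_iff)

lemma supp_of_int_mult:
  fixes p :: "'b::monoid_add \<Rightarrow>\<^sub>0 'z::comm_ring_1"
  shows "supp (of_int n * p) \<subseteq> supp p"
  using supp_cst_mult[of "of_int n" p] by simp

lemma supp_nf_bracket:
  "M \<in> supp (nf_bracket \<delta> u b a v) \<Longrightarrow>
    M \<in> supp (nf \<delta> (u @ (a + b) # v)) \<or> a + b = 0 \<and> M \<in> supp (nf \<delta> (u @ v))"
proof -
  assume "M \<in> supp (nf_bracket \<delta> u b a v)"
  then consider "M \<in> supp (of_int (a - b) * nf \<delta> (u @ (a + b) # v))" | "M \<in> supp (cst (cocyc \<delta> b a) * nf \<delta> (u @ v))"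
    unfolding nf_bracket_def by (auto dest!: subsetD[OF Poly_Mapping.keys_add])
  then show ?thesis
  proof cases
    case 1
    from subsetD[OF supp_of_int_mult this] show ?thesis by (rule disjI1)
  next
    case 2
    then have "cocyc \<delta> b a \<noteq> 0" by (metis cst_simps(1) mult_zero_left keys_zero empty_iff)
    then have "a + b = 0" by (metis cocyc_def)
    then show ?thesis using 2 by (auto dest!: subsetD[OF supp_cst_mult])
  qed
qed

lemma supp_mon: "supp (mon M) = {M}"
  by (simp add: mon_def)

lemma nf_weight: "M \<in> supp (nf \<delta> w) \<Longrightarrow> sum_mset M = sum_list w"
proof (induction w arbitrary: M rule: sorting_induct[where \<delta> = \<delta>])
  case (sorted w)
  then show ?case by (simp add: nf_sorted supp_mon sum_mset_sum_list)
next
  case (descent u b a v)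
  from descent.prems have "M \<in> supp (nf \<delta> (u @ a # b # v)) \<or> M \<in> supp (nf_bracket \<delta> u b a v)"
    unfolding descent.hyps(3) by (auto dest!: subsetD[OF Poly_Mapping.keys_add])
  then show ?case
    using descent.IH supp_nf_bracket[of M \<delta> u b a v] by fastforce
qed

text \<open>
  Spanned by monomials of degree less than \<open>n\<close>: the error terms in all statements about
  leading symbols.
\<close>

definition low :: "nat \<Rightarrow> 'z::comm_ring_1 sym \<Rightarrow> bool" where
  "low n p \<longleftrightarrow> (\<forall>M\<in>supp p. size M < n)"

lemma low_simps [simp]: "low n 0" "low n (- p) \<longleftrightarrow> low n p" "low n (mon M) \<longleftrightarrow> size M < n"
  by (simp_all add: low_def supp_mon)

lemma low_add: "low n p \<Longrightarrow> low n q \<Longrightarrow> low n (p + q)"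
  using Poly_Mapping.keys_add[of p q] by (auto simp: low_def)

lemma low_diff: "low n p \<Longrightarrow> low n q \<Longrightarrow> low n (p - q)"
  using low_add[of n p "- q"] by simp

lemma low_cst: "low n p \<Longrightarrow> low n (cst r * p)"
  using supp_cst_mult[of r p] by (auto simp: low_def)

lemma low_mono: "low n p \<Longrightarrow> n \<le> m \<Longrightarrow> low m p"
  by (auto simp: low_def intro: less_le_trans)

lemma low_mult: "low (Suc m) p \<Longrightarrow> low n q \<Longrightarrow> low (m + n) (p * q)"
  using keys_mult[of p q] by (fastforce simp: low_def)

lemma low_mult': "low m p \<Longrightarrow> low (Suc n) q \<Longrightarrow> low (m + n) (p * q)"
  using low_mult[of n q m p] by (simp add: ac_simps)

lemma low_induct [consumes 1, case_names zero mon add]: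
  assumes "low n p"
    and "P 0" "\<And>M r. size M < n \<Longrightarrow> P (cst r * mon M)" "\<And>p q. P p \<Longrightarrow> P q \<Longrightarrow> P (p + q)"
  shows "P p"
proof (rule supp_induct[of p "{M. size M < n}"])
  show "supp p \<subseteq> {M. size M < n}" using assms(1) by (auto simp: low_def)
qed (use assms in \<open>simp_all add: single_eq_cst_mon\<close>)

definition homog :: "nat \<Rightarrow> 'z::comm_ring_1 sym \<Rightarrow> bool" where
  "homog n p \<longleftrightarrow> (\<forall>M\<in>supp p. size M = n)"

lemma homog_simps [simp]: "homog n 0" "homog n (mon M) \<longleftrightarrow> size M = n"
  by (simp_all add: homog_def supp_mon)

lemma homog_add: "homog n p \<Longrightarrow> homog n q \<Longrightarrow> homog n (p + q)"
  using Poly_Mapping.keys_add[of p q] by (auto simp: homog_def)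

lemma homog_cst: "homog n p \<Longrightarrow> homog n (cst r * p)"
  using supp_cst_mult[of r p] by (auto simp: homog_def)

lemma homog_mult: "homog m p \<Longrightarrow> homog n q \<Longrightarrow> homog (m + n) (p * q)"
  using keys_mult[of p q] by (fastforce simp: homog_def)

lemma homog_low: "homog n p \<Longrightarrow> low (Suc n) p"
  by (auto simp: homog_def low_def)

lemma homog_induct [consumes 1, case_names zero mon add]:
  assumes "homog n p"
    and "P 0" "\<And>M r. size M = n \<Longrightarrow> P (cst r * mon M)" "\<And>p q. P p \<Longrightarrow> P q \<Longrightarrow> P (p + q)"
  shows "P p"
proof (rule supp_induct[of p "{M. size M = n}"])
  show "supp p \<subseteq> {M. size M = n}" using assms(1) by (auto simp: homog_def)
qed (use assms in \<open>simp_all add: single_eq_cst_mon\<close>)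

lemma sym_induct [case_names zero mon add]:
  assumes "P 0" "\<And>M r. P (cst r * mon M)" "\<And>p q. P p \<Longrightarrow> P q \<Longrightarrow> P (p + q)"
  shows "P p"
  by (induction p rule: poly_mapping_linear_induct) (use assms in \<open>simp_all add: single_eq_cst_mon\<close>)

lemma mon_add: "mon (M + M') = mon M * mon M'"
  by (simp add: mon_def mult_single)

lemma mon_empty [simp]: "mon {#} = 1"
  by (simp add: mon_def)

lemma mon_add_mset: "mon (add_mset i M) = mon {#i#} * mon M"
  using mon_add[of "{#i#}" M] by simp

lemma ext_sum_cst_add [simp]:
  fixes p :: "'z::comm_ring_1 sym"
  shows "ext_sum (\<lambda>M r. cst r * (f M :: 'z sym)) (p + q) = ext_sum (\<lambda>M r. cst r * f M) p + ext_sum (\<lambda>M r. cst r * f M) q"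
  by (rule ext_sum_add) (simp_all add: distrib_right)

lemma ext_sum_cst_mon [simp]:
  fixes f :: "int multiset \<Rightarrow> 'z::comm_ring_1 sym"
  shows "ext_sum (\<lambda>M r. cst r * f M) (cst s * mon M) = cst s * f M"
  by (simp flip: single_eq_cst_mon)

lemma ext_sum_cst_mon1 [simp]:
  fixes f :: "int multiset \<Rightarrow> 'z::comm_ring_1 sym"
  shows "ext_sum (\<lambda>M r. cst r * f M) (mon M) = f M"
  using ext_sum_cst_mon[of f 1 M] by simp

definition deriv_mon :: "(int \<Rightarrow> 'z sym) \<Rightarrow> int multiset \<Rightarrow> 'z::comm_ring_1 sym" where
  "deriv_mon g M = (\<Sum>j\<in>#M. g j * mon (M - {#j#}))"

text \<open>
  The derivation of the symmetric algebra that sends the generator with index \<open>j\<close> to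
  \<open>g j\<close>. Commutators act on leading symbols through such derivations.
\<close>

definition sym_deriv :: "(int \<Rightarrow> 'z sym) \<Rightarrow> 'z::comm_ring_1 sym \<Rightarrow> 'z sym" where
  "sym_deriv g p = ext_sum (\<lambda>M r. cst r * deriv_mon g M) p"

lemma sym_deriv_simps [simp]:
  "sym_deriv g 0 = 0" "sym_deriv g (p + q) = sym_deriv g p + sym_deriv g q"
  "sym_deriv g (mon M) = deriv_mon g M" "sym_deriv g (cst r * mon M) = cst r * deriv_mon g M"
  by (simp_all add: sym_deriv_def)

lemma deriv_mon_empty [simp]: "deriv_mon g {#} = 0"
  by (simp add: deriv_mon_def)

lemma deriv_mon_add_mset: "deriv_mon g (add_mset i M) = g i * mon M + mon {#i#} * deriv_mon g M"
proof -
  have "(\<Sum>j\<in>#M. g j * mon (add_mset i M - {#j#})) = (\<Sum>j\<in>#M. mon {#i#} * (g j * mon (M - {#j#})))"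
    by (rule arg_cong[of _ _ sum_mset], rule image_mset_cong)
      (auto simp: mon_add_mset[of i "M - {#_#}", symmetric] mult.left_commute dest: multi_member_split)
  then show ?thesis by (simp add: deriv_mon_def sum_mset_distrib_left)
qed

lemma deriv_mon_single [simp]: "deriv_mon g {#i#} = g i"
  by (simp add: deriv_mon_add_mset)

lemma deriv_mon_add: "deriv_mon g (M + M') = deriv_mon g M * mon M' + mon M * deriv_mon g M'"
proof (induction M)
  case (add i M)
  then show ?case by (simp add: deriv_mon_add_mset mon_add mon_add_mset[of i M] algebra_simps)
qed simp

lemma sym_deriv_mult: "sym_deriv g (p * q) = sym_deriv g p * q + p * sym_deriv g q"
proof (induction p rule: sym_induct)
  case (mon M r)
  show ?case
  proof (induction q rule: sym_induct)
    case (mon M' s)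
    have "cst r * mon M * (cst s * mon M') = cst (r * s) * mon (M + M')"
      by (simp add: mon_add ac_simps)
    then show ?case by (simp only: sym_deriv_simps deriv_mon_add) (simp add: algebra_simps)
  qed (simp_all add: algebra_simps)
qed (simp_all add: algebra_simps)

lemma sym_deriv_cst: "sym_deriv g (cst r * p) = cst r * sym_deriv g p"
  using sym_deriv_mult[of g "cst r * mon {#}" p] by (simp only: sym_deriv_simps) simp

definition below :: "int \<Rightarrow> 'z::comm_ring_1 sym \<Rightarrow> bool" where
  "below t p \<longleftrightarrow> (\<forall>M\<in>supp p. \<forall>i\<in>#M. i < t)"

lemma below_simps [simp]: "below t 0" "below t 1" "below t (cst r)" "below t (mon M) \<longleftrightarrow> (\<forall>i\<in>#M. i < t)"
  by (simp_all add: below_def supp_mon cst_def)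

lemma below_add: "below t p \<Longrightarrow> below t q \<Longrightarrow> below t (p + q)"
  using Poly_Mapping.keys_add[of p q] by (auto simp: below_def)

lemma below_mult: "below t p \<Longrightarrow> below t q \<Longrightarrow> below t (p * q)"
  using keys_mult[of p q] by (fastforce simp: below_def)

lemma below_power: "below t p \<Longrightarrow> below t (p ^ n)"
  by (induction n) (auto intro: below_mult)

lemma below_mono: "below t p \<Longrightarrow> t \<le> s \<Longrightarrow> below s p"
  by (fastforce simp: below_def)

lemma below_sum_mset: "(\<And>i. i \<in># M \<Longrightarrow> below t (f i)) \<Longrightarrow> below t (\<Sum>i\<in>#M. f i)"
  by (induction M) (auto intro: below_add)

lemma below_induct [consumes 1, case_names zero mon add]:
  assumes "below t p"
    and "P 0" "\<And>M r. \<forall>i\<in>#M. i < t \<Longrightarrow> P (cst r * mon M)" "\<And>p q. P p \<Longrightarrow> P q \<Longrightarrow> P (p + q)"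
  shows "P p"
proof (rule supp_induct[of p "{M. \<forall>i\<in>#M. i < t}"])
  show "supp p \<subseteq> {M. \<forall>i\<in>#M. i < t}" using assms(1) by (auto simp: below_def)
qed (use assms in \<open>simp_all add: single_eq_cst_mon\<close>)

lemma below_sym_deriv:
  assumes "below t p" "\<And>j. j < t \<Longrightarrow> below s (g j)" "t \<le> s"
  shows "below s (sym_deriv g p)"
  using assms(1)
proof (induction p rule: below_induct)
  case (mon M r)
  have "below s (deriv_mon g M)" unfolding deriv_mon_def
  proof (rule below_sum_mset)
    fix j assume j: "j \<in># M"
    have "below s (mon (M - {#j#}))"
      unfolding below_simps
    proof
      fix i assume "i \<in># M - {#j#}"
      then have "i \<in># M" by (rule in_diffD)
      then show "i < s" using mon assms(3) by fastforce
    qed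
    then show "below s (g j * mon (M - {#j#}))" using assms(2)[of j] mon j by (intro below_mult) auto
  qed
  then show ?case by (simp add: below_mult)
qed (auto intro: below_add)

text \<open>
  The Poisson bracket of a monomial with the generator of index \<open>t\<close>.
\<close>

definition bracket_gen :: "int \<Rightarrow> int multiset \<Rightarrow> 'z::comm_ring_1 sym" where
  "bracket_gen t M = (\<Sum>i\<in>#M. of_int (t - i) * mon (add_mset (i + t) (M - {#i#})))"

lemma bracket_gen_deriv: "bracket_gen t M = deriv_mon (\<lambda>i. of_int (t - i) * mon {#i + t#}) M"
  unfolding bracket_gen_def deriv_mon_def by (simp add: mon_add_mset[of "_ + t" "M - {#_#}"] mult.assoc)

section \<open>Algebras with a Poincare--Birkhoff--Witt basis\<close>

definition comm :: "'a::ring \<Rightarrow> 'a \<Rightarrow> 'a" where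
  "comm x y = x * y - y * x"

lemma comm_simps:
  "comm (x + y) z = comm x z + comm y z" "comm x (y + z) = comm x y + comm x z"
  "comm x (y * z) = comm x y * z + y * comm x z" "comm (x * y) z = x * comm y z + comm x z * y"
  "comm 0 x = 0" "comm x 0 = 0"
  by (simp_all add: comm_def algebra_simps)

text \<open>
  A ring containing a copy of the Virasoro operators over the coefficients \<open>'z\<close>, with
  linearly independent sorted words. Independence is expressed by the map \<open>sbl\<close>, which
  recovers the leading monomial of every word. This form does not refer to an ordering of the
  letters, so it is inherited by the family $-e_{-n}$, whose sorted words are different.
\<close>

locale vir_pbw =
  fixes scal :: "'z::{idom, ring_char_0} \<Rightarrow> 'a::ring_1" and gen :: "int \<Rightarrow> 'a"
    and \<delta> :: 'z and sbl :: "'a \<Rightarrow> 'z sym"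
  assumes scal_add [simp]: "scal (r + s) = scal r + scal s"
    and scal_mult [simp]: "scal (r * s) = scal r * scal s"
    and scal_1 [simp]: "scal 1 = 1"
    and scal_gen: "scal r * gen i = gen i * scal r"
    and gen_rel: "gen b * gen a = gen a * gen b + scal (of_int (a - b)) * gen (a + b) + scal (cocyc \<delta> b a)"
    and sbl_add: "sbl (x + y) = sbl x + sbl y"
    and sbl_scal: "sbl (scal r * x) = cst r * sbl x"
    and sbl_word: "low (length w) (sbl (prod_list (map gen w)) - mon (mset w))"
begin

lemma scal_0 [simp]: "scal 0 = 0"
  using scal_add[of 0 0] by simp

lemma scal_uminus [simp]: "scal (- r) = - scal r"
  using scal_add[of r "- r"] by (simp add: eq_neg_iff_add_eq_0 add.commute)

lemma scal_diff [simp]: "scal (r - s) = scal r - scal s"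
  using scal_add[of r "- s"] by simp

lemma scal_of_int [simp]: "scal (of_int n) = of_int n"
proof -
  have "scal (of_nat m) = of_nat m" for m by (induction m) simp_all
  then show ?thesis by (cases n) simp_all
qed

definition word :: "int list \<Rightarrow> 'a" where
  "word w = prod_list (map gen w)"

lemma word_simps [simp]: "word [] = 1" "word (i # w) = gen i * word w" "word (v @ w) = word v * word w"
  by (simp_all add: word_def)

lemma scal_word: "scal r * word w = word w * scal r"
proof (induction w)
  case (Cons i w)
  have "scal r * word (i # w) = gen i * (scal r * word w)" by (simp add: scal_gen flip: mult.assoc)
  then show ?case by (simp add: Cons mult.assoc)
qed simp

abbreviation smon :: "int multiset \<Rightarrow> 'a" where
  "smon M \<equiv> word (sorted_list_of_multiset M)"

definition emb :: "'z sym \<Rightarrow> 'a" where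
  "emb p = ext_sum (\<lambda>M r. scal r * smon M) p"

lemma emb_simps [simp]:
  "emb 0 = 0" "emb (p + q) = emb p + emb q" "emb (cst r * mon M) = scal r * smon M"
  unfolding emb_def by (simp, rule ext_sum_add, simp_all add: distrib_right flip: single_eq_cst_mon)

lemma emb_mon [simp]: "emb (mon M) = smon M"
  using emb_simps(3)[of 1 M] by simp

lemma emb_cst [simp]: "emb (cst r * p) = scal r * emb p"
proof (induction p rule: sym_induct)
  case (mon M s)
  show ?case using emb_simps(3)[of "r * s" M] by (simp add: mult.assoc)
qed (simp_all add: distrib_left)

lemma emb_of_int_mult: "emb (of_int n * p) = of_int n * emb p"
  using emb_cst[of "of_int n" p] by simp

lemma emb_uminus [simp]: "emb (- p) = - emb p"
  using emb_simps(2)[of p "- p"] by (simp add: eq_neg_iff_add_eq_0 add.commute)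

lemma emb_diff [simp]: "emb (p - q) = emb p - emb q"
  using emb_simps(2)[of p "- q"] by simp

lemma scal_emb: "scal r * emb p = emb p * scal r"
proof (induction p rule: sym_induct)
  case (mon M s)
  have "scal r * (scal s * smon M) = scal (r * s) * smon M" by (simp add: mult.assoc)
  also have "\<dots> = scal s * (scal r * smon M)" by (simp only: mult.commute[of r s] scal_mult mult.assoc)
  finally show ?case by (simp only: emb_simps scal_word[of r] mult.assoc)
qed (simp_all add: distrib_left distrib_right)

lemma word_eq_emb_nf: "word w = emb (nf \<delta> w)"
proof (induction w rule: sorting_induct[where \<delta> = \<delta>])
  case (sorted w)
  then show ?case by (simp add: nf_sorted sorted_list_of_multiset_mset sorted_sort_id)
next
  case (descent u b a v)
  have "word (u @ b # a # v) = word u * (gen b * gen a) * word v" by (simp add: mult.assoc)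
  also have "\<dots> = word (u @ a # b # v) + scal (of_int (a - b)) * word (u @ (a + b) # v)
      + scal (cocyc \<delta> b a) * word (u @ v)"
    unfolding gen_rel[of b a] using scal_word[of "cocyc \<delta> b a" u] scal_word[of "of_int (a - b)" u]
    by (simp add: distrib_left distrib_right mult.assoc del: scal_of_int of_int_diff) (simp flip: mult.assoc del: scal_of_int of_int_diff)
  also have "\<dots> = emb (nf \<delta> (u @ b # a # v))"
    unfolding descent.hyps(3) nf_bracket_def emb_simps(2) emb_of_int_mult emb_cst descent.IH scal_of_int
    by (simp add: add.assoc)
  finally show ?case .
qed

lemma sbl_0 [simp]: "sbl 0 = 0"
  using sbl_add[of 0 0] by simp

lemma sbl_emb: "low (Suc n) p \<Longrightarrow> low n (sbl (emb p) - p)"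
proof (induction p rule: low_induct)
  case (mon M r)
  have "low n (sbl (smon M) - mon M)"
    using low_mono[OF sbl_word[of "sorted_list_of_multiset M"], of n] mon by (simp add: word_def)
  then show ?case using low_cst[of n _ r] by (simp add: sbl_scal flip: right_diff_distrib)
next
  case (add p q)
  then have "low n ((sbl (emb p) - p) + (sbl (emb q) - q))" by (intro low_add)
  then show ?case by (simp add: sbl_add algebra_simps)
qed simp

text \<open>
  The leading part of a combination of sorted words can be read off with \<open>sbl\<close>, so a
  nonzero combination cannot vanish.
\<close>

lemma emb_eq_0: "emb p = 0 \<Longrightarrow> p = 0"
proof -
  assume 0: "emb p = 0"
  have "low n p \<Longrightarrow> p = 0" for n
  proof (induction n)
    case 0
    then have "supp p = {}" by (auto simp: low_def)
    then show ?case by simp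
  next
    case (Suc n)
    then show ?case using sbl_emb[OF Suc.prems] 0 by simp
  qed
  moreover have "low (Suc (\<Sum>M\<in>supp p. size M)) p"
    by (auto simp: low_def less_Suc_eq_le intro: member_le_sum)
  ultimately show ?thesis by blast
qed

lemma emb_inj: "emb p = emb q \<Longrightarrow> p = q"
  using emb_eq_0[of "p - q"] by simp

definition alg :: "'a set" where
  "alg = range emb"

definition co :: "'a \<Rightarrow> 'z sym" where
  "co x = (THE p. emb p = x)"

lemma co_emb [simp]: "co (emb p) = p"
  unfolding co_def by (rule the_equality) (auto dest: emb_inj)

lemma emb_in_alg [simp]: "emb p \<in> alg"
  by (simp add: alg_def)

lemma emb_co [simp]: "x \<in> alg \<Longrightarrow> emb (co x) = x"
  by (auto simp: alg_def)

lemma word_in_alg [simp]: "word w \<in> alg"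
  by (simp add: word_eq_emb_nf)

lemma co_word [simp]: "co (word w) = nf \<delta> w"
  by (simp add: word_eq_emb_nf)

lemma algE: assumes "x \<in> alg" obtains p where "x = emb p"
  using assms by (auto simp: alg_def)

lemma alg_closed [simp]:
  "0 \<in> alg" "1 \<in> alg" "gen i \<in> alg" "scal r \<in> alg"
proof -
  show "0 \<in> alg" "1 \<in> alg" "gen i \<in> alg"
    using emb_in_alg[of 0] word_in_alg[of "[]"] word_in_alg[of "[i]"] by simp_all
  have "scal r = emb (cst r * mon {#})" by (simp only: emb_simps) simp
  then show "scal r \<in> alg" by simp
qed

lemma alg_add [simp]: "x \<in> alg \<Longrightarrow> y \<in> alg \<Longrightarrow> x + y \<in> alg"
  by (metis algE emb_in_alg emb_simps(2))

lemma alg_uminus [simp]: "x \<in> alg \<Longrightarrow> - x \<in> alg"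
  by (metis algE emb_in_alg emb_uminus)

lemma alg_diff [simp]: "x \<in> alg \<Longrightarrow> y \<in> alg \<Longrightarrow> x - y \<in> alg"
  using alg_add[of x "- y"] by simp

lemma alg_induct [consumes 1, case_names zero smon add]:
  assumes "x \<in> alg" "P 0" "\<And>M r. P (scal r * smon M)"
    "\<And>x y. x \<in> alg \<Longrightarrow> y \<in> alg \<Longrightarrow> P x \<Longrightarrow> P y \<Longrightarrow> P (x + y)"
  shows "P x"
proof -
  have "P (emb p)" for p by (induction p rule: sym_induct) (auto intro: assms)
  then show ?thesis using assms(1) by (auto simp: alg_def)
qed

lemma scal_alg: "x \<in> alg \<Longrightarrow> scal r * x = x * scal r"
  by (metis algE scal_emb)

lemma alg_scal_mult [simp]: "x \<in> alg \<Longrightarrow> scal r * x \<in> alg"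
  by (metis algE emb_cst emb_in_alg)

lemma smon_mult: "scal r * smon M * (scal s * smon M') = scal (r * s) * word (sorted_list_of_multiset M @ sorted_list_of_multiset M')"
  using scal_word[of s "sorted_list_of_multiset M"] by (simp add: mult.assoc) (simp flip: mult.assoc)

lemma alg_mult [simp]: "x \<in> alg \<Longrightarrow> y \<in> alg \<Longrightarrow> x * y \<in> alg"
proof (induction x rule: alg_induct)
  case (smon M r)
  from smon(1) show ?case
  proof (induction y rule: alg_induct)
    case (smon M' s)
    show ?case unfolding smon_mult by (rule alg_scal_mult) (rule word_in_alg)
  qed (simp_all add: distrib_left)
qed (simp_all add: distrib_right)

lemma alg_comm [simp]: "x \<in> alg \<Longrightarrow> y \<in> alg \<Longrightarrow> comm x y \<in> alg"
  by (simp add: comm_def)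

lemma co_simps [simp]:
  "co 0 = 0"
  "x \<in> alg \<Longrightarrow> y \<in> alg \<Longrightarrow> co (x + y) = co x + co y"
  "x \<in> alg \<Longrightarrow> y \<in> alg \<Longrightarrow> co (x - y) = co x - co y"
  "x \<in> alg \<Longrightarrow> co (- x) = - co x"
  "x \<in> alg \<Longrightarrow> co (scal r * x) = cst r * co x"
  using co_emb[of 0] by (simp_all, (metis algE co_emb emb_simps(2) emb_diff emb_uminus emb_cst)+)

lemma co_1 [simp]: "co 1 = 1"
  using co_word[of "[]"] by (simp add: nf_sorted)

lemma co_gen [simp]: "co (gen i) = mon {#i#}"
  using co_word[of "[i]"] by (simp add: nf_sorted)

lemma co_scal [simp]: "co (scal r) = cst r"
  using co_simps(5)[of 1 r] by simp

lemma co_eq_iff: "x \<in> alg \<Longrightarrow> y \<in> alg \<Longrightarrow> co x = co y \<longleftrightarrow> x = y"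
  by (metis emb_co)

lemma co_smon [simp]: "co (smon M) = mon M"
  by (simp add: nf_sorted)

text \<open>
  The element \<open>x\<close> has degree at most \<open>n\<close> and its symbol in degree
  \<open>n\<close> is \<open>p\<close>, which may be zero.
\<close>

definition lead :: "nat \<Rightarrow> 'a \<Rightarrow> 'z sym \<Rightarrow> bool" where
  "lead n x p \<longleftrightarrow> x \<in> alg \<and> homog n p \<and> low n (co x - p)"

lemma lead_0 [simp]: "lead n 0 0"
  by (simp add: lead_def)

lemma lead_add: "lead n x p \<Longrightarrow> lead n y q \<Longrightarrow> lead n (x + y) (p + q)"
  using low_add[of n "co x - p" "co y - q"] by (auto simp: lead_def homog_add add_diff_add)

lemma lead_scal: "lead n x p \<Longrightarrow> lead n (scal r * x) (cst r * p)"
  using low_cst[of n "co x - p" r] by (simp add: lead_def homog_cst right_diff_distrib)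

lemma lead_low: "x \<in> alg \<Longrightarrow> low n (co x) \<Longrightarrow> lead n x 0"
  by (simp add: lead_def)

lemma lead_bound: "lead n x p \<Longrightarrow> low (Suc n) (co x)"
  using low_add[OF low_mono[of n "co x - p" "Suc n"] homog_low[of n p]] by (simp add: lead_def)

lemma lead_weaken: "lead k x p \<Longrightarrow> k < n \<Longrightarrow> lead n x 0"
  using lead_bound[of k x p] by (auto simp: lead_def intro: low_mono)

lemma lead_word: "lead (length w) (word w) (mon (mset w))"
  using nf_leading[of _ \<delta> w] by (auto simp: lead_def low_def)

lemma lead_gen: "lead 1 (gen i) (mon {#i#})"
  using lead_word[of "[i]"] by simp

lemma lead_unique: "lead n x p \<Longrightarrow> lead n x q \<Longrightarrow> p = q"
proof -
  assume *: "lead n x p" "lead n x q"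
  then have "low n ((co x - q) - (co x - p))" by (intro low_diff[of n "co x - q" "co x - p"]) (simp_all add: lead_def)
  then have "low n (p - q)" by simp
  moreover have "homog n (p - q)"
    using * homog_add[of n p "- q"] by (simp add: lead_def homog_def)
  ultimately have "supp (p - q) = {}" by (auto simp: low_def homog_def)
  then show ?thesis by simp
qed

lemma lead_mult:
  assumes "lead m x p" "lead n y q"
  shows "lead (m + n) (x * y) (p * q)"
proof -
  have *: "low (m + n) (co (emb p * emb q) - p * q)" if "low (Suc m) p" "low (Suc n) q" for p q
    using that(1)
  proof (induction p rule: low_induct)
    case (mon M r)
    from that(2) show ?case
    proof (induction q rule: low_induct)
      case (mon M' s)
      let ?w = "sorted_list_of_multiset M @ sorted_list_of_multiset M'"
      have "low (m + n) (nf \<delta> ?w - mon (M + M'))"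
        using lead_word[of ?w] mon \<open>size M < Suc m\<close> unfolding lead_def co_word mset_append mset_sorted_list_of_multiset
        by (auto intro: low_mono)
      then have "low (m + n) (cst (r * s) * (nf \<delta> ?w - mon (M + M')))" by (rule low_cst)
      also have "\<dots> = co (emb (cst r * mon M) * emb (cst s * mon M')) - (cst r * mon M) * (cst s * mon M')"
        unfolding emb_simps smon_mult co_simps(5)[OF word_in_alg] co_word mon_add by (simp add: algebra_simps)
      finally show ?case .
    next
      case (add q q')
      from low_add[OF add] show ?case by (simp add: distrib_left algebra_simps del: emb_cst)
    qed simp
  next
    case (add p p')
    from low_add[OF add] show ?case by (simp add: distrib_right algebra_simps)
  qed simp
  note A = assms[unfolded lead_def]
  have "low (m + n) (co x * co y - p * q)"
  proof -
    have "low (m + n) (co x * (co y - q))" "low (m + n) ((co x - p) * q)"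
      using assms[THEN lead_bound] A by (auto intro: low_mult low_mult' homog_low)
    from low_add[OF this] show ?thesis by (simp add: algebra_simps)
  qed
  moreover have "low (m + n) (co (x * y) - co x * co y)"
    using *[OF assms[THEN lead_bound]] A by simp
  ultimately have "low (m + n) (co (x * y) - p * q)"
    using low_add by fastforce
  then show ?thesis using A by (simp add: lead_def homog_mult)
qed

lemma comm_gen: "comm (gen i) (gen t) = of_int (t - i) * gen (i + t) + scal (cocyc \<delta> i t)"
  using gen_rel[of i t] by (simp add: comm_def add.commute)

lemma lead_of_int: "lead n x p \<Longrightarrow> lead n (of_int k * x) (of_int k * p)"
  using lead_scal[of n x p "of_int k"] by simp

lemma lead_comm_gens: "lead 1 (comm (gen i) (gen t)) (of_int (t - i) * mon {#i + t#})"
proof -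
  have "lead 1 (of_int (t - i) * gen (i + t)) (of_int (t - i) * mon {#i + t#})"
    by (rule lead_of_int) (rule lead_gen)
  moreover have "lead 1 (scal (cocyc \<delta> i t)) 0"
    by (rule lead_low) (simp_all add: low_def cst_def)
  ultimately show ?thesis using lead_add unfolding comm_gen by fastforce
qed

lemma comm_scal: "x \<in> alg \<Longrightarrow> y \<in> alg \<Longrightarrow> comm (scal r * x) y = scal r * comm x y"
  "x \<in> alg \<Longrightarrow> y \<in> alg \<Longrightarrow> comm y (scal r * x) = scal r * comm y x"
  using scal_alg[of y r] by (simp_all add: comm_def right_diff_distrib mult.assoc) (simp_all flip: mult.assoc)

lemma lead_comm_gen_word: "lead (length w) (comm (word w) (gen t)) (bracket_gen t (mset w))"
proof (induction w)
  case (Cons i w)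
  have "lead (Suc (length w)) (gen i * comm (word w) (gen t) + comm (gen i) (gen t) * word w)
      (mon {#i#} * bracket_gen t (mset w) + of_int (t - i) * mon {#i + t#} * mon (mset w))"
    using lead_mult[OF lead_gen Cons] lead_mult[OF lead_comm_gens lead_word] by (intro lead_add) auto
  then show ?case by (simp add: comm_simps bracket_gen_deriv deriv_mon_add_mset add.commute)
qed (simp add: comm_def bracket_gen_deriv)

definition bracket :: "'z sym \<Rightarrow> int \<Rightarrow> 'z sym" where
  "bracket p t = ext_sum (\<lambda>M r. cst r * bracket_gen t M) p"

lemma bracket_simps [simp]:
  "bracket 0 t = 0" "bracket (p + q) t = bracket p t + bracket q t"
  "bracket (cst r * mon M) t = cst r * bracket_gen t M" "bracket (mon M) t = bracket_gen t M"
  by (simp_all add: bracket_def)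

lemma lead_comm_gen:
  assumes "lead d x p"
  shows "lead d (comm x (gen t)) (bracket p t)"
proof -
  have "homog d p" using assms by (simp add: lead_def)
  then have 1: "lead d (comm (emb p) (gen t)) (bracket p t)"
  proof (induction p rule: homog_induct)
    case (mon M r)
    then show ?case
      using lead_scal[OF lead_comm_gen_word[of "sorted_list_of_multiset M" t], of r] by (simp add: comm_scal)
  qed (auto intro: lead_add simp: comm_simps)
  have "low d (co x - p)" using assms by (simp add: lead_def)
  then have 2: "lead d (comm (emb (co x - p)) (gen t)) 0"
  proof (induction rule: low_induct)
    case (mon M r)
    then show ?case
      using lead_scal[OF lead_weaken[OF lead_comm_gen_word[of "sorted_list_of_multiset M" t], of d], of r]
      by (simp add: comm_scal)
  next
    case (add p q)
    then show ?case using lead_add by (fastforce simp: comm_simps)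
  qed (simp add: comm_simps)
  have "comm x (gen t) = comm (emb p) (gen t) + comm (emb (co x - p)) (gen t)"
    using assms by (simp add: lead_def comm_def algebra_simps)
  then show ?thesis using lead_add[OF 1 2] by simp
qed

text \<open>
  The commutator with \<open>x\<close> is a derivation, so its effect on symbols is determined by
  the symbols of the commutators with the generators.
\<close>

lemma lead_comm:
  assumes x: "x \<in> alg" and g: "\<And>t. lead (Suc d) (comm x (gen t)) (g t)" and y: "lead n y q"
  shows "lead (n + d) (comm x y) (sym_deriv g q)"
proof -
  have w: "lead (length w + d) (comm x (word w)) (deriv_mon g (mset w))" for w
  proof (induction w)
    case (Cons i w)
    have "lead (Suc (length w + d)) (comm x (gen i) * word w + gen i * comm x (word w))
        (g i * mon (mset w) + mon {#i#} * deriv_mon g (mset w))"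
      using lead_mult[OF lead_gen Cons] lead_mult[OF g lead_word] by (intro lead_add) (auto simp: add.commute)
    then show ?case by (simp add: comm_simps deriv_mon_add_mset)
  qed (simp add: comm_def)
  have "homog n q" using y by (simp add: lead_def)
  then have 1: "lead (n + d) (comm x (emb q)) (sym_deriv g q)"
  proof (induction q rule: homog_induct)
    case (mon M r)
    then show ?case
      using lead_scal[OF w[of "sorted_list_of_multiset M"], of r] x by (simp add: comm_scal)
  qed (auto intro: lead_add simp: comm_simps)
  have "low n (co y - q)" using y by (simp add: lead_def)
  then have 2: "lead (n + d) (comm x (emb (co y - q))) 0"
  proof (induction rule: low_induct)
    case (mon M r)
    then show ?case
      using lead_scal[OF lead_weaken[OF w[of "sorted_list_of_multiset M"], of "n + d"], of r] x
      by (simp add: comm_scal)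
  next
    case (add p q)
    then show ?case using lead_add by (fastforce simp: comm_simps)
  qed (simp add: comm_simps)
  have "comm x y = comm x (emb q) + comm x (emb (co y - q))"
    using y by (simp add: lead_def comm_def algebra_simps)
  then show ?thesis using lead_add[OF 1 2] by simp
qed

end

section \<open>Locally finite elements and the centre\<close>

lemma deriv_mon_diff:
  "deriv_mon (\<lambda>i. g i - c * h i) M = deriv_mon g M - c * deriv_mon h M"
proof (induction M)
  case (add i M)
  show ?case by (simp only: deriv_mon_add_mset add right_diff_distrib) (simp add: algebra_simps)
qed simp

lemma sym_deriv_diff:
  "sym_deriv (\<lambda>i. g i - c * h i) p = sym_deriv g p - c * sym_deriv h p"
  by (induction p rule: sym_induct) (simp_all add: deriv_mon_diff algebra_simps)

lemma coef_of_nat_mult: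
  fixes p :: "'b::monoid_add \<Rightarrow>\<^sub>0 'z::comm_ring_1"
  shows "coef (of_nat n * p) M = of_nat n * coef p M"
  using coef_of_int_mult[of "int n" p M] by simp

lemma cst_of_nat: "cst (of_nat n) = of_nat n"
  using cst_of_int[of "int n"] by simp

abbreviation partial :: "int \<Rightarrow> 'z::comm_ring_1 sym \<Rightarrow> 'z sym" where
  "partial N \<equiv> sym_deriv (\<lambda>i. if i = N then 1 else 0)"

lemma deriv_mon_partial: "deriv_mon (\<lambda>i. if i = N then 1 else 0) M = of_nat (count M N) * mon (M - {#N#})"
proof -
  have "deriv_mon (\<lambda>i. if i = N then 1 else 0) M = (\<Sum>j\<in>#M. if j = N then mon (M - {#N#}) else 0)"
    unfolding deriv_mon_def by (rule arg_cong[of _ _ sum_mset], rule image_mset_cong) simp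
  then show ?thesis by (simp add: sum_mset_delta mult.commute)
qed

lemma coef_partial: "coef (partial N p) K = of_nat (Suc (count K N)) * coef p (add_mset N K)"
proof (induction p rule: sym_induct)
  case (mon M r)
  have "coef (mon (M - {#N#})) K * of_nat (count M N) = of_nat (Suc (count K N)) * coef (mon M) (add_mset N K)"
  proof (cases "M = add_mset N K")
    case False
    then have "N \<notin># M \<or> M - {#N#} \<noteq> K" by (auto dest: multi_member_split)
    then show ?thesis using False by (auto simp: mon_def lookup_single when_def not_in_iff)
  qed (simp add: mon_def)
  from arg_cong[OF this, of "(*) r"] show ?case
    by (simp add: deriv_mon_partial coef_of_nat_mult mult.commute mult.left_commute del: of_nat_Suc)
qed (simp_all add: lookup_add algebra_simps)

lemma partial_neq_0:
  fixes p :: "'z::{idom, ring_char_0} sym"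
  assumes "M \<in> supp p" "N \<in># M"
  shows "partial N p \<noteq> 0"
proof
  assume "partial N p = 0"
  then have "of_nat (Suc (count (M - {#N#}) N)) * coef p (add_mset N (M - {#N#})) = 0"
    unfolding coef_partial[symmetric] by simp
  then show False using assms by (simp add: in_keys_iff count_eq_zero_iff del: of_nat_Suc)
qed

lemma coef_mult_mon: "coef (q * mon {#i#}) (add_mset i K) = coef q K"
proof (induction q rule: sym_induct)
  case (mon M r)
  have "cst r * mon M * mon {#i#} = cst r * mon (add_mset i M)" by (simp add: mon_add_mset[of i M] ac_simps)
  then show ?case by (simp add: mon_def lookup_single when_def)
qed (simp_all add: lookup_add distrib_right)

lemma below_mult_mon: "below t (q * mon {#t#}) \<Longrightarrow> q = 0"
proof (rule poly_mapping_eqI)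
  fix K assume "below t (q * mon {#t#})"
  then have "add_mset t K \<notin> supp (q * mon {#t#})" by (auto simp: below_def)
  then show "coef q K = coef 0 K" using coef_mult_mon[of q t K] by (simp add: in_keys_iff)
qed

lemma below_uminus [simp]: "below t (- p) \<longleftrightarrow> below t p"
  by (simp add: below_def)

lemma below_diff: "below t p \<Longrightarrow> below t q \<Longrightarrow> below t (p - q)"
  using below_add[of t p "- q"] by simp

lemma below_of_int [simp]: "below t (of_int n)"
  using below_simps(3)[of t "of_int n"] by simp

text \<open>
  A product with the generator of index \<open>t\<close> cannot be cancelled by terms that only
  involve smaller indices.
\<close>

lemma below_exceeds:
  assumes "below t r" "q \<noteq> 0"
  obtains M where "M \<in> supp (q * mon {#t#} + r)" "\<not> (\<forall>i\<in>#M. i < t)"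
proof -
  have "\<not> below t (q * mon {#t#} + r)"
    using below_diff[of t "q * mon {#t#} + r" r] below_mult_mon[of t q] assms by auto
  then show ?thesis using that by (auto simp: below_def)
qed

lemma ex_homog: "low (Suc n) q \<Longrightarrow> \<exists>p. homog n p \<and> low n (q - p)"
proof (induction q rule: low_induct)
  case zero
  show ?case by (rule exI[of _ 0]) simp
next
  case (mon M r)
  show ?case
  proof (cases "size M = n")
    case True
    then show ?thesis by (intro exI[of _ "cst r * mon M"]) (simp add: homog_cst)
  next
    case False
    then show ?thesis using mon by (intro exI[of _ 0]) (simp add: low_cst)
  qed
next
  case (add p q)
  then obtain p' q' where "homog n p'" "low n (p - p')" "homog n q'" "low n (q - q')" by auto
  then show ?case using low_add[of n "p - p'" "q - q'"]
    by (intro exI[of _ "p' + q'"]) (simp add: homog_add add_diff_add)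
qed

lemma low_1: "low 1 p \<Longrightarrow> p = cst (coef p {#})"
  by (rule poly_mapping_eqI) (auto simp: low_def cst_def lookup_single when_def in_keys_iff)

definition flip_mon :: "int multiset \<Rightarrow> 'z::comm_ring_1 sym" where
  "flip_mon M = (- 1) ^ size M * mon (image_mset uminus M)"

text \<open>
  The effect on symbols of $e_n \mapsto - e_{-n}$.
\<close>

definition flip_sym :: "'z::comm_ring_1 sym \<Rightarrow> 'z sym" where
  "flip_sym p = ext_sum (\<lambda>M r. cst r * flip_mon M) p"

lemma flip_sym_simps [simp]:
  "flip_sym 0 = 0" "flip_sym (p + q) = flip_sym p + flip_sym q"
  "flip_sym (cst r * mon M) = cst r * flip_mon M" "flip_sym (mon M) = flip_mon M"
  by (simp_all add: flip_sym_def)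

lemma flip_sym_cst: "flip_sym (cst r * p) = cst r * flip_sym p"
proof (induction p rule: sym_induct)
  case (mon M s)
  have "cst r * (cst s * mon M) = cst (r * s) * mon M" by (simp add: mult.assoc)
  then show ?case by (simp only: flip_sym_simps) (simp add: mult.assoc)
qed (simp_all add: distrib_left)

lemma cst_minus_one_power: "(- 1) ^ n = (cst ((- 1) ^ n) :: 'b::monoid_add \<Rightarrow>\<^sub>0 'z::comm_ring_1)"
  by (induction n) simp_all

lemma flip_mon_eq: "flip_mon M = cst ((- 1) ^ size M) * mon (image_mset uminus M)"
  by (simp add: flip_mon_def cst_minus_one_power)

lemma minus_one_power_square: "(- 1) ^ n * (- 1) ^ n = (1 :: 'r::comm_ring_1)"
  by (simp flip: power_add)

lemma cst_sign_twice: "cst ((- 1) ^ n) * (cst ((- 1) ^ n) * p) = p"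
  by (simp only: mult.assoc[symmetric] cst_simps(4)[symmetric] minus_one_power_square cst_simps(2) mult_1_left)

lemma flip_sym_flip [simp]: "flip_sym (flip_sym p) = p"
proof (induction p rule: sym_induct)
  case (mon M r)
  have "flip_sym (flip_mon M) = (mon M :: 'a sym)"
    unfolding flip_mon_eq flip_sym_simps
    by (simp add: image_mset.compositionality comp_def cst_sign_twice flip_mon_eq)
  then show ?case by (simp add: flip_sym_cst)
qed simp_all

lemma low_flip_sym: "low n p \<Longrightarrow> low n (flip_sym p)"
  by (induction rule: low_induct) (auto simp: flip_mon_eq intro!: low_add low_cst)

lemma coef_flip_sym: "coef (flip_sym p) M = (- 1) ^ size M * coef p (image_mset uminus M)"
proof (induction p rule: sym_induct)
  case (mon K r)
  have "image_mset uminus K = M \<longleftrightarrow> K = image_mset uminus M"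
    by (auto simp: image_mset.compositionality comp_def)
  then show ?case unfolding flip_sym_simps flip_mon_eq by (auto simp: mon_def lookup_single when_def)
qed (simp_all add: lookup_add distrib_left)

context vir_pbw
begin

lemma ex_lead:
  assumes "x \<in> alg" "x \<noteq> 0"
  obtains n p where "lead n x p" "p \<noteq> 0"
proof -
  define k where "k = (LEAST k. low k (co x))"
  have "low (Suc (\<Sum>M\<in>supp (co x). size M)) (co x)"
    by (auto simp: low_def less_Suc_eq_le intro: member_le_sum)
  then have k: "low k (co x)" unfolding k_def by (rule LeastI)
  have "k \<noteq> 0"
  proof
    assume "k = 0"
    then have "supp (co x) = {}" using k by (auto simp: low_def)
    then have "emb (co x) = 0" by simp
    then show False using assms by simp
  qed
  then obtain n where n: "k = Suc n" by (cases k) auto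
  with k obtain p where p: "homog n p" "low n (co x - p)" using ex_homog by blast
  have "p \<noteq> 0"
  proof
    assume "p = 0"
    then have "k \<le> n" using p unfolding k_def by (auto intro: Least_le)
    then show False using n by simp
  qed
  then show ?thesis using that[of n p] p assms by (simp add: lead_def)
qed

lemma scalar_if_low: "x \<in> alg \<Longrightarrow> low 1 (co x) \<Longrightarrow> \<exists>z. x = scal z"
  using low_1[of "co x"] by (intro exI[of _ "coef (co x) {#}"]) (subst co_eq_iff[symmetric], simp_all)

lemma bracket_deriv: "bracket p t = sym_deriv (\<lambda>i. of_int (t - i) * mon {#i + t#}) p"
  by (induction p rule: sym_induct) (simp_all add: bracket_gen_deriv)

lemma below_bracket:
  assumes "below (N + 1) p" "t < s" "0 < s"
  shows "below (s + N) (bracket p t)"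
  unfolding bracket_deriv using assms by (intro below_sym_deriv[OF assms(1)] below_mult) (auto simp del: of_int_diff)

text \<open>
  If \<open>N\<close> is the largest index in \<open>p\<close>, the largest index that can occur in
  the bracket with the generator \<open>t\<close> is \<open>t + N\<close>, with an explicit
  coefficient.
\<close>

lemma bracket_top:
  assumes "below (N + 1) p" "0 < t"
  shows "below (t + N) (bracket p t - of_int (t - N) * partial N p * mon {#t + N#})"
proof -
  define c :: "'z sym" where "c = of_int (t - N) * mon {#t + N#}"
  have "below (t + N) (sym_deriv (\<lambda>i. of_int (t - i) * mon {#i + t#} - c * (if i = N then 1 else 0)) p)"
    using assms(2) by (intro below_sym_deriv[OF assms(1)])
      (auto simp: c_def add.commute simp del: of_int_diff intro!: below_mult)
  then show ?thesis unfolding sym_deriv_diff bracket_deriv c_def by (simp add: ac_simps)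
qed

text \<open>
  The iterated commutators of \<open>x\<close> with any element stay in a finitely generated module
  over the scalars. Images under surjective homomorphisms inherit this property.
\<close>

definition loc_fin :: "'a \<Rightarrow> bool" where
  "loc_fin x \<longleftrightarrow> (\<forall>y\<in>alg. \<exists>I (v :: int \<Rightarrow> 'a). finite I \<and> v ` I \<subseteq> alg \<and>
    (\<forall>j. \<exists>c. (comm x ^^ j) y = (\<Sum>i\<in>I. scal (c i) * v i)))"

lemma loc_fin_supp:
  assumes "loc_fin x" "y \<in> alg"
  obtains Q where "finite Q" "\<And>j. supp (co ((comm x ^^ j) y)) \<subseteq> Q"
proof -
  obtain I and v :: "int \<Rightarrow> 'a" where I: "finite I" "v ` I \<subseteq> alg"
      "\<forall>j. \<exists>c. (comm x ^^ j) y = (\<Sum>i\<in>I. scal (c i) * v i)"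
    using bspec[OF assms(1)[unfolded loc_fin_def] assms(2)] by (elim exE conjE) (rule that)
  have *: "(\<Sum>i\<in>I. scal (c i) * v i) \<in> alg \<and> supp (co (\<Sum>i\<in>I. scal (c i) * v i)) \<subseteq> (\<Union>i\<in>I. supp (co (v i)))" for c
    using I(1,2)
  proof (induction I rule: finite_induct)
    case (insert i I)
    then show ?case
      using subset_trans[OF Poly_Mapping.keys_add[of "cst (c i) * co (v i)" "co (\<Sum>i\<in>I. scal (c i) * v i)"]
          Un_mono[OF supp_cst_mult[of "c i" "co (v i)"]]]
      by simp
  qed simp
  show ?thesis
  proof (rule that)
    show "finite (\<Union>i\<in>I. supp (co (v i)))" using I by simp
    show "supp (co ((comm x ^^ j) y)) \<subseteq> (\<Union>i\<in>I. supp (co (v i)))" for j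
    proof -
      obtain c where "(comm x ^^ j) y = (\<Sum>i\<in>I. scal (c i) * v i)" using I(3) by blast
      then show ?thesis using * by simp
    qed
  qed
qed

lemma lead_iterate:
  assumes "x \<in> alg" "lead (Suc d) x p" "lead n y q"
  shows "lead (n + j * d) ((comm x ^^ j) y) ((sym_deriv (bracket p) ^^ j) q)"
proof (induction j)
  case (Suc j)
  from lead_comm[OF assms(1) lead_comm_gen[OF assms(2)] this] show ?case
    by (simp add: add.commute add.left_commute)
qed (use assms in simp)

lemma supp_lead:
  assumes "lead n x p" "M \<in> supp p"
  shows "M \<in> supp (co x) \<and> size M = n"
proof -
  have "size M = n" using assms by (simp add: lead_def homog_def)
  then have "M \<notin> supp (co x - p)" using assms(1) by (auto simp: lead_def low_def)
  then show ?thesis using assms(2) \<open>size M = n\<close> by (simp add: in_keys_iff lookup_minus)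
qed

text \<open>
  If an index \<open>N > 0\<close> occurs in the symbol, take it maximal. By
  \<open>bracket_top\<close> each commutator raises the largest index by \<open>N\<close>, so the
  iterates on a generator with large index involve unboundedly many generators.
\<close>

lemma loc_fin_nonpos:
  assumes "loc_fin x" "x \<in> alg" "lead (Suc d) x p" "M \<in> supp p" "i \<in># M"
  shows "i \<le> 0"
proof (rule ccontr)
  assume "\<not> i \<le> 0"
  define N where "N = Max (\<Union>M\<in>supp p. set_mset M)"
  have fin: "finite (\<Union>M\<in>supp p. set_mset M)" by simp
  have "(\<Union>M\<in>supp p. set_mset M) \<noteq> {}" using assms(4,5) by fast
  from Max_in[OF fin this] have "N \<in> (\<Union>M\<in>supp p. set_mset M)" unfolding N_def .
  have N: "i \<le> N" and le: "\<And>M i. M \<in> supp p \<Longrightarrow> i \<in># M \<Longrightarrow> i \<le> N"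
    unfolding N_def using assms(4,5) by (auto intro!: Max_ge)
  with \<open>N \<in> _\<close> obtain M' where M': "M' \<in> supp p" "N \<in># M'" by auto
  have "0 < N" using N \<open>\<not> i \<le> 0\<close> by simp
  have p: "below (N + 1) p" using le by (fastforce simp: below_def)
  define q where "q = partial N p"
  have q0: "q \<noteq> 0" unfolding q_def by (rule partial_neq_0[OF M'])
  have q: "below (N + 1) q" unfolding q_def by (rule below_sym_deriv[OF p]) auto
  define m where "m = 2 * N + 1"
  define T where "T j = m + int j * N" for j
  define D where "D = sym_deriv (bracket p)"
  have iter: "\<exists>k r. k \<noteq> 0 \<and> below (T j) r \<and> (D ^^ j) (mon {#m#}) = of_int k * q ^ j * mon {#T j#} + r" for j
  proof (induction j)
    case 0
    show ?case by (rule exI[of _ 1], rule exI[of _ 0]) (simp add: T_def)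
  next
    case (Suc j)
    then obtain k r where k: "k \<noteq> 0" and r: "below (T j) r"
      and eq: "(D ^^ j) (mon {#m#}) = of_int k * q ^ j * mon {#T j#} + r" by blast
    have T: "N < T j" "T (Suc j) = T j + N" using \<open>0 < N\<close> by (simp_all add: T_def m_def algebra_simps add_strict_increasing)
    define r1 where "r1 = bracket p (T j) - of_int (T j - N) * q * mon {#T j + N#}"
    have r1: "below (T j + N) r1" unfolding r1_def q_def by (rule bracket_top[OF p]) (use T \<open>0 < N\<close> in simp)
    have Dq: "below (T j + N) (D (of_int k * q ^ j))"
      unfolding D_def
      by (rule below_sym_deriv[of "N + 1"]) (use T \<open>0 < N\<close> p q in \<open>auto intro!: below_bracket below_mult below_power\<close>)
    have Dr: "below (T j + N) (D r)"
      unfolding D_def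
      by (rule below_sym_deriv[OF r]) (use T \<open>0 < N\<close> p in \<open>auto intro!: below_bracket\<close>)
    have "(D ^^ Suc j) (mon {#m#}) = D (of_int k * q ^ j * mon {#T j#}) + D r" by (simp only: funpow.simps comp_apply eq) (simp add: D_def)
    also have "D (of_int k * q ^ j * mon {#T j#}) = D (of_int k * q ^ j) * mon {#T j#} + of_int k * q ^ j * bracket p (T j)"
      by (simp add: D_def sym_deriv_mult[of _ _ "mon {#T j#}"])
    also have "bracket p (T j) = of_int (T j - N) * q * mon {#T j + N#} + r1" by (simp add: r1_def)
    finally have "(D ^^ Suc j) (mon {#m#}) = of_int (k * (T j - N)) * q ^ Suc j * mon {#T (Suc j)#} +
        (D (of_int k * q ^ j) * mon {#T j#} + of_int k * q ^ j * r1 + D r)"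
      unfolding T(2) by (simp only: of_int_mult power_Suc distrib_left distrib_right ac_simps)
    moreover have "below (T (Suc j)) (D (of_int k * q ^ j) * mon {#T j#} + of_int k * q ^ j * r1 + D r)"
      unfolding T(2)
      by (intro below_add below_mult Dq Dr r1 below_power) (use T \<open>0 < N\<close> q in \<open>auto intro: below_mono\<close>)
    moreover have "k * (T j - N) \<noteq> 0" using k T by simp
    ultimately show ?case by blast
  qed
  obtain Q where Q: "finite Q" "\<And>j. supp (co ((comm x ^^ j) (gen m))) \<subseteq> Q"
    using loc_fin_supp[OF assms(1), of "gen m"] by auto
  define B where "B = Max (insert 0 (\<Union>M\<in>Q. set_mset M))"
  have B: "i \<le> B" if "M \<in> Q" "i \<in># M" for M i
    unfolding B_def using that Q(1) by (intro Max_ge) auto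
  define j where "j = nat B + 1"
  obtain k r where k: "k \<noteq> 0" and r: "below (T j) r"
    and eq: "(D ^^ j) (mon {#m#}) = of_int k * q ^ j * mon {#T j#} + r" using iter by blast
  have "of_int k * q ^ j \<noteq> 0" using k q0 by simp
  then obtain K where K: "K \<in> supp ((D ^^ j) (mon {#m#}))" "\<not> (\<forall>i\<in>#K. i < T j)"
    unfolding eq using below_exceeds[OF r] by metis
  have "K \<in> Q"
    using supp_lead[OF lead_iterate[OF assms(2,3) lead_gen] K(1)[unfolded D_def]] Q(2) by auto
  then have "T j \<le> B" using K(2) B by force
  moreover have "B < T j"
  proof -
    have "B < int j" by (simp add: j_def)
    also have "int j \<le> int j * N" using \<open>0 < N\<close> by (simp add: mult_le_cancel_left1)
    finally show ?thesis using \<open>0 < N\<close> by (simp add: T_def m_def)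
  qed
  ultimately show False by simp
qed

text \<open>
  A nonconstant symbol has a nonzero bracket with a generator of sufficiently large index, by
  \<open>bracket_top\<close>.
\<close>

lemma central_scalar:
  assumes "x \<in> alg" "\<And>t. comm x (gen t) = 0"
  shows "\<exists>z. x = scal z"
proof (cases "x = 0")
  case True
  then show ?thesis by (intro exI[of _ 0]) simp
next
  case False
  with assms obtain n p where p: "lead n x p" "p \<noteq> 0" using ex_lead by blast
  have br: "bracket p t = 0" for t
    using lead_unique[OF lead_comm_gen[OF p(1)], of t 0] assms by simp
  show ?thesis
  proof (cases n)
    case 0
    then show ?thesis using lead_bound[OF p(1)] assms by (auto intro: scalar_if_low)
  next
    case (Suc d)
    from p(2) obtain M where M: "M \<in> supp p" by (metis all_not_in_conv keys_eq_empty)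
    then have "size M = Suc d" using p(1) Suc by (simp add: lead_def homog_def)
    then obtain i where i: "i \<in># M" by (metis size_eq_Suc_imp_elem)
    define N where "N = Max (\<Union>M\<in>supp p. set_mset M)"
    have ne: "(\<Union>M\<in>supp p. set_mset M) \<noteq> {}" using M i by fast
    have "N \<in> (\<Union>M\<in>supp p. set_mset M)" unfolding N_def by (rule Max_in[OF _ ne]) simp
    have le: "\<And>M i. M \<in> supp p \<Longrightarrow> i \<in># M \<Longrightarrow> i \<le> N"
      unfolding N_def by (auto intro!: Max_ge)
    from \<open>N \<in> _\<close> obtain M' where M': "M' \<in> supp p" "N \<in># M'" by auto
    have below: "below (N + 1) p" using le by (fastforce simp: below_def)
    define t where "t = \<bar>N\<bar> + 1"
    have t: "0 < t" "t - N \<noteq> 0" by (auto simp: t_def)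
    have "below (t + N) (of_int (t - N) * partial N p * mon {#t + N#})"
      using bracket_top[OF below t(1)] br by simp
    then have "of_int (t - N) * partial N p = 0" by (rule below_mult_mon)
    moreover have "partial N p \<noteq> 0" by (rule partial_neq_0[OF M'])
    ultimately show ?thesis using t by simp
  qed
qed

text \<open>
  Here the symbol is a multiple of the power \<open>d + 1\<close> of the generator with index zero,
  and the induced derivation multiplies the other generators by the power \<open>d\<close>. For
  \<open>d > 0\<close> the iterates have unbounded degree, so the symbol is linear and the remainder
  is a scalar.
\<close>

lemma loc_fin_zero_modes:
  assumes "loc_fin x" "x \<in> alg" "lead (Suc d) x p" "p \<noteq> 0" "\<And>M i. M \<in> supp p \<Longrightarrow> i \<in># M \<Longrightarrow> i = 0"
  shows "\<exists>\<alpha> z. x = scal \<alpha> * gen 0 + scal z"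
proof -
  define Z :: "nat \<Rightarrow> int multiset" where "Z k = replicate_mset k 0" for k
  define \<alpha> where "\<alpha> = coef p (Z (Suc d))"
  have supp: "M = Z (Suc d)" if "M \<in> supp p" for M
    using assms(3) assms(5)[OF that] that unfolding Z_def lead_def homog_def
    by (metis set_mset_subset_singletonD singletonI subsetI)
  have p: "p = cst \<alpha> * mon (Z (Suc d))"
  proof (rule poly_mapping_eqI)
    fix M
    show "coef p M = coef (cst \<alpha> * mon (Z (Suc d))) M"
      using supp[of M] by (auto simp: \<alpha>_def mon_def lookup_single when_def in_keys_iff)
  qed
  have \<alpha>: "\<alpha> \<noteq> 0" using p assms(4) by auto
  have dZ: "deriv_mon g (Z (Suc k)) = of_nat (Suc k) * g 0 * mon (Z k)" for g :: "int \<Rightarrow> 'z sym" and k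
  proof (induction k)
    case (Suc k)
    have "deriv_mon g (Z (Suc (Suc k))) = g 0 * mon (Z (Suc k)) + mon {#0#} * deriv_mon g (Z (Suc k))"
      by (simp add: Z_def deriv_mon_add_mset)
    also have "mon {#0#} * deriv_mon g (Z (Suc k)) = of_nat (Suc k) * g 0 * mon (Z (Suc k))"
      unfolding Suc by (simp add: Z_def mon_add_mset[of 0 "replicate_mset k 0"] ac_simps)
    finally show ?case by (simp add: distrib_right)
  qed (simp add: Z_def)
  have br: "bracket p t = cst (\<alpha> * of_nat (Suc d) * of_int t) * (mon (Z d) * mon {#t#})" for t
    unfolding bracket_deriv p sym_deriv_simps dZ
    by (simp add: cst_of_nat ac_simps del: of_nat_Suc)
  define D where "D = sym_deriv (bracket p)"
  define \<beta> where "\<beta> = \<alpha> * of_nat (Suc d)"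
  have iter: "(D ^^ j) (mon {#1#}) = cst (\<beta> ^ j) * (mon (Z (j * d)) * mon {#1#})" for j
  proof (induction j)
    case (Suc j)
    have D0: "D (mon (Z k)) = 0" for k
    proof (cases k)
      case 0
      then show ?thesis by (simp add: D_def Z_def flip: mon_empty)
    next
      case (Suc k')
      then show ?thesis by (simp add: D_def dZ br)
    qed
    have "(D ^^ Suc j) (mon {#1#}) = cst (\<beta> ^ j) * (mon (Z (j * d)) * bracket p 1)"
    proof -
      have "D (cst c * (q * r)) = cst c * (D q * r + q * D r)" for c q r
        unfolding D_def sym_deriv_cst sym_deriv_mult[of _ q r] ..
      then show ?thesis by (simp add: Suc D0) (simp add: D_def)
    qed
    also have "\<dots> = cst (\<beta> ^ Suc j) * ((mon (Z (j * d)) * mon (Z d)) * mon {#1#})"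
      unfolding br \<beta>_def by (simp only: cst_simps of_int_1 mult_1_right mult_1_left power_Suc ac_simps)
    also have "mon (Z (j * d)) * mon (Z d) = mon (Z (Suc j * d))"
      
      unfolding Z_def mon_add[symmetric] by (rule arg_cong[of _ _ mon]) (simp add: multiset_eq_iff)
    finally show ?case .
  qed (simp add: Z_def)
  have "d = 0"
  proof (rule ccontr)
    assume "d \<noteq> 0"
    obtain Q where Q: "finite Q" "\<And>j. supp (co ((comm x ^^ j) (gen 1))) \<subseteq> Q"
      using loc_fin_supp[OF assms(1), of "gen 1"] by auto
    define B where "B = Max (insert 0 (size ` Q))"
    have B: "size M \<le> B" if "M \<in> Q" for M unfolding B_def using that Q(1) by (intro Max_ge) auto
    have "\<beta> \<noteq> 0" using \<alpha> by (simp add: \<beta>_def del: of_nat_Suc)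
    then have "Z (B * d) + {#1#} \<in> supp ((D ^^ B) (mon {#1#}))"
      unfolding iter by (simp add: in_keys_iff mon_def mult_single)
    from supp_lead[OF lead_iterate[OF assms(2,3) lead_gen] this[unfolded D_def]]
    have "Z (B * d) + {#1#} \<in> Q" using subsetD[OF Q(2)] by blast
    then have "size (Z (B * d) + {#1#}) \<le> B" by (rule B)
    then show False using \<open>d \<noteq> 0\<close> by (cases d) (auto simp: Z_def)
  qed
  have "low 1 (co (x - scal \<alpha> * gen 0))"
    using assms(2,3) p \<open>d = 0\<close> by (simp add: lead_def Z_def)
  then obtain z where "x - scal \<alpha> * gen 0 = scal z" using scalar_if_low[of "x - scal \<alpha> * gen 0"] assms(2) by auto
  then show ?thesis by (metis diff_add_cancel add.commute)
qed

lemma flip_word: "prod_list (map (\<lambda>n. - gen (- n)) w) = scal ((- 1) ^ length w) * word (map uminus w)"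
proof (induction w)
  case (Cons i w)
  then show ?case using scal_gen[of "(- 1) ^ length w" "- i"] by (simp flip: mult.assoc)
qed simp

text \<open>
  The generators $-e_{-n}$ satisfy the Virasoro relations with \<open>\<delta>\<close> replaced by
  \<open>- \<delta>\<close>. Statements about positive indices thereby turn into statements about
  negative ones.
\<close>

lemma flip_vir_pbw: "vir_pbw scal (\<lambda>n. - gen (- n)) (- \<delta>) (\<lambda>x. flip_sym (sbl x))"
proof
  show "(- gen (- b)) * (- gen (- a)) = (- gen (- a)) * (- gen (- b)) + scal (of_int (a - b)) * (- gen (- (a + b)))
      + scal (cocyc (- \<delta>) b a)" for a b
  proof -
    have "cocyc (- \<delta>) b a = cocyc \<delta> (- b) (- a)" 
    proof -
      have "- a + - b = 0 \<longleftrightarrow> a + b = 0" by arith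
      then show ?thesis by (simp add: cocyc_def left_diff_distrib)
    qed
    then show ?thesis using gen_rel[of "- b" "- a"] by (simp add: algebra_simps)
  qed
  show "low (length w) (flip_sym (sbl (prod_list (map (\<lambda>n. - gen (- n)) w))) - mon (mset w))" for w
  proof -
    have "low (length w) (flip_sym (cst ((- 1) ^ length w) * (sbl (word (map uminus w)) - mon (mset (map uminus w)))))"
      using sbl_word[of "map uminus w"] by (intro low_flip_sym low_cst) (simp add: word_def)
    also have "flip_sym (cst ((- 1) ^ length w) * (sbl (word (map uminus w)) - mon (mset (map uminus w)))) =
        flip_sym (sbl (prod_list (map (\<lambda>n. - gen (- n)) w))) - cst ((- 1) ^ length w) * flip_mon (mset (map uminus w))"
      using flip_sym_simps(2)[of "cst ((- 1) ^ length w) * (sbl (word (map uminus w)) - mon (mset (map uminus w)))"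
          "cst ((- 1) ^ length w) * mon (mset (map uminus w))"]
      by (simp add: flip_word sbl_scal right_diff_distrib)
    also have "cst ((- 1) ^ length w) * flip_mon (mset (map uminus w)) = mon (mset w)"
      by (simp add: flip_mon_eq image_mset.compositionality comp_def cst_sign_twice flip: mset_map)
    finally show ?thesis .
  qed
qed (simp_all add: scal_gen sbl_add sbl_scal flip_sym_cst)

interpretation flip: vir_pbw scal "\<lambda>n. - gen (- n)" "- \<delta>" "\<lambda>x. flip_sym (sbl x)"
  by (rule flip_vir_pbw)

lemma flip_word_alt: "flip.word w = scal ((- 1) ^ length w) * word (map uminus w)"
  by (simp add: flip.word_def flip_word)

lemma word_flip: "word w = scal ((- 1) ^ length w) * flip.word (map uminus w)"
  by (simp add: flip_word_alt comp_def minus_one_power_square flip: mult.assoc scal_mult)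

lemma flip_alg: "flip.alg = alg"
proof (intro equalityI subsetI)
  fix x assume "x \<in> flip.alg"
  then show "x \<in> alg" by (induction rule: flip.alg_induct) (simp_all add: flip_word_alt)
next
  fix x assume "x \<in> alg"
  then show "x \<in> flip.alg"
    by (induction rule: alg_induct) (simp_all add: word_flip[of "sorted_list_of_multiset _"])
qed

lemma flip_lead: "lead n x p \<Longrightarrow> flip.lead n x (flip_sym p)"
proof -
  assume "lead n x p"
  then have *: "x \<in> alg" "homog n p" "low n (co x - p)" by (simp_all add: lead_def)
  have w: "flip.lead (size M) (smon M) (flip_mon M)" for M
    using flip.lead_scal[OF flip.lead_word[of "map uminus (sorted_list_of_multiset M)"], of "(- 1) ^ size M"]
    by (simp add: word_flip[of "sorted_list_of_multiset M"] flip_mon_eq)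
  have 1: "flip.lead n (emb p) (flip_sym p)" using *(2)
    by (induction rule: homog_induct) (auto intro: flip.lead_add flip.lead_scal w)
  have 2: "flip.lead n (emb (co x - p)) 0" using *(3)
  proof (induction rule: low_induct)
    case (mon M r)
    then show ?case using flip.lead_scal[OF flip.lead_weaken[OF w[of M], of n], of r] by simp
  next
    case (add p q)
    then show ?case using flip.lead_add by fastforce
  qed simp
  show ?thesis using flip.lead_add[OF 1 2] *(1) by simp
qed

lemma flip_loc_fin: "flip.loc_fin x \<longleftrightarrow> loc_fin x"
  by (simp add: flip.loc_fin_def loc_fin_def flip_alg)

text \<open>
  No positive index occurs in the symbol by \<open>loc_fin_nonpos\<close>, no negative one by the
  same lemma for $-e_{-n}$.
\<close>

theorem loc_fin_affine:
  assumes "loc_fin x" "x \<in> alg"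
  shows "\<exists>\<alpha> z. x = scal \<alpha> * gen 0 + scal z"
proof (cases "x = 0")
  case True
  then show ?thesis by (intro exI[of _ 0]) simp
next
  case False
  with assms obtain n p where p: "lead n x p" "p \<noteq> 0" using ex_lead by blast
  show ?thesis
  proof (cases n)
    case 0
    then have "\<exists>z. x = scal z" using lead_bound[OF p(1)] assms by (auto intro: scalar_if_low)
    then show ?thesis by (metis scal_0 mult_zero_left add_0)
  next
    case (Suc d)
    have "i = 0" if "M \<in> supp p" "i \<in># M" for M i
    proof -
      have "i \<le> 0" using loc_fin_nonpos[OF assms p(1)[unfolded Suc] that] .
      moreover have "- i \<le> 0"
      proof (rule flip.loc_fin_nonpos)
        show "flip.loc_fin x" "x \<in> flip.alg" using assms by (simp_all add: flip_loc_fin flip_alg)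
        show "flip.lead (Suc d) x (flip_sym p)" using flip_lead[OF p(1)] Suc by simp
        show "image_mset uminus M \<in> supp (flip_sym p)"
          using that(1) by (simp add: in_keys_iff coef_flip_sym image_mset.compositionality comp_def)
        show "- i \<in># image_mset uminus M" using that(2) by simp
      qed
      ultimately show ?thesis by simp
    qed
    then show ?thesis using loc_fin_zero_modes[OF assms p(1)[unfolded Suc] p(2)] by blast
  qed
qed

end

section \<open>Weights\<close>

lemma sum_list_sorted_list_of_multiset [simp]: "sum_list (sorted_list_of_multiset M) = sum_mset (M :: int multiset)"
  by (metis mset_sorted_list_of_multiset sum_mset_sum_list)

definition restr :: "int multiset set \<Rightarrow> 'z::comm_ring_1 sym \<Rightarrow> 'z sym" where
  "restr S p = ext_sum (\<lambda>M r. cst r * (if M \<in> S then mon M else 0)) p"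

lemma coef_restr: "coef (restr S p) M = (if M \<in> S then coef p M else 0)"
  unfolding restr_def
proof (induction p rule: sym_induct)
  case (mon K r)
  show ?case unfolding ext_sum_cst_mon by (auto simp: mon_def lookup_single when_def)
qed (simp_all add: lookup_add)

abbreviation weight_part :: "int \<Rightarrow> 'z::comm_ring_1 sym \<Rightarrow> 'z sym" where
  "weight_part n \<equiv> restr {M. sum_mset M = n}"

lemma sum_weight_part: "p = (\<Sum>n\<in>sum_mset ` supp p. weight_part n p)"
  by (rule poly_mapping_eqI) (auto simp: lookup_sum coef_restr in_keys_iff sum.delta)

lemma mon_neq_0 [simp]: "mon M \<noteq> (0 :: 'z::comm_ring_1 sym)"
  by (metis supp_mon keys_zero insert_not_empty)

context vir_pbw
begin

text \<open>
  The weight spaces for the action of $e_0$.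
\<close>

definition wsp :: "int \<Rightarrow> 'a set" where
  "wsp n = {x \<in> alg. \<forall>M\<in>supp (co x). sum_mset M = n}"

lemma wsp_alg: "x \<in> wsp n \<Longrightarrow> x \<in> alg"
  by (simp add: wsp_def)

lemma word_wsp: "word w \<in> wsp (sum_list w)"
  using nf_weight by (auto simp: wsp_def)

lemma smon_wsp: "smon M \<in> wsp (sum_mset M)"
  using word_wsp[of "sorted_list_of_multiset M"] by simp

lemma gen_wsp: "gen i \<in> wsp i"
  using word_wsp[of "[i]"] by simp

definition wcomp :: "int \<Rightarrow> 'a \<Rightarrow> 'a" where
  "wcomp n x = emb (weight_part n (co x))"

lemma wcomp_wsp: "wcomp n x \<in> wsp n"
  by (auto simp: wsp_def wcomp_def in_keys_iff coef_restr split: if_splits)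

lemma sum_in_alg: "(\<And>i. i \<in> I \<Longrightarrow> v i \<in> alg) \<Longrightarrow> (\<Sum>i\<in>I. v i) \<in> alg"
  by (induction I rule: infinite_finite_induct) auto

lemma emb_sum: "emb (sum p I) = (\<Sum>i\<in>I. emb (p i))"
  by (induction I rule: infinite_finite_induct) auto

lemma co_sum: "(\<And>i. i \<in> I \<Longrightarrow> v i \<in> alg) \<Longrightarrow> co (\<Sum>i\<in>I. v i) = (\<Sum>i\<in>I. co (v i))"
  by (induction I rule: infinite_finite_induct) (auto simp: sum_in_alg)

lemma sum_wcomp:
  assumes "x \<in> alg"
  shows "x = (\<Sum>n\<in>sum_mset ` supp (co x). wcomp n x)"
  unfolding wcomp_def emb_sum[symmetric] sum_weight_part[of "co x", symmetric] using assms by simp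

lemma comm_gen0_word: "comm (gen 0) (word w) = of_int (sum_list w) * word w"
proof (induction w)
  case (Cons i w)
  have "comm (gen 0) (gen i) = of_int i * gen i"
    using comm_gen[of 0 i] by (simp add: cocyc_def)
  then have "comm (gen 0) (word (i # w)) = of_int i * gen i * word w + gen i * (of_int (sum_list w) * word w)"
    by (simp add: comm_simps Cons)
  also have "gen i * (of_int (sum_list w) * word w) = of_int (sum_list w) * (gen i * word w)"
    using scal_gen[of "of_int (sum_list w)" i] by (simp flip: mult.assoc)
  finally show ?case by (simp add: distrib_right mult.assoc)
qed (simp add: comm_def)

lemma co_comm_gen0: "x \<in> alg \<Longrightarrow> coef (co (comm (gen 0) x)) M = of_int (sum_mset M) * coef (co x) M"
proof (induction x rule: alg_induct)
  case (smon K r)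
  have "comm (gen 0) (scal r * smon K) = scal (r * of_int (sum_mset K)) * smon K"
    by (simp add: comm_scal comm_gen0_word mult.assoc)
  then have "co (comm (gen 0) (scal r * smon K)) = cst (r * of_int (sum_mset K)) * mon K"
    by (simp only: co_simps(5)[OF word_in_alg] co_smon)
  then have "coef (co (comm (gen 0) (scal r * smon K))) M = r * of_int (sum_mset K) * coef (mon K) M"
    by (simp only: coef_cst_mult)
  moreover have "coef (co (scal r * smon K)) M = r * coef (mon K) M"
    by (simp only: co_simps(5)[OF word_in_alg] co_smon coef_cst_mult)
  ultimately show ?case by (auto simp: mon_def lookup_single when_def)
qed (simp_all add: comm_simps lookup_add distrib_left)

lemma co_of_int_mult: "x \<in> alg \<Longrightarrow> co (of_int n * x) = of_int n * co x"
  using co_simps(5)[of x "of_int n"] by simp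

lemma alg_of_int_mult [simp]: "x \<in> alg \<Longrightarrow> of_int n * x \<in> alg"
  using alg_scal_mult[of x "of_int n"] by simp

lemma of_int_mult_eq_0:
  assumes "x \<in> alg" "of_int n * x = 0" "n \<noteq> 0"
  shows "x = 0"
proof -
  have "of_int n * coef (co x) M = 0" for M
    using co_of_int_mult[OF assms(1), of n] coef_of_int_mult[of n "co x" M] assms(2) by auto
  then have "co x = 0" using assms(3) by (intro poly_mapping_eqI) simp
  then show ?thesis using assms(1) by (metis emb_co emb_simps(1))
qed

lemma comm_gen0_wsp: "x \<in> wsp n \<Longrightarrow> comm (gen 0) x = of_int n * x"
proof -
  assume x: "x \<in> wsp n"
  then have alg: "x \<in> alg" by (rule wsp_alg)
  have "coef (co (comm (gen 0) x)) M = coef (co (of_int n * x)) M" for M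
    unfolding co_comm_gen0[OF alg] co_of_int_mult[OF alg] coef_of_int_mult
    using x by (cases "M \<in> supp (co x)") (auto simp: wsp_def in_keys_iff)
  then have "co (comm (gen 0) x) = co (of_int n * x)" by (rule poly_mapping_eqI)
  then show ?thesis using alg by (simp add: co_eq_iff)
qed

lemma wspI:
  assumes "x \<in> alg" "comm (gen 0) x = of_int n * x"
  shows "x \<in> wsp n"
  unfolding wsp_def
proof (intro CollectI conjI ballI assms(1))
  fix M assume "M \<in> supp (co x)"
  moreover have "of_int (sum_mset M) * coef (co x) M = of_int n * coef (co x) M"
    using co_comm_gen0[OF assms(1), of M]
    unfolding assms(2) co_of_int_mult[OF assms(1)] coef_of_int_mult by (rule sym)
  ultimately show "sum_mset M = n" unfolding in_keys_iff by (metis mult_cancel_right of_int_eq_iff)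
qed

end

section \<open>Surjective endomorphisms preserve the grading up to sign\<close>

locale vir_epi = vir_pbw scal gen \<delta> sbl
  for scal :: "'z::{idom, ring_char_0} \<Rightarrow> 'a::ring_1" and gen \<delta> sbl +
  fixes f :: "'a \<Rightarrow> 'a"
  assumes f_alg [simp]: "x \<in> alg \<Longrightarrow> f x \<in> alg"
    and f_add: "x \<in> alg \<Longrightarrow> y \<in> alg \<Longrightarrow> f (x + y) = f x + f y"
    and f_mult: "x \<in> alg \<Longrightarrow> y \<in> alg \<Longrightarrow> f (x * y) = f x * f y"
    and f_1 [simp]: "f 1 = 1"
    and f_surj: "y \<in> alg \<Longrightarrow> \<exists>x\<in>alg. f x = y"
begin

lemma f_0 [simp]: "f 0 = 0"
  using f_add[of 0 0] by simp

lemma f_uminus: "x \<in> alg \<Longrightarrow> f (- x) = - f x"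
  using f_add[of x "- x"] by (simp add: eq_neg_iff_add_eq_0 add.commute)

lemma f_diff: "x \<in> alg \<Longrightarrow> y \<in> alg \<Longrightarrow> f (x - y) = f x - f y"
  using f_add[of x "- y"] by (simp add: f_uminus)

lemma f_sum: "(\<And>i. i \<in> I \<Longrightarrow> v i \<in> alg) \<Longrightarrow> f (\<Sum>i\<in>I. v i) = (\<Sum>i\<in>I. f (v i))"
  by (induction I rule: infinite_finite_induct) (auto simp: f_add sum_in_alg)

lemma f_comm: "x \<in> alg \<Longrightarrow> y \<in> alg \<Longrightarrow> f (comm x y) = comm (f x) (f y)"
  by (simp add: comm_def f_diff f_mult)

lemma of_int_alg [simp]: "of_int n \<in> alg"
  using alg_closed(4)[of "of_int n"] by simp

lemma f_of_int: "f (of_int n) = of_int n"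
proof -
  have nat: "of_nat m \<in> alg \<and> f (of_nat m) = of_nat m" for m
    by (induction m) (simp_all add: f_add)
  show ?thesis using nat by (cases n) (simp_all add: f_add f_uminus f_diff)
qed

lemma f_of_int_mult: "x \<in> alg \<Longrightarrow> f (of_int n * x) = of_int n * f x"
  by (simp add: f_mult f_of_int)

lemma comm_f_wsp: "u \<in> wsp n \<Longrightarrow> comm (f (gen 0)) (f u) = of_int n * f u"
  using comm_gen0_wsp[of u n] wsp_alg[of u n] by (metis f_comm f_of_int_mult alg_closed(3))

lemma comm_sum: "comm x (sum v I) = (\<Sum>i\<in>I. comm x (v i))"
  by (induction I rule: infinite_finite_induct) (simp_all add: comm_simps)

lemma loc_fin_f_gen0: "loc_fin (f (gen 0))"
  unfolding loc_fin_def
proof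
  fix y assume "y \<in> alg"
  then obtain x where x: "x \<in> alg" "f x = y" using f_surj by blast
  define I where "I = sum_mset ` supp (co x)"
  define v where "v n = f (wcomp n x)" for n
  have v: "v n \<in> alg" for n by (simp add: v_def wsp_alg[OF wcomp_wsp])
  have y: "y = (\<Sum>n\<in>I. v n)"
    unfolding v_def using f_sum[of I "\<lambda>n. wcomp n x"] sum_wcomp[OF x(1)] wsp_alg[OF wcomp_wsp] x(2) by (simp add: I_def)
  have comm_v: "comm (f (gen 0)) (scal r * v n) = scal (of_int n * r) * v n" for r n
    using comm_f_wsp[OF wcomp_wsp[of n x]] v[of n]
    by (simp add: comm_scal(2) v_def) (simp flip: scal_of_int scal_mult mult.assoc add: mult.commute)
  have "(comm (f (gen 0)) ^^ j) y = (\<Sum>n\<in>I. scal (of_int n ^ j) * v n)" for j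
  proof (induction j)
    case (Suc j)
    then show ?case by (simp only: funpow.simps comp_apply comm_sum comm_v power_Suc)
  qed (simp add: y)
  then have "\<exists>c. (comm (f (gen 0)) ^^ j) y = (\<Sum>n\<in>I. scal (c n) * v n)" for j
    by (intro exI[of _ "\<lambda>n. of_int n ^ j"])
  moreover have "finite I" by (simp add: I_def)
  ultimately show "\<exists>I (v :: int \<Rightarrow> 'a). finite I \<and> v ` I \<subseteq> alg \<and>
      (\<forall>j. \<exists>c. (comm (f (gen 0)) ^^ j) y = (\<Sum>i\<in>I. scal (c i) * v i))"
    using v by blast
qed

text \<open>
  Otherwise \<open>f\<close> kills $e_0$, a multiple of $[e_{-1}, e_1]$, and hence all $e_n$. Then
  only the images of scalars remain, and these commute with one another.
\<close>

lemma f_gen1_neq_0: "f (gen 1) \<noteq> 0"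
proof
  assume 1: "f (gen 1) = 0"
  have "comm (gen (- 1)) (gen 1) = of_int 2 * gen 0"
    by (simp add: comm_gen cocyc_def)
  then have "of_int 2 * f (gen 0) = comm (f (gen (- 1))) (f (gen 1))"
    by (metis f_comm f_of_int_mult alg_closed(3))
  then have "of_int 2 * f (gen 0) = 0" by (simp add: 1 comm_simps)
  then have 0: "f (gen 0) = 0" by (rule of_int_mult_eq_0[rotated]) simp_all
  have "f (gen n) = 0" for n
  proof (cases "n = 0")
    case False
    have "of_int n * f (gen n) = 0" using comm_f_wsp[OF gen_wsp[of n]] by (simp add: 0 comm_simps)
    then show ?thesis using False by (rule of_int_mult_eq_0[rotated]) simp_all
  qed (simp add: 0)
  then have word: "f (word (i # w)) = 0" for i w by (simp add: f_mult)
  have scalar: "\<exists>r. f x = f (scal r)" if "x \<in> alg" for x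
    using that
  proof (induction x rule: alg_induct)
    case (smon M r)
    show ?case
    proof (cases "sorted_list_of_multiset M")
      case Nil
      then show ?thesis by auto
    next
      case (Cons i w)
      then show ?thesis using word[of i w] by (intro exI[of _ 0]) (simp add: f_mult)
    qed
  next
    case (add x y)
    then obtain r s where "f x = f (scal r)" "f y = f (scal s)" by blast
    then show ?case using add by (intro exI[of _ "r + s"]) (simp add: f_add)
  qed (auto intro: exI[of _ 0])
  obtain x y where xy: "x \<in> alg" "f x = gen 0" "y \<in> alg" "f y = gen 1" using f_surj by (meson alg_closed(3))
  obtain r s where "f x = f (scal r)" "f y = f (scal s)" using scalar xy by blast
  then have "comm (gen 0) (gen 1) = f (comm (scal r) (scal s))" using xy by (simp add: f_comm)
  also have "comm (scal r) (scal s) = 0" by (simp add: comm_def mult.commute flip: scal_mult)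
  finally have "co (gen 1) = 0" using comm_gen[of 0 1] by (simp add: cocyc_def)
  then show False by simp
qed

text \<open>
  Since $e_0$ is locally finite and \<open>f\<close> is surjective, \<open>loc_fin_affine\<close>
  gives $f(e_0) = \alpha e_0 + z$. Comparing eigenvalues for the image of $e_1$ and for a preimage
  of $e_1$ shows that \<open>\<alpha>\<close> is an integer dividing one.
\<close>

theorem f_gen0:
  obtains \<epsilon> z where "\<epsilon> = 1 \<or> \<epsilon> = - 1" "f (gen 0) = \<epsilon> * gen 0 + scal z"
proof -
  obtain \<alpha> z where f0: "f (gen 0) = scal \<alpha> * gen 0 + scal z"
    using loc_fin_affine[OF loc_fin_f_gen0] by auto
  have scaled: "\<alpha> * of_int (sum_mset M) = of_int n" if "u \<in> wsp n" "M \<in> supp (co (f u))" for u n M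
  proof -
    have u: "f u \<in> alg" using wsp_alg[OF that(1)] by simp
    have "comm (scal z) (f u) = 0" using scal_alg[OF u] by (simp add: comm_def)
    then have "scal \<alpha> * comm (gen 0) (f u) = of_int n * f u"
      using comm_f_wsp[OF that(1)] u by (simp add: f0 comm_simps(1) comm_scal(1))
    then have "cst \<alpha> * co (comm (gen 0) (f u)) = of_int n * co (f u)"
      using u by (metis alg_closed(3) alg_comm co_of_int_mult co_simps(5))
    from arg_cong[OF this, of "\<lambda>p. coef p M"] have "\<alpha> * (of_int (sum_mset M) * coef (co (f u)) M) = of_int n * coef (co (f u)) M"
      using u by (simp add: co_comm_gen0 coef_of_int_mult)
    then have "(\<alpha> * of_int (sum_mset M) - of_int n) * coef (co (f u)) M = 0"
      by (simp add: algebra_simps)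
    then show ?thesis using that(2) by (simp add: in_keys_iff)
  qed
  have "co (f (gen 1)) \<noteq> 0" using f_gen1_neq_0 by (metis alg_closed(3) emb_co emb_simps(1) f_alg)
  then obtain M where M: "M \<in> supp (co (f (gen 1)))" by (metis all_not_in_conv keys_eq_empty)
  from scaled[OF gen_wsp M] have 1: "\<alpha> * of_int (sum_mset M) = 1" by simp
  obtain y where y: "y \<in> alg" "f y = gen 1" using f_surj by (meson alg_closed(3))
  have "gen 1 = (\<Sum>n\<in>sum_mset ` supp (co y). f (wcomp n y))"
    using f_sum[of "sum_mset ` supp (co y)" "\<lambda>n. wcomp n y"] sum_wcomp[OF y(1)] wsp_alg[OF wcomp_wsp] y(2) by simp
  then have "co (gen 1) = (\<Sum>n\<in>sum_mset ` supp (co y). co (f (wcomp n y)))"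
    by (simp only:) (rule co_sum, simp add: wsp_alg[OF wcomp_wsp])
  then have "1 = (\<Sum>n\<in>sum_mset ` supp (co y). coef (co (f (wcomp n y))) {#1#})"
    by (metis co_gen lookup_sum mon_def lookup_single_eq)
  then obtain n where "coef (co (f (wcomp n y))) {#1#} \<noteq> 0"
    by (metis (no_types, lifting) sum.neutral zero_neq_one)
  then have "{#1#} \<in> supp (co (f (wcomp n y)))" by (simp add: in_keys_iff)
  from scaled[OF wcomp_wsp this] have \<alpha>: "\<alpha> = of_int n" by simp
  with 1 have "of_int (n * sum_mset M) = (of_int 1 :: 'z)" by simp
  then have "n * sum_mset M = 1" by (simp only: of_int_eq_iff)
  then have "n = 1 \<or> n = - 1" by (auto simp: zmult_eq_1_iff)
  then show ?thesis using f0 \<alpha> by (intro that[of "of_int n" z]) auto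
qed

text \<open>
  The image of a scalar commutes with the image of \<open>f\<close>, which is everything.
\<close>

lemma f_scal_central: "\<exists>s. f (scal r) = scal s"
proof (rule central_scalar)
  fix t
  obtain x where x: "x \<in> alg" "f x = gen t" using f_surj by (meson alg_closed(3))
  have "comm (scal r) x = 0" using scal_alg[OF x(1)] by (simp add: comm_def)
  then show "comm (f (scal r)) (gen t) = 0" using f_comm[of "scal r" x] x by simp
qed simp

end

section \<open>Evaluation in Verma-type modules\<close>

text \<open>
  The sum of the positive indices of a monomial. Sorted words end in their positive letters, so it
  is the weight of that positive end.
\<close>

definition pos_weight :: "int multiset \<Rightarrow> int" where
  "pos_weight M = sum_mset (filter_mset (\<lambda>i. 0 < i) M)"

abbreviation nonzero :: "int multiset \<Rightarrow> int multiset" where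
  "nonzero M \<equiv> filter_mset (\<lambda>i. i \<noteq> 0) M"

lemma pos_weight_simps [simp]:
  "pos_weight {#} = 0" "pos_weight (M + M') = pos_weight M + pos_weight M'"
  "pos_weight (add_mset i M) = (if 0 < i then i else 0) + pos_weight M"
  by (simp_all add: pos_weight_def)

lemma pos_weight_nonneg: "0 \<le> pos_weight M"
  by (induction M) auto

lemma pos_weight_ge_sum: "sum_mset M \<le> pos_weight M"
  by (induction M) auto

lemma pos_weight_nonzero [simp]: "pos_weight (nonzero M) = pos_weight M"
  by (induction M) auto

lemma sum_mset_nonzero [simp]: "sum_mset (nonzero M) = (sum_mset M :: int)"
  by (induction M) auto

lemma pos_weight_mset_pos: "\<forall>i\<in>set w. 0 < i \<Longrightarrow> pos_weight (mset w) = sum_list w"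
  by (induction w) auto

lemma size_le_pos_weight: "\<forall>i\<in>#M. i \<noteq> 0 \<Longrightarrow> int (size M) \<le> 2 * pos_weight M - sum_mset M"
  by (induction M) auto

lemma abs_le_pos_weight: "i \<in># M \<Longrightarrow> \<bar>i\<bar> \<le> 2 * pos_weight M - sum_mset M"
proof (induction M)
  case (add j M)
  have "0 \<le> 2 * pos_weight M - sum_mset M" using pos_weight_ge_sum[of M] pos_weight_nonneg[of M] by linarith
  then show ?case using add by auto
qed simp

lemma finite_msets_bounded: "finite S \<Longrightarrow> finite {M. set_mset M \<subseteq> S \<and> size M \<le> n}"
proof (induction n)
  case (Suc n)
  have "{M. set_mset M \<subseteq> S \<and> size M \<le> Suc n} \<subseteq>
      insert {#} ((\<lambda>(i, M). add_mset i M) ` (S \<times> {M. set_mset M \<subseteq> S \<and> size M \<le> n}))"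
  proof
    fix M assume "M \<in> {M. set_mset M \<subseteq> S \<and> size M \<le> Suc n}"
    then show "M \<in> insert {#} ((\<lambda>(i, M). add_mset i M) ` (S \<times> {M. set_mset M \<subseteq> S \<and> size M \<le> n}))"
      by (cases M) auto
  qed
  then show ?case using Suc by (auto intro: finite_subset)
qed simp

text \<open>
  A basis of the weight space \<open>n\<close> of the algebra modulo the left ideal described at
  \<open>verma\<close> together with all elements of \<open>above m\<close>.
\<close>

definition verma_index :: "int \<Rightarrow> int \<Rightarrow> int multiset set" where
  "verma_index n m = {M. 0 \<notin># M \<and> sum_mset M = n \<and> pos_weight M < m}"

lemma finite_verma_index: "finite (verma_index n m)"
proof (rule finite_subset)
  let ?B = "2 * m - n"
  show "verma_index n m \<subseteq> {M. set_mset M \<subseteq> {- ?B..?B} \<and> size M \<le> nat ?B}"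
  proof
    fix M assume M: "M \<in> verma_index n m"
    have "i \<in> {- ?B..?B}" if "i \<in># M" for i
      using abs_le_pos_weight[OF that] M by (auto simp: verma_index_def)
    moreover have "int (size M) \<le> ?B"
      using size_le_pos_weight[of M] M by (force simp: verma_index_def)
    ultimately show "M \<in> {M. set_mset M \<subseteq> {- ?B..?B} \<and> size M \<le> nat ?B}" by auto
  qed
qed (rule finite_msets_bounded, simp)

text \<open>
  A descent that meets a positive suffix from the left begins with a larger letter, which is
  positive as well. Hence swaps and brackets never lower the weight of the positive end of a word.
\<close>

lemma nf_pos_suffix:
  assumes "w = v @ p" "\<forall>i\<in>set p. 0 < i" "m \<le> sum_list p" "K \<in> supp (nf \<delta> w)"
  shows "m \<le> pos_weight K"
proof -
  have "(\<exists>v p. w = v @ p \<and> (\<forall>i\<in>set p. 0 < i) \<and> m \<le> sum_list p) \<Longrightarrow> \<forall>K\<in>supp (nf \<delta> w). m \<le> pos_weight K" for w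
  proof (induction w rule: sorting_induct[where \<delta> = \<delta>])
    case (sorted w)
    then obtain v p where "w = v @ p" "\<forall>i\<in>set p. 0 < i" "m \<le> sum_list p" by blast
    then show ?case using sorted pos_weight_mset_pos[of p] pos_weight_nonneg[of "mset v"]
      by (simp add: nf_sorted supp_mon)
  next
    case (descent u b a v')
    obtain v p where vp: "u @ b # a # v' = v @ p" and p: "\<forall>i\<in>set p. 0 < i" "m \<le> sum_list p"
      using descent.prems by blast
    let ?Q = "\<lambda>w. \<exists>v p. w = v @ p \<and> (\<forall>i\<in>set p. 0 < i) \<and> m \<le> sum_list p"
    have "?Q (u @ a # b # v') \<and> ?Q (u @ (a + b) # v') \<and> (a + b = 0 \<longrightarrow> ?Q (u @ v'))"
    proof -
      have inside: ?thesis if "u = v0 @ p0" "\<forall>i\<in>set (p0 @ b # a # v'). 0 < i" "m \<le> sum_list (p0 @ b # a # v')" for v0 p0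
      proof -
        have "?Q (u @ a # b # v')" using that by (intro exI[of _ v0] exI[of _ "p0 @ a # b # v'"]) auto
        moreover have "?Q (u @ (a + b) # v')" using that by (intro exI[of _ v0] exI[of _ "p0 @ (a + b) # v'"]) auto
        moreover have "a + b \<noteq> 0" using that(2) by auto
        ultimately show ?thesis by blast
      qed
      consider (in_suffix) p0 where "u = v @ p0" "p = p0 @ b # a # v'" | (border) "v = u @ [b]" "p = a # v'"
        | (in_prefix) v1 where "v = u @ b # a # v1" "v' = v1 @ p"
      proof -
        have "(\<exists>p0. u = v @ p0 \<and> p = p0 @ b # a # v') \<or> (\<exists>q. v = u @ q \<and> b # a # v' = q @ p)"
          using vp by (auto simp: append_eq_append_conv2)
        then show ?thesis
        proof (elim disjE exE conjE)
          fix q assume q: "v = u @ q" "b # a # v' = q @ p"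
          show ?thesis
          proof (cases q)
            case Nil
            then show ?thesis using q that(1)[of "[]"] by simp
          next
            case (Cons x q')
            then show ?thesis using q that(2) that(3) by (cases q') auto
          qed
        qed (use that(1) in blast)
      qed
      then show ?thesis
      proof cases
        case (in_suffix p0)
        then show ?thesis using inside[of v p0] p by simp
      next
        case border
        then show ?thesis using inside[of u "[]"] p descent.hyps(1) by simp
      next
        case (in_prefix v1)
        have "?Q (w @ p)" for w using p by blast
        from this[of "u @ a # b # v1"] this[of "u @ (a + b) # v1"] this[of "u @ v1"]
        show ?thesis using in_prefix by simp
      qed
    qed
    note IH = this
    show ?case
    proof
      fix K assume "K \<in> supp (nf \<delta> (u @ b # a # v'))"
      then have "K \<in> supp (nf \<delta> (u @ a # b # v')) \<or> K \<in> supp (nf_bracket \<delta> u b a v')"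
        unfolding descent.hyps(3) by (auto dest!: subsetD[OF Poly_Mapping.keys_add])
      then show "m \<le> pos_weight K" using supp_nf_bracket[of K \<delta> u b a v'] IH descent.IH by blast
    qed
  qed
  then show ?thesis using assms by blast
qed

lemma sorted_list_split:
  fixes M :: "int multiset"
  obtains N P where "sorted_list_of_multiset M = N @ P" "\<forall>i\<in>set N. i \<le> 0" "\<forall>i\<in>set P. 0 < i"
    "sum_list P = pos_weight M" "sorted_list_of_multiset (add_mset 0 M) = N @ 0 # P"
proof -
  let ?l = "sorted_list_of_multiset M"
  define N P where "N = takeWhile (\<lambda>i. i \<le> 0) ?l" and "P = dropWhile (\<lambda>i. i \<le> 0) ?l"
  have l: "?l = N @ P" by (simp add: N_def P_def)
  have s: "sorted (N @ P)" unfolding l[symmetric] by simp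
  have N: "\<forall>i\<in>set N. i \<le> 0" by (auto simp: N_def dest: set_takeWhileD)
  have P: "\<forall>i\<in>set P. 0 < i"
  proof (cases P)
    case (Cons x P')
    then have "\<not> x \<le> 0" unfolding P_def by (simp add: dropWhile_eq_Cons_conv)
    then show ?thesis using s Cons by (auto simp: sorted_append)
  qed simp
  have M: "M = mset (N @ P)" using arg_cong[OF l, of mset] by simp
  have "pos_weight (mset N) = 0" using N by (induction N) auto
  then have "sum_list P = pos_weight M" using pos_weight_mset_pos[OF P] by (simp add: M)
  moreover have "sorted (N @ 0 # P)" using s N P by (auto simp: sorted_append)
  then have "sorted_list_of_multiset (add_mset 0 M) = N @ 0 # P"
    by (metis M mset_append mset.simps(2) union_mset_add_mset_right sorted_list_of_multiset_mset sorted_sort_id)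
  ultimately show ?thesis using that l N P by blast
qed

definition ring_point :: "('z::comm_ring_1 \<Rightarrow> 'k::comm_ring_1) \<Rightarrow> bool" where
  "ring_point \<chi> \<longleftrightarrow> (\<forall>r s. \<chi> (r + s) = \<chi> r + \<chi> s) \<and> (\<forall>r s. \<chi> (r * s) = \<chi> r * \<chi> s) \<and> \<chi> 1 = 1"

lemma ring_pointD:
  assumes "ring_point \<chi>"
  shows "\<chi> (r + s) = \<chi> r + \<chi> s" "\<chi> (r * s) = \<chi> r * \<chi> s" "\<chi> 1 = 1" "\<chi> 0 = 0"
  using assms unfolding ring_point_def by (simp_all, metis add_cancel_right_left)

lemma ring_point_of_int: "ring_point \<chi> \<Longrightarrow> \<chi> (of_int n) = of_int n"
proof -
  assume \<chi>: "ring_point \<chi>"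
  have nat: "\<chi> (of_nat m) = of_nat m" for m by (induction m) (simp_all add: ring_pointD[OF \<chi>])
  have "\<chi> (- r) = - \<chi> r" for r
    using ring_pointD(1)[OF \<chi>, of r "- r"] by (simp add: ring_pointD[OF \<chi>] eq_neg_iff_add_eq_0 add.commute)
  then show ?thesis using nat by (cases n rule: int_cases2) simp_all
qed

context vir_pbw
begin

text \<open>
  The class of \<open>x\<close> modulo the left ideal generated by $e_0 - h$ and the kernel of
  \<open>\<chi>\<close>, written in the basis of sorted words without the letter $e_0$. In a sorted
  word the power of $e_0$ stands before the positive letters; moving it to the right end shifts
  $e_0$ by their weight.
\<close>

definition verma :: "('z \<Rightarrow> 'k::field_char_0) \<Rightarrow> 'k \<Rightarrow> 'a \<Rightarrow> 'k sym" where
  "verma \<chi> h x = ext_sum (\<lambda>M r. cst (\<chi> r) * (cst ((h + of_int (pos_weight M)) ^ count M 0) * mon (nonzero M))) (co x)"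

lemma verma_add: "ring_point \<chi> \<Longrightarrow> x \<in> alg \<Longrightarrow> y \<in> alg \<Longrightarrow> verma \<chi> h (x + y) = verma \<chi> h x + verma \<chi> h y"
  unfolding verma_def by (simp, rule ext_sum_add) (simp_all add: ring_pointD distrib_right)

lemma verma_0 [simp]: "verma \<chi> h 0 = 0"
  by (simp add: verma_def)

lemma verma_scal_smon: "ring_point \<chi> \<Longrightarrow> verma \<chi> h (scal r * smon M) =
    cst (\<chi> r) * (cst ((h + of_int (pos_weight M)) ^ count M 0) * mon (nonzero M))"
  unfolding verma_def co_simps(5)[OF word_in_alg] co_smon single_eq_cst_mon[symmetric]
  by (rule ext_sum_single) (simp add: ring_pointD)

lemma verma_smon: "ring_point \<chi> \<Longrightarrow>
    verma \<chi> h (smon M) = cst ((h + of_int (pos_weight M)) ^ count M 0) * mon (nonzero M)"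
  using verma_scal_smon[of \<chi> h 1 M] by (simp add: ring_pointD)

lemma verma_scal:
  assumes \<chi>: "ring_point \<chi>"
  shows "x \<in> alg \<Longrightarrow> verma \<chi> h (scal r * x) = cst (\<chi> r) * verma \<chi> h x"
proof (induction x rule: alg_induct)
  case (smon M s)
  have "scal r * (scal s * smon M) = scal (r * s) * smon M" by (simp add: mult.assoc)
  then show ?case by (simp only: verma_scal_smon[OF \<chi>] ring_pointD[OF \<chi>] cst_simps mult.assoc)
qed (simp_all add: distrib_left verma_add[OF \<chi>])

lemma verma_of_int: "ring_point \<chi> \<Longrightarrow> x \<in> alg \<Longrightarrow> verma \<chi> h (of_int n * x) = of_int n * verma \<chi> h x"
  using verma_scal[of \<chi> x h "of_int n"] by (simp add: ring_point_of_int)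

lemma verma_1: "ring_point \<chi> \<Longrightarrow> verma \<chi> h 1 = 1"
  using verma_smon[of \<chi> h "{#}"] by simp

lemma smon_gen0: "smon M * gen 0 = smon (add_mset 0 M) - of_int (pos_weight M) * smon M"
proof -
  obtain N P where M: "sorted_list_of_multiset M = N @ P" "sum_list P = pos_weight M"
      "sorted_list_of_multiset (add_mset 0 M) = N @ 0 # P"
    using sorted_list_split by metis
  have "word P * gen 0 = gen 0 * word P - of_int (pos_weight M) * word P"
    using comm_gen0_word[of P] M(2) by (simp add: comm_def algebra_simps)
  then have "word N * (word P * gen 0) = word N * (gen 0 * word P) - of_int (pos_weight M) * (word N * word P)"
    using scal_word[of "of_int (pos_weight M)" N] by (simp add: right_diff_distrib) (simp flip: mult.assoc)
  then show ?thesis unfolding M(1,3) by (simp add: mult.assoc)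
qed

text \<open>
  Right multiplication by $e_0$ acts as the scalar \<open>h\<close>, so the left ideal generated by
  $e_0 - h$ is killed.
\<close>

lemma verma_gen0:
  assumes \<chi>: "ring_point \<chi>"
  shows "x \<in> alg \<Longrightarrow> verma \<chi> h (x * gen 0) = cst h * verma \<chi> h x"
proof (induction x rule: alg_induct)
  case (smon M r)
  have "verma \<chi> h (smon M * gen 0 + of_int (pos_weight M) * smon M) = verma \<chi> h (smon (add_mset 0 M))"
    unfolding smon_gen0 diff_add_cancel ..
  then have "verma \<chi> h (smon M * gen 0) = verma \<chi> h (smon (add_mset 0 M)) - of_int (pos_weight M) * verma \<chi> h (smon M)"
    by (simp add: verma_add[OF \<chi>] verma_of_int[OF \<chi>] eq_diff_eq del: sorted_list_of_multiset_insert)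
  also have "\<dots> = cst h * verma \<chi> h (smon M)"
    by (simp add: verma_smon[OF \<chi>] algebra_simps del: sorted_list_of_multiset_insert)
  finally show ?case by (simp add: verma_scal[OF \<chi>] mult.assoc mult.left_commute)
qed (simp_all add: distrib_left distrib_right verma_add[OF \<chi>])

text \<open>
  The left ideal spanned by the words that end in positive letters of total weight at least
  \<open>m\<close>.
\<close>

definition above :: "int \<Rightarrow> 'a set" where
  "above m = {x \<in> alg. \<forall>M\<in>supp (co x). m \<le> pos_weight M}"

lemma wsp_above: "x \<in> wsp n \<Longrightarrow> m \<le> n \<Longrightarrow> x \<in> above m"
  using order_trans[OF _ pos_weight_ge_sum] by (simp add: wsp_def above_def)

lemma above_closed:
  "0 \<in> above m" "x \<in> above m \<Longrightarrow> y \<in> above m \<Longrightarrow> x + y \<in> above m" "x \<in> above m \<Longrightarrow> scal r * x \<in> above m"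
  using subsetD[OF Poly_Mapping.keys_add[of "co x" "co y"]] subsetD[OF supp_cst_mult[of r "co x"]]
  by (auto simp: above_def)

text \<open>
  A product of words has the positive end of its right factor as a suffix, so
  \<open>nf_pos_suffix\<close> applies.
\<close>

lemma mult_above:
  assumes "x \<in> alg" "y \<in> above m"
  shows "x * y \<in> above m"
  using assms(1)
proof (induction x rule: alg_induct)
  case (smon K r)
  define S where "S = {M. m \<le> pos_weight M}"
  have "scal r * smon K * emb p \<in> above m" if "supp p \<subseteq> S" for p
    using that
  proof (induction p rule: supp_induct)
    case (single M s)
    obtain N P where M: "sorted_list_of_multiset M = N @ P" "\<forall>i\<in>set P. 0 < i" "sum_list P = pos_weight M"
      using sorted_list_split by metis
    have "word (sorted_list_of_multiset K @ sorted_list_of_multiset M) \<in> above m"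
      unfolding above_def
    proof (intro CollectI conjI ballI word_in_alg)
      fix K' assume "K' \<in> supp (co (word (sorted_list_of_multiset K @ sorted_list_of_multiset M)))"
      then have "K' \<in> supp (nf \<delta> (sorted_list_of_multiset K @ sorted_list_of_multiset M))" by (simp only: co_word)
      then show "m \<le> pos_weight K'"
        using M single by (intro nf_pos_suffix[of _ "sorted_list_of_multiset K @ N" P m K' \<delta>]) (auto simp: S_def)
    qed
    then show ?case
      unfolding single_eq_cst_mon emb_simps smon_mult by (rule above_closed(3))
  qed (simp_all add: distrib_left above_closed)
  from this[of "co y"] show ?case using assms(2) by (simp add: above_def S_def subset_iff)
qed (simp_all add: distrib_right above_closed)

lemma verma_above:
  assumes "x \<in> above m" "M \<in> supp (verma \<chi> h x)" "\<chi> 0 = 0"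
  shows "m \<le> pos_weight M"
proof (rule ccontr)
  assume M: "\<not> m \<le> pos_weight M"
  have "coef (verma \<chi> h x) M = (\<Sum>K\<in>supp (co x). coef (cst (\<chi> (coef (co x) K)) *
      (cst ((h + of_int (pos_weight K)) ^ count K 0) * mon (nonzero K))) M)"
    by (simp add: verma_def ext_sum_def lookup_sum)
  also have "\<dots> = 0"
    using assms(1) M by (intro sum.neutral) (auto simp: above_def mon_def lookup_single when_def)
  finally show False using assms(2) by (simp add: in_keys_iff)
qed

lemma verma_weight:
  assumes "x \<in> wsp n" "M \<in> supp (verma \<chi> h x)"
  shows "0 \<notin># M \<and> sum_mset M = n"
proof (rule ccontr)
  assume M: "\<not> (0 \<notin># M \<and> sum_mset M = n)"
  have "coef (verma \<chi> h x) M = (\<Sum>K\<in>supp (co x). coef (cst (\<chi> (coef (co x) K)) *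
      (cst ((h + of_int (pos_weight K)) ^ count K 0) * mon (nonzero K))) M)"
    by (simp add: verma_def ext_sum_def lookup_sum)
  also have "\<dots> = 0"
    using assms(1) M by (intro sum.neutral) (auto simp: wsp_def mon_def lookup_single when_def)
  finally show False using assms(2) by (simp add: in_keys_iff)
qed

text \<open>
  For a fixed monomial without $e_0$, the value at \<open>h\<close> is a polynomial in
  \<open>h\<close> whose coefficients are the \<open>\<chi>\<close>-values of the coefficients of
  \<open>x\<close>; it vanishes identically over an infinite field.
\<close>

lemma verma_separates:
  fixes \<chi> :: "'z \<Rightarrow> 'k::field_char_0"
  assumes \<chi>: "ring_point \<chi>" and "\<And>h. verma \<chi> h x = 0"
  shows "\<chi> (coef (co x) M) = 0"
proof -
  define P where "P q = ext_sum (\<lambda>K r. if nonzero K = nonzero M then Polynomial.monom (\<chi> r) (count K 0) else 0) q" for q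
  have P_add: "P (p + q) = P p + P q" for p q
    unfolding P_def by (rule ext_sum_add) (simp_all add: ring_pointD[OF \<chi>] Polynomial.add_monom)
  have P_mon: "P (cst r * mon K) = (if nonzero K = nonzero M then Polynomial.monom (\<chi> r) (count K 0) else 0)" for r K
    unfolding P_def single_eq_cst_mon[symmetric] by (rule ext_sum_single) (simp add: ring_pointD[OF \<chi>])
  have "poly (P q) (h + of_int (pos_weight M)) =
      coef (ext_sum (\<lambda>M r. cst (\<chi> r) * (cst ((h + of_int (pos_weight M)) ^ count M 0) * mon (nonzero M))) q) (nonzero M)" for q h
  proof (induction q rule: sym_induct)
    case zero
    show ?case by (simp add: P_def)
  next
    case (mon K r)
    have "nonzero K = nonzero M \<Longrightarrow> pos_weight K = pos_weight M" by (metis pos_weight_nonzero)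
    then show ?case unfolding P_mon unfolding single_eq_cst_mon[symmetric]
      by (subst ext_sum_single)
        (auto simp: ring_pointD[OF \<chi>] poly_monom mon_def[of "nonzero K"] lookup_single when_def mult.commute)
  next
    case (add p q)
    then show ?case unfolding P_add
      by (subst ext_sum_add) (simp_all add: ring_pointD[OF \<chi>] distrib_right lookup_add)
  qed
  from this[of "co x"] have "poly (P (co x)) (h + of_int (pos_weight M)) = 0" for h
    using assms(2)[of h] by (simp add: verma_def)
  from this[of "_ - of_int (pos_weight M)"] have "poly (P (co x)) h = 0" for h by simp
  then have "P (co x) = 0" using poly_all_0_iff_0 by blast
  moreover have "poly.coeff (P q) (count M 0) = \<chi> (coef q M)" for q
  proof (induction q rule: sym_induct)
    case zero
    show ?case by (simp add: P_def ring_pointD[OF \<chi>])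
  next
    case (mon K r)
    have "K = M" if "nonzero K = nonzero M" "count K 0 = count M 0"
    proof (rule multiset_eqI)
      fix i show "count K i = count M i"
        using that(2) arg_cong[OF that(1), of "\<lambda>M. count M i"] by (cases "i = 0") simp_all
    qed
    then show ?case unfolding P_mon
      by (auto simp: mon_def lookup_single when_def ring_pointD[OF \<chi>] cst_mult_single)
  qed (simp_all add: P_add lookup_add ring_pointD[OF \<chi>])
  ultimately show ?thesis by (metis coeff_0)
qed

end

section \<open>Surjective endomorphisms are injective\<close>

lemma mon_eq_iff: "mon M = (mon K :: 'z::comm_ring_1 sym) \<longleftrightarrow> M = K"
  by (metis supp_mon singleton_inject)

text \<open>
  In a linear relation one member could be expressed by the others, and fewer vectors than the
  cardinality of \<open>Q\<close> would span the independent monomials indexed by \<open>Q\<close>.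
\<close>

lemma spanning_family_independent:
  fixes W :: "int multiset \<Rightarrow> 'k::field sym"
  assumes Q: "finite Q" and span: "\<And>M. M \<in> Q \<Longrightarrow> \<exists>c. mon M = (\<Sum>K\<in>Q. cst (c K) * W K)"
    and zero: "(\<Sum>K\<in>Q. cst (v K) * W K) = 0" and "K \<in> Q"
  shows "v K = 0"
proof (rule ccontr)
  assume vK: "v K \<noteq> 0"
  interpret vs: vector_space "\<lambda>a p. cst a * (p :: 'k sym)"
    by standard (simp_all add: distrib_left distrib_right mult.assoc)
  let ?T = "W ` (Q - {K})"
  have "vs.independent (mon ` Q)"
    unfolding vs.independent_explicit_finite_subsets
  proof (intro allI impI ballI)
    fix A and u :: "'k sym \<Rightarrow> 'k" and p
    assume A: "A \<subseteq> mon ` Q" "finite A" "(\<Sum>p\<in>A. cst (u p) * p) = 0" "p \<in> A"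
    then obtain M where M: "p = mon M" by auto
    have "coef (\<Sum>p\<in>A. cst (u p) * p) M = (\<Sum>q\<in>A. if q = p then u p else 0)"
      unfolding lookup_sum
    proof (intro sum.cong refl)
      fix q assume "q \<in> A"
      then obtain K where q: "q = mon K" using A(1) by auto
      then show "coef (cst (u q) * q) M = (if q = p then u p else 0)"
      proof (cases "K = M")
        case True
        then show ?thesis using M q by (simp add: mon_def)
      next
        case False
        then have "q \<noteq> p" using M q by (simp add: mon_eq_iff)
        then show ?thesis using False q by (simp add: mon_def lookup_single when_def)
      qed
    qed
    also have "\<dots> = u p" using A by simp
    finally show "u p = 0" using A(3) by simp
  qed
  moreover have "mon ` Q \<subseteq> vs.span ?T"
  proof
    have "cst (v K) * W K + (\<Sum>L\<in>Q - {K}. cst (v L) * W L) = 0"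
      using zero sum.remove[OF Q \<open>K \<in> Q\<close>, of "\<lambda>L. cst (v L) * W L"] by simp
    then have "cst (v K) * W K = - (\<Sum>L\<in>Q - {K}. cst (v L) * W L)"
      by (simp add: eq_neg_iff_add_eq_0)
    moreover have "(\<Sum>L\<in>Q - {K}. cst (v L) * W L) \<in> vs.span ?T"
      by (intro vs.span_sum vs.span_scale vs.span_base) simp
    ultimately have "cst (v K) * W K \<in> vs.span ?T" by (simp add: vs.span_neg)
    then have "cst (inverse (v K)) * (cst (v K) * W K) \<in> vs.span ?T" by (rule vs.span_scale)
    also have "cst (inverse (v K)) * (cst (v K) * W K) = cst (inverse (v K) * v K) * W K"
      by (simp only: cst_simps mult.assoc)
    finally have "W K \<in> vs.span ?T" using vK by simp
    then have W: "W L \<in> vs.span ?T" if "L \<in> Q" for L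
      using that by (cases "L = K") (auto intro: vs.span_base)
    fix p :: "'k sym" assume "p \<in> mon ` Q"
    then obtain c where "p = (\<Sum>K\<in>Q. cst (c K) * W K)" using span by blast
    then show "p \<in> vs.span ?T" by (auto intro!: vs.span_sum vs.span_scale W)
  qed
  ultimately have "card (mon ` Q :: 'k sym set) \<le> card ?T"
    using vs.independent_span_bound[of ?T "mon ` Q"] Q by simp
  also have "\<dots> \<le> card (Q - {K})" using Q by (intro card_image_le) simp
  also have "\<dots> < card Q" using Q \<open>K \<in> Q\<close> by (rule card_Diff1_less)
  also have "card Q = card (mon ` Q :: 'k sym set)"
    by (rule card_image[symmetric]) (simp add: inj_on_def mon_eq_iff)
  finally show False by simp
qed

lemma restr_0 [simp]: "restr S 0 = 0"
  by (simp add: restr_def)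

lemma restr_add: "restr S (p + q) = restr S p + restr S q"
  by (simp add: restr_def)

lemma restr_sum: "restr S (sum p I) = (\<Sum>i\<in>I. restr S (p i))"
  by (induction I rule: infinite_finite_induct) (simp_all add: restr_add)

lemma restr_cst: "restr S (cst r * p) = cst r * restr S p"
  by (rule poly_mapping_eqI) (simp add: coef_restr)

lemma restr_mon: "M \<in> S \<Longrightarrow> restr S (mon M) = mon M"
  by (simp add: restr_def)

lemma (in vir_pbw) coef_wsp: "x \<in> wsp n \<Longrightarrow> sum_mset M \<noteq> n \<Longrightarrow> coef (co x) M = 0"
  by (auto simp: wsp_def in_keys_iff)

text \<open>
  The target carries its own generators \<open>gen'\<close>, so that both signs of $f(e_0) = \pm e_0
  + z$ are covered by taking \<open>gen' n\<close> to be $e_n$ or $-e_{-n}$.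
\<close>

locale vir_epi_graded = vir_epi scal gen \<delta> sbl f + target: vir_pbw scal gen' \<delta>' sbl'
  for scal :: "'z::{idom, ring_char_0} \<Rightarrow> 'a::ring_1" and gen \<delta> sbl f gen' \<delta>' sbl' +
  fixes \<phi> :: "'z \<Rightarrow> 'z" and z :: 'z
  assumes alg_eq: "target.alg = alg"
    and f_gen0_eq: "f (gen 0) = gen' 0 + scal z"
    and f_scal: "f (scal r) = scal (\<phi> r)"
begin

lemma scal_inj: "scal r = scal s \<Longrightarrow> r = s"
proof -
  assume "scal r = scal s"
  then have "coef (co (scal r)) 0 = coef (co (scal s)) 0" by simp
  then show ?thesis by (simp add: cst_def)
qed

lemma \<phi>_hom: "\<phi> (r + s) = \<phi> r + \<phi> s" "\<phi> (r * s) = \<phi> r * \<phi> s" "\<phi> 1 = 1"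
  using f_add[of "scal r" "scal s"] f_mult[of "scal r" "scal s"] f_scal[of 1]
  by (auto intro!: scal_inj simp flip: f_scal)

lemma ring_point_comp: "ring_point \<chi> \<Longrightarrow> ring_point (\<chi> \<circ> \<phi>)"
  by (simp add: ring_point_def \<phi>_hom)

lemma f_wsp:
  assumes "u \<in> wsp n"
  shows "f u \<in> target.wsp n"
proof (rule target.wspI)
  have u: "f u \<in> alg" using wsp_alg[OF assms] by simp
  then show "f u \<in> target.alg" by (simp add: alg_eq)
  have "comm (scal z) (f u) = 0" using scal_alg[OF u] by (simp add: comm_def)
  then show "comm (gen' 0) (f u) = of_int n * f u"
    using comm_f_wsp[OF assms] by (simp add: f_gen0_eq comm_simps(1))
qed

lemma coef_f_wcomp:
  assumes "x \<in> alg"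
  shows "coef (target.co (f x)) M = coef (target.co (f (wcomp (sum_mset M) x))) M"
proof -
  let ?I = "sum_mset ` supp (co x)"
  have alg: "f (wcomp n x) \<in> target.alg" for n using wsp_alg[OF wcomp_wsp] by (simp add: alg_eq)
  have "f x = (\<Sum>n\<in>?I. f (wcomp n x))"
    using f_sum[of ?I "\<lambda>n. wcomp n x"] sum_wcomp[OF assms] wsp_alg[OF wcomp_wsp] by simp
  then have "coef (target.co (f x)) M = (\<Sum>n\<in>?I. coef (target.co (f (wcomp n x))) M)"
    using target.co_sum[of ?I "\<lambda>n. f (wcomp n x)"] alg by (simp add: lookup_sum)
  also have "\<dots> = (\<Sum>n\<in>?I. if n = sum_mset M then coef (target.co (f (wcomp (sum_mset M) x))) M else 0)"
    using target.coef_wsp[OF f_wsp[OF wcomp_wsp[of _ x]], of M] by (intro sum.cong refl) auto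
  also have "\<dots> = coef (target.co (f (wcomp (sum_mset M) x))) M"
  proof (cases "sum_mset M \<in> ?I")
    case False
    have "weight_part (sum_mset M) (co x) = 0"
    proof (rule poly_mapping_eqI)
      fix K
      have "sum_mset K = sum_mset M \<Longrightarrow> K \<notin> supp (co x)" using False by (metis imageI)
      then show "coef (weight_part (sum_mset M) (co x)) K = coef 0 K" by (simp add: coef_restr in_keys_iff)
    qed
    then have "wcomp (sum_mset M) x = 0" by (simp add: wcomp_def)
    then show ?thesis by simp
  qed simp
  finally show ?thesis .
qed

lemma f_wsp_surj:
  assumes "y \<in> target.wsp n"
  obtains u where "u \<in> wsp n" "f u = y"
proof -
  have y: "y \<in> target.alg" by (rule target.wsp_alg[OF assms])
  then obtain x where x: "x \<in> alg" "f x = y" using f_surj alg_eq by blast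
  let ?u = "wcomp n x"
  have "coef (target.co y) M = coef (target.co (f ?u)) M" for M
    using coef_f_wcomp[OF x(1), of M] target.coef_wsp[OF f_wsp[OF wcomp_wsp[of n x]], of M]
      target.coef_wsp[OF assms, of M] x(2)
    by (cases "sum_mset M = n") auto
  then have "target.co y = target.co (f ?u)" by (rule poly_mapping_eqI)
  then have "f ?u = y" using y target.wsp_alg[OF f_wsp[OF wcomp_wsp[of n x]]] by (simp add: target.co_eq_iff)
  then show ?thesis using that wcomp_wsp by blast
qed

lemma verma_f_smon:
  fixes \<chi> :: "'z \<Rightarrow> 'k::field_char_0"
  assumes \<chi>: "ring_point \<chi>"
  shows "target.verma \<chi> h (f (smon M)) =
    cst ((h + \<chi> z + of_int (pos_weight M)) ^ count M 0) * target.verma \<chi> h (f (smon (nonzero M)))"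
proof (induction "count M 0" arbitrary: M)
  case 0
  then have "nonzero M = M" by (auto simp: filter_mset_eq_conv count_eq_zero_iff intro!: multiset_eqI)
  then show ?case using 0 by simp
next
  case (Suc k)
  then have "0 \<in># M" by (metis count_inI nat.distinct(1))
  then obtain K where M: "M = add_mset 0 K" by (metis multi_member_split)
  let ?w = "f (smon K)"
  have w: "?w \<in> target.alg" by (simp add: alg_eq)
  have "smon M = smon K * gen 0 + of_int (pos_weight K) * smon K"
    unfolding M smon_gen0 by simp
  then have "f (smon M) = ?w * gen' 0 + scal z * ?w + of_int (pos_weight K) * ?w"
    using scal_alg[of ?w z] by (simp add: f_add f_mult f_of_int f_gen0_eq distrib_left)
  then have "target.verma \<chi> h (f (smon M)) =
      cst h * target.verma \<chi> h ?w + cst (\<chi> z) * target.verma \<chi> h ?w + of_int (pos_weight K) * target.verma \<chi> h ?w"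
    using w by (simp add: target.verma_add[OF \<chi>] target.verma_gen0[OF \<chi>] target.verma_scal[OF \<chi>] target.verma_of_int[OF \<chi>])
  also have "\<dots> = cst (h + \<chi> z + of_int (pos_weight K)) * target.verma \<chi> h ?w"
    by (simp add: distrib_right)
  also have "target.verma \<chi> h ?w = cst ((h + \<chi> z + of_int (pos_weight K)) ^ count K 0) * target.verma \<chi> h (f (smon (nonzero K)))"
    using Suc(1)[of K] Suc(2) M by simp
  finally show ?case
    unfolding M by (simp add: mult.assoc del: sorted_list_of_multiset_insert)
qed

lemma verma_f:
  fixes \<chi> :: "'z \<Rightarrow> 'k::field_char_0"
  assumes \<chi>: "ring_point \<chi>" and "x \<in> alg"
  shows "target.verma \<chi> h (f x) =
    ext_sum (\<lambda>M c. cst c * target.verma \<chi> h (f (smon M))) (verma (\<chi> \<circ> \<phi>) (h + \<chi> z) x)"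
proof -
  define \<psi> where "\<psi> = \<chi> \<circ> \<phi>"
  have \<psi>: "ring_point \<psi>" "\<psi> r = \<chi> (\<phi> r)" for r
    using ring_point_comp[OF \<chi>] by (simp_all add: \<psi>_def)
  have "target.verma \<chi> h (f x) =
      ext_sum (\<lambda>M c. cst c * target.verma \<chi> h (f (smon M))) (verma \<psi> (h + \<chi> z) x)"
    using assms(2)
proof (induction x rule: alg_induct)
  case (smon M r)
  have fs: "f (smon M) \<in> target.alg" by (simp add: alg_eq)
  have "target.verma \<chi> h (f (scal r * smon M)) = cst (\<chi> (\<phi> r)) * target.verma \<chi> h (f (smon M))"
    using target.verma_scal[OF \<chi> fs] by (simp add: f_mult f_scal)
  also have "\<dots> = cst (\<chi> (\<phi> r) * (h + \<chi> z + of_int (pos_weight M)) ^ count M 0) * target.verma \<chi> h (f (smon (nonzero M)))"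
    by (simp add: verma_f_smon[OF \<chi>, of h M] mult.assoc)
  also have "\<dots> = ext_sum (\<lambda>M c. cst c * target.verma \<chi> h (f (smon M)))
      (cst (\<chi> (\<phi> r) * (h + \<chi> z + of_int (pos_weight M)) ^ count M 0) * mon (nonzero M))"
    by (simp only: ext_sum_cst_mon)
  also have "cst (\<chi> (\<phi> r) * (h + \<chi> z + of_int (pos_weight M)) ^ count M 0) * mon (nonzero M) =
      verma \<psi> (h + \<chi> z) (scal r * smon M)"
    by (simp add: verma_scal_smon[OF \<psi>(1)] \<psi>(2) mult.assoc)
  finally show ?case .
next
  case (add x y)
  then show ?case
    by (simp add: f_add target.verma_add[OF \<chi>] verma_add[OF \<psi>(1)] alg_eq)
qed simp
  then show ?thesis by (simp only: \<psi>_def)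
qed

lemma f_smon_above: "f (smon M) \<in> target.above (pos_weight M)"
proof -
  obtain N P where M: "sorted_list_of_multiset M = N @ P" "sum_list P = pos_weight M"
    using sorted_list_split by metis
  have "f (word P) \<in> target.above (pos_weight M)"
    using f_wsp[OF word_wsp[of P]] M(2) by (intro target.wsp_above) auto
  then have "f (word N) * f (word P) \<in> target.above (pos_weight M)"
    by (intro target.mult_above) (simp_all add: alg_eq)
  then show ?thesis by (simp add: M(1) f_mult)
qed

text \<open>
  The map induced by \<open>f\<close> on the truncated weight space is well defined: it is
  determined by the class of \<open>u\<close> at the shifted parameters \<open>h + \<chi> z\<close>
  and \<open>\<chi> \<circ> \<phi>\<close>.
\<close>

lemma restr_verma_f:
  fixes \<chi> :: "'z \<Rightarrow> 'k::field_char_0"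
  assumes \<chi>: "ring_point \<chi>" and u: "u \<in> wsp n"
    and Q_def: "Q = verma_index n m" and v_def: "v = verma (\<chi> \<circ> \<phi>) (h + \<chi> z) u"
  shows "restr Q (target.verma \<chi> h (f u)) = (\<Sum>M\<in>Q. cst (coef v M) * restr Q (target.verma \<chi> h (f (smon M))))"
proof -
  let ?W = "\<lambda>M. restr Q (target.verma \<chi> h (f (smon M)))"
  have W0: "?W M = 0" if "M \<in> supp v" "M \<notin> Q" for M
  proof (rule poly_mapping_eqI)
    fix K
    have "m \<le> pos_weight M"
      using verma_weight[OF u that(1)[unfolded v_def]] that(2) by (auto simp: Q_def verma_index_def)
    then have "m \<le> pos_weight K" if "K \<in> supp (target.verma \<chi> h (f (smon M)))"
      using target.verma_above[OF f_smon_above that ring_pointD(4)[OF \<chi>]] by simp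
    then show "coef (?W M) K = coef 0 K"
      by (cases "K \<in> supp (target.verma \<chi> h (f (smon M)))")
        (auto simp: coef_restr in_keys_iff Q_def verma_index_def)
  qed
  have "restr Q (target.verma \<chi> h (f u)) = (\<Sum>M\<in>supp v. cst (coef v M) * ?W M)"
    using verma_f[OF \<chi> wsp_alg[OF u], of h] by (simp add: ext_sum_def restr_sum restr_cst v_def)
  also have "\<dots> = (\<Sum>M\<in>supp v \<inter> Q. cst (coef v M) * ?W M)"
    by (rule sum.mono_neutral_right) (auto simp: W0)
  also have "\<dots> = (\<Sum>M\<in>Q. cst (coef v M) * ?W M)"
    using finite_verma_index by (intro sum.mono_neutral_left) (auto simp: Q_def in_keys_iff)
  finally show ?thesis .
qed

lemma verma_kernel:
  fixes \<chi> :: "'z \<Rightarrow> 'k::field_char_0"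
  assumes \<chi>: "ring_point \<chi>" and u: "u \<in> wsp n" and "f u = 0"
  shows "verma (\<chi> \<circ> \<phi>) (h + \<chi> z) u = 0"
proof -
  let ?v = "verma (\<chi> \<circ> \<phi>) (h + \<chi> z)"
  have "M \<notin> supp (?v u)" for M
  proof
    assume M: "M \<in> supp (?v u)"
    define Q where "Q = verma_index n (pos_weight M + 1)"
    let ?W = "\<lambda>M. restr Q (target.verma \<chi> h (f (smon M)))"
    have "M \<in> Q" using verma_weight[OF u M] by (simp add: Q_def verma_index_def)
    have "coef (?v u) M = 0"
    proof (rule spanning_family_independent[of Q ?W])
      show "finite Q" by (simp add: Q_def finite_verma_index)
      show "\<exists>c. mon K = (\<Sum>L\<in>Q. cst (c L) * ?W L)" if "K \<in> Q" for K
      proof -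
        have K: "0 \<notin># K" "sum_mset K = n" using that by (simp_all add: Q_def verma_index_def)
        then have "target.smon K \<in> target.wsp n" using target.smon_wsp[of K] by simp
        then obtain w where w: "w \<in> wsp n" "f w = target.smon K" by (rule f_wsp_surj)
        have "nonzero K = K" using K(1) by (intro multiset_eqI) (auto simp: not_in_iff)
        then have "target.verma \<chi> h (f w) = mon K"
          using K(1) by (simp add: w(2) target.verma_smon[OF \<chi>] not_in_iff)
        then have "mon K = restr Q (target.verma \<chi> h (f w))" using that by (simp add: restr_mon)
        also have "\<dots> = (\<Sum>L\<in>Q. cst (coef (?v w) L) * ?W L)"
          unfolding Q_def by (rule restr_verma_f[OF \<chi> w(1) refl refl])
        finally show ?thesis by blast
      qed
      show "(\<Sum>L\<in>Q. cst (coef (?v u) L) * ?W L) = 0"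
        unfolding Q_def restr_verma_f[OF \<chi> u refl refl, symmetric] by (simp add: assms(3))
    qed fact
    then show False using M by (simp add: in_keys_iff)
  qed
  then have "supp (?v u) = {}" by blast
  then show ?thesis by simp
qed

lemma verma_index_0_1: "verma_index 0 1 = {{#}}"
proof -
  have "M = {#}" if "0 \<notin># M" "sum_mset M = 0" "pos_weight M < 1" for M
  proof -
    have "int (size M) \<le> 2 * pos_weight M - sum_mset M" using that(1) by (intro size_le_pos_weight) metis
    then have "int (size M) \<le> 0" using that(2,3) by linarith
    then show ?thesis by simp
  qed
  then show ?thesis by (auto simp: verma_index_def)
qed

text \<open>
  In weight zero and for \<open>m = 1\<close> the truncated space is one dimensional, and
  \<open>f\<close> acts on it as the identity up to the change of parameters. Evaluating at a
  preimage of \<open>scal r\<close> expresses \<open>\<chi> r\<close> by \<open>\<chi> \<circ>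
  \<phi>\<close>; the free choice of \<open>h\<close> absorbs the shift by \<open>\<chi> z\<close>.
\<close>

lemma point_comp_inj:
  fixes \<chi>1 \<chi>2 :: "'z \<Rightarrow> 'k::field_char_0"
  assumes "ring_point \<chi>1" "ring_point \<chi>2" and eq: "\<chi>1 \<circ> \<phi> = \<chi>2 \<circ> \<phi>"
  shows "\<chi>1 = \<chi>2"
proof
  fix r
  have vac: "coef (target.verma \<chi> h (f u)) {#} = coef (verma (\<chi> \<circ> \<phi>) (h + \<chi> z) u) {#}"
    if \<chi>: "ring_point \<chi>" and u: "u \<in> wsp 0" for \<chi> :: "'z \<Rightarrow> 'k" and h u
  proof -
    have "coef (target.verma \<chi> h (f u)) {#} = coef (restr (verma_index 0 1) (target.verma \<chi> h (f u))) {#}"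
      by (simp add: coef_restr verma_index_0_1)
    also have "restr (verma_index 0 1) (target.verma \<chi> h (f u)) = (\<Sum>M\<in>verma_index 0 1.
        cst (coef (verma (\<chi> \<circ> \<phi>) (h + \<chi> z) u) M) * restr (verma_index 0 1) (target.verma \<chi> h (f (smon M))))"
      by (rule restr_verma_f[OF \<chi> u refl refl])
    also have "coef \<dots> {#} = coef (verma (\<chi> \<circ> \<phi>) (h + \<chi> z) u) {#}"
      by (simp add: verma_index_0_1 target.verma_1[OF \<chi>] coef_restr lookup_one)
    finally show ?thesis .
  qed
  have "target.smon {#} \<in> target.wsp 0" using target.smon_wsp[of "{#}"] by simp
  then have "scal r \<in> target.wsp 0"
    using supp_cst_mult[of r "1 :: 'z sym"] by (auto simp: target.wsp_def)
  then obtain u where u: "u \<in> wsp 0" "f u = scal r" by (rule f_wsp_surj)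
  have "coef (target.verma \<chi> h (scal r)) {#} = \<chi> r" if \<chi>: "ring_point \<chi>" for \<chi> :: "'z \<Rightarrow> 'k" and h
    using target.verma_scal[OF \<chi>, of 1 h r] target.verma_1[OF \<chi>, of h] by (simp add: cst_def)
  then have "\<chi> r = coef (verma (\<chi> \<circ> \<phi>) (h + \<chi> z) u) {#}" if "ring_point \<chi>" for \<chi> :: "'z \<Rightarrow> 'k" and h
    using vac[OF that u(1), of h] that by (simp only: u(2))
  from this[OF assms(1), of 0] this[OF assms(2), of "\<chi>1 z - \<chi>2 z"]
  show "\<chi>1 r = \<chi>2 r" using eq by simp
qed

text \<open>
  For each weight space the induced maps are surjections between spaces of the same finite
  dimension, so an element of the kernel vanishes modulo all the left ideals. The points
  \<open>\<chi> \<circ> \<phi>\<close> are as numerous as the points \<open>\<chi>\<close>, and by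
  \<open>sep\<close> they suffice to detect a nonzero coefficient.
\<close>

lemma kernel_trivial:
  fixes pts :: "('z \<Rightarrow> 'k::field_char_0) set"
  assumes pts: "\<And>\<chi>. \<chi> \<in> pts \<Longrightarrow> ring_point \<chi>" "\<And>\<chi>. \<chi> \<in> pts \<Longrightarrow> \<chi> \<circ> \<phi> \<in> pts"
    and sep: "\<And>g r. inj_on g pts \<Longrightarrow> g ` pts \<subseteq> pts \<Longrightarrow> (\<And>\<chi>. \<chi> \<in> pts \<Longrightarrow> g \<chi> r = 0) \<Longrightarrow> r = 0"
    and x: "x \<in> alg" "f x = 0"
  shows "x = 0"
proof -
  have hom: "u = 0" if u: "u \<in> wsp n" "f u = 0" for u n
  proof -
    have "coef (co u) M = 0" for M
    proof (rule sep[of "\<lambda>\<chi>. \<chi> \<circ> \<phi>"])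
      show "inj_on (\<lambda>\<chi>. \<chi> \<circ> \<phi>) pts" using point_comp_inj pts(1) by (intro inj_onI) blast
      show "(\<lambda>\<chi>. \<chi> \<circ> \<phi>) ` pts \<subseteq> pts" using pts(2) by blast
      fix \<chi> assume "\<chi> \<in> pts"
      then have \<chi>: "ring_point \<chi>" by (rule pts(1))
      have "verma (\<chi> \<circ> \<phi>) h u = 0" for h
        using verma_kernel[OF \<chi> u, of "h - \<chi> z"] by simp
      then show "(\<chi> \<circ> \<phi>) (coef (co u) M) = 0" by (rule verma_separates[OF ring_point_comp[OF \<chi>]])
    qed
    then have "co u = 0" by (intro poly_mapping_eqI) simp
    then show ?thesis using wsp_alg[OF u(1)] by (metis emb_co emb_simps(1))
  qed
  have "wcomp n x = 0" for n
  proof (rule hom[OF wcomp_wsp])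
    have "coef (target.co (f (wcomp n x))) M = 0" for M
      using coef_f_wcomp[OF x(1), of M] x(2) target.coef_wsp[OF f_wsp[OF wcomp_wsp[of n x]], of M]
      by (cases "sum_mset M = n") auto
    then have "target.co (f (wcomp n x)) = 0" by (intro poly_mapping_eqI) simp
    then show "f (wcomp n x) = 0"
      using target.wsp_alg[OF f_wsp[OF wcomp_wsp[of n x]]] by (metis target.emb_co target.emb_simps(1))
  qed
  then show ?thesis using sum_wcomp[OF x(1)] by simp
qed

end

context vir_epi
begin

theorem epi_injective:
  fixes inc :: "'k::field_char_0 \<Rightarrow> 'z"
  assumes inc: "\<And>a. f (scal (inc a)) = scal (inc a)"
    and sep: "\<And>g r. inj_on g {\<chi>. ring_point \<chi> \<and> (\<forall>a. \<chi> (inc a) = a)} \<Longrightarrow>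
      g ` {\<chi>. ring_point \<chi> \<and> (\<forall>a. \<chi> (inc a) = a)} \<subseteq> {\<chi>. ring_point \<chi> \<and> (\<forall>a. \<chi> (inc a) = a)} \<Longrightarrow>
      (\<And>\<chi>. \<chi> \<in> {\<chi>. ring_point \<chi> \<and> (\<forall>a. \<chi> (inc a) = a)} \<Longrightarrow> g \<chi> r = 0) \<Longrightarrow> r = 0"
    and x: "x \<in> alg" "f x = 0"
  shows "x = 0"
proof -
  obtain \<phi> where \<phi>: "\<And>r. f (scal r) = scal (\<phi> r)" using f_scal_central by metis
  obtain \<epsilon> z where \<epsilon>: "\<epsilon> = 1 \<or> \<epsilon> = - 1" and f0: "f (gen 0) = \<epsilon> * gen 0 + scal z" by (rule f_gen0)
  let ?pts = "{\<chi> :: 'z \<Rightarrow> 'k. ring_point \<chi> \<and> (\<forall>a. \<chi> (inc a) = a)}"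
  interpret flip: vir_pbw scal "\<lambda>n. - gen (- n)" "- \<delta>" "\<lambda>x. flip_sym (sbl x)"
    by (rule flip_vir_pbw)
  from \<epsilon> show ?thesis
  proof
    assume 1: "\<epsilon> = 1"
    interpret g: vir_epi_graded scal gen \<delta> sbl f gen \<delta> sbl \<phi> z
      by unfold_locales (simp_all add: f0 1 \<phi>)
    have "\<phi> (inc a) = inc a" for a by (rule g.scal_inj) (simp add: inc flip: \<phi>)
    then have pts: "\<chi> \<circ> \<phi> \<in> ?pts" if "\<chi> \<in> ?pts" for \<chi>
      using that g.ring_point_comp[of \<chi>] by simp
    show ?thesis
      by (rule g.kernel_trivial[where pts = ?pts, OF _ pts sep x]) simp
  next
    assume m1: "\<epsilon> = - 1"
    interpret g: vir_epi_graded scal gen \<delta> sbl f "\<lambda>n. - gen (- n)" "- \<delta>" "\<lambda>x. flip_sym (sbl x)" \<phi> z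
      by unfold_locales (simp_all add: f0 m1 \<phi> flip_alg)
    have "\<phi> (inc a) = inc a" for a by (rule g.scal_inj) (simp add: inc flip: \<phi>)
    then have pts: "\<chi> \<circ> \<phi> \<in> ?pts" if "\<chi> \<in> ?pts" for \<chi>
      using that g.ring_point_comp[of \<chi>] by simp
    show ?thesis
      by (rule g.kernel_trivial[where pts = ?pts, OF _ pts sep x]) simp
  qed
qed

end

section \<open>The positive part\<close>

context vector_space
begin

lemma span_exchange_finite:
  assumes "finite B" "x \<in> span (U \<union> B)" "x \<notin> span U"
  shows "\<exists>b\<in>B. b \<in> span (insert x (U \<union> (B - {b})))"
  using assms
proof (induction B rule: finite_induct)
  case (insert b B)
  show ?case
  proof (cases "x \<in> span (U \<union> B)")
    case True
    then obtain b' where b': "b' \<in> B" "b' \<in> span (insert x (U \<union> (B - {b'})))" using insert by blast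
    have "span (insert x (U \<union> (B - {b'}))) \<subseteq> span (insert x (U \<union> (insert b B - {b'})))"
      by (rule span_mono) blast
    then show ?thesis using b' by blast
  next
    case False
    have "x \<in> span (insert b (U \<union> B))" using insert.prems by simp
    then have "b \<in> span (insert x (U \<union> B))" using False by (rule in_span_insert)
    moreover have "U \<union> B = U \<union> (insert b B - {b})" using insert.hyps by auto
    ultimately show ?thesis by (metis insertI1)
  qed
qed simp

text \<open>
  A surjection that maps \<open>U\<close> into itself induces a surjection of the finite dimensional
  quotient \<open>V / U\<close>, hence a bijection. To avoid quotient spaces, a complement of
  \<open>U\<close> is replaced by a spanning set of minimal cardinality: an element outside
  \<open>U\<close> with image in \<open>U\<close> could be exchanged into it and would disappear
  under \<open>g\<close>.
\<close>

lemma surjective_preimage_finite_codim: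
  assumes V: "subspace V" and U: "subspace U" "U \<subseteq> V"
    and B: "finite B" "B \<subseteq> V" "V \<subseteq> span (U \<union> B)"
    and add: "\<And>x y. x \<in> V \<Longrightarrow> y \<in> V \<Longrightarrow> g (x + y) = g x + g y"
    and sc: "\<And>a x. x \<in> V \<Longrightarrow> g (scale a x) = scale a (g x)"
    and surj: "g ` V = V" and gU: "g ` U \<subseteq> U"
    and x: "x \<in> V" "g x \<in> U"
  shows "x \<in> U"
proof (rule ccontr)
  assume xU: "x \<notin> U"
  define good where "good B \<longleftrightarrow> finite B \<and> V \<subseteq> span (U \<union> B)" for B
  define B0 where "B0 = (ARG_MIN card B. good B \<and> B \<subseteq> V)"
  have B0: "good B0 \<and> B0 \<subseteq> V"
    unfolding B0_def by (rule arg_min_natI[of _ B]) (use B in \<open>simp add: good_def\<close>)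
  have spanU: "span U = U" using U(1) by (simp add: span_eq_iff)
  obtain b where b: "b \<in> B0" "b \<in> span (insert x (U \<union> (B0 - {b})))"
    using span_exchange_finite[of B0 x U] B0 x xU spanU by (auto simp: good_def)
  define S where "S = insert x (U \<union> (B0 - {b}))"
  have S: "S \<subseteq> V" using x U B0 by (auto simp: S_def)
  have "U \<union> B0 \<subseteq> span S" using b by (auto simp: S_def intro: span_base)
  then have V_S: "V \<subseteq> span S" using B0 span_minimal[OF _ subspace_span, of "U \<union> B0" S] by (auto simp: good_def)
  have g_span: "y \<in> V \<and> g y \<in> span (g ` S)" if "y \<in> span S" for y
    using that
  proof (induction y rule: span_induct_alt)
    case base
    have "g 0 = 0" using sc[OF x(1), of 0] by simp
    then show ?case using V by (simp add: subspace_0 span_zero)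
  next
    case (step c y z)
    then have "y \<in> V" "g y \<in> span (g ` S)" using S by (auto intro: span_base)
    then show ?case using step V by (simp add: add sc subspace_add subspace_scale span_add span_scale)
  qed
  have "g ` S \<subseteq> U \<union> g ` (B0 - {b})" using gU x by (auto simp: S_def)
  then have "span (g ` S) \<subseteq> span (U \<union> g ` (B0 - {b}))" by (rule span_mono)
  moreover have "V \<subseteq> span (g ` S)"
  proof
    fix y assume "y \<in> V"
    then obtain w where "w \<in> V" "y = g w" using surj by auto
    then show "y \<in> span (g ` S)" using g_span subsetD[OF V_S] by simp
  qed
  ultimately have "V \<subseteq> span (U \<union> g ` (B0 - {b}))" by simp
  moreover have "g ` (B0 - {b}) \<subseteq> V" using surj B0 by auto
  ultimately have "good (g ` (B0 - {b})) \<and> g ` (B0 - {b}) \<subseteq> V" using B0 by (simp add: good_def)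
  then have "card B0 \<le> card (g ` (B0 - {b}))"
    unfolding B0_def by (rule arg_min_nat_le)
  also have "\<dots> \<le> card (B0 - {b})" using B0 by (intro card_image_le) (simp add: good_def)
  also have "\<dots> < card B0" using B0 b by (intro card_Diff1_less) (auto simp: good_def)
  finally show False by simp
qed

end

definition positive :: "int multiset \<Rightarrow> bool" where
  "positive M \<longleftrightarrow> (\<forall>i\<in>#M. 0 < i)"

text \<open>
  Brackets add indices, so a set of indices closed under addition spans a subalgebra. For the
  positive indices this is the enveloping algebra of $W_+$.
\<close>

lemma nf_letters:
  assumes X: "\<And>a b. a \<in> X \<Longrightarrow> b \<in> X \<Longrightarrow> a + b \<in> X"
  shows "set w \<subseteq> X \<Longrightarrow> M \<in> supp (nf \<delta> w) \<Longrightarrow> set_mset M \<subseteq> X"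
proof (induction w arbitrary: M rule: sorting_induct[where \<delta> = \<delta>])
  case (sorted w)
  then show ?case by (simp add: nf_sorted supp_mon)
next
  case (descent u b a v)
  from descent.prems(2) have "M \<in> supp (nf \<delta> (u @ a # b # v)) \<or> M \<in> supp (nf_bracket \<delta> u b a v)"
    unfolding descent.hyps(3) by (auto dest!: subsetD[OF Poly_Mapping.keys_add])
  moreover have "a + b \<in> X" using descent.prems(1) by (intro X) auto
  ultimately show ?case
    using descent.IH(1)[of M] descent.IH(2)[of M] descent.IH(3)[of M] supp_nf_bracket[of M \<delta> u b a v] descent.prems(1)
    by auto
qed

lemma nf_positive: "\<forall>i\<in>set w. 0 < i \<Longrightarrow> M \<in> supp (nf \<delta> w) \<Longrightarrow> positive M"
  using nf_letters[of "{0<..}" w M \<delta>] by (auto simp: positive_def)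

lemma positive_sum: "positive M \<Longrightarrow> 0 \<le> sum_mset M \<and> (M \<noteq> {#} \<longrightarrow> 1 \<le> sum_mset M)"
  by (induction M) (auto simp: positive_def)

locale vir_pbw_field = vir_pbw scal gen \<delta> sbl
  for scal :: "'k::field_char_0 \<Rightarrow> 'a::ring_1" and gen \<delta> sbl
begin

sublocale vs: vector_space "\<lambda>a x. scal a * x"
  by standard (simp_all add: distrib_left distrib_right mult.assoc)

definition palg :: "'a set" where
  "palg = {x \<in> alg. \<forall>M\<in>supp (co x). positive M}"

lemma palg_alg: "x \<in> palg \<Longrightarrow> x \<in> alg"
  by (simp add: palg_def)

lemma palg_0 [simp]: "0 \<in> palg"
  by (simp add: palg_def)

lemma palg_add [simp]: "x \<in> palg \<Longrightarrow> y \<in> palg \<Longrightarrow> x + y \<in> palg"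
  using subsetD[OF Poly_Mapping.keys_add[of "co x" "co y"]] by (auto simp: palg_def)

lemma palg_scal [simp]: "x \<in> palg \<Longrightarrow> scal r * x \<in> palg"
  using subsetD[OF supp_cst_mult[of r "co x"]] by (auto simp: palg_def)

lemma subspace_palg: "vs.subspace palg"
  by (simp add: vs.subspace_def)

lemma palg_uminus [simp]: "x \<in> palg \<Longrightarrow> - x \<in> palg"
  by (rule vs.subspace_neg[OF subspace_palg])

lemma palg_diff [simp]: "x \<in> palg \<Longrightarrow> y \<in> palg \<Longrightarrow> x - y \<in> palg"
  by (rule vs.subspace_diff[OF subspace_palg])

lemma palg_word: "\<forall>i\<in>set w. 0 < i \<Longrightarrow> word w \<in> palg"
  using nf_positive by (auto simp: palg_def)

lemma palg_1 [simp]: "1 \<in> palg"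
  using palg_word[of "[]"] by simp

lemma palg_gen: "0 < i \<Longrightarrow> gen i \<in> palg"
  using palg_word[of "[i]"] by simp

lemma palg_induct [consumes 1, case_names zero smon add]:
  assumes "x \<in> palg" "P 0" "\<And>M r. positive M \<Longrightarrow> P (scal r * smon M)"
    "\<And>x y. x \<in> palg \<Longrightarrow> y \<in> palg \<Longrightarrow> P x \<Longrightarrow> P y \<Longrightarrow> P (x + y)"
  shows "P x"
proof -
  have smon: "scal r * smon M \<in> palg" if "positive M" for r M
    using that by (intro palg_scal palg_word) (simp add: positive_def)
  have "emb p \<in> palg \<and> P (emb p)" if "supp p \<subseteq> {M. positive M}" for p
    using that
  proof (induction p rule: supp_induct)
    case (single M r)
    then show ?case using smon assms(3) unfolding single_eq_cst_mon emb_simps by blast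
  qed (auto intro: assms)
  from this[of "co x"] show ?thesis using assms(1) by (auto simp: palg_def)
qed

lemma palg_mult [simp]: "x \<in> palg \<Longrightarrow> y \<in> palg \<Longrightarrow> x * y \<in> palg"
proof (induction x rule: palg_induct)
  case (smon M r)
  from smon(2,1) show ?case
  proof (induction y rule: palg_induct)
    case (smon M' s)
    show ?case unfolding smon_mult using smon
      by (intro palg_scal palg_word) (auto simp: positive_def)
  qed (simp_all add: distrib_left)
qed (simp_all add: distrib_right)

definition eps :: "'a \<Rightarrow> 'k" where
  "eps x = coef (co x) {#}"

lemma eps_simps [simp]:
  "eps 0 = 0" "eps 1 = 1"
  "x \<in> alg \<Longrightarrow> y \<in> alg \<Longrightarrow> eps (x + y) = eps x + eps y"
  "x \<in> alg \<Longrightarrow> y \<in> alg \<Longrightarrow> eps (x - y) = eps x - eps y"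
  "x \<in> alg \<Longrightarrow> eps (scal r * x) = r * eps x"
  "eps (gen i) = 0"
  by (simp_all add: eps_def lookup_add lookup_minus lookup_one mon_def lookup_single when_def)

lemma eps_scal [simp]: "eps (scal r) = r"
  by (simp add: eps_def cst_def)

lemma eps_word: "\<forall>i\<in>set w. 0 < i \<Longrightarrow> eps (word w) = (if w = [] then 1 else 0)"
proof (cases w)
  case (Cons i v)
  assume "\<forall>i\<in>set w. 0 < i"
  then have "0 < sum_list w" unfolding Cons by (intro sum_list_strict_mono[of _ "\<lambda>_. 0", simplified] | (auto intro!: add_pos_nonneg sum_list_nonneg))+
  then have "{#} \<notin> supp (nf \<delta> w)" using nf_weight[of "{#}" \<delta> w] by auto
  then show ?thesis using Cons by (simp add: eps_def in_keys_iff del: word_simps)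
qed simp

lemma eps_mult: "x \<in> palg \<Longrightarrow> y \<in> palg \<Longrightarrow> eps (x * y) = eps x * eps y"
proof (induction x rule: palg_induct)
  case (smon M r)
  from smon(2,1) show ?case
  proof (induction y rule: palg_induct)
    case (smon M' s)
    have pos: "\<forall>i\<in>set (sorted_list_of_multiset M). 0 < i" "\<forall>i\<in>set (sorted_list_of_multiset M'). 0 < i"
      using smon by (simp_all add: positive_def)
    have "eps (scal r * smon M * (scal s * smon M')) = r * s * eps (word (sorted_list_of_multiset M @ sorted_list_of_multiset M'))"
      unfolding smon_mult by (rule eps_simps(5)) (rule word_in_alg)
    also have "eps (word (sorted_list_of_multiset M @ sorted_list_of_multiset M')) = eps (smon M) * eps (smon M')"
      using pos by (subst (1 2 3) eps_word) auto
    finally show ?case by simp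
  qed (simp_all add: distrib_left palg_alg)
qed (simp_all add: distrib_right palg_alg)

definition aug :: "'a set" where
  "aug = {x \<in> palg. eps x = 0}"

primrec aug_power :: "nat \<Rightarrow> 'a set" where
  "aug_power 0 = palg"
| "aug_power (Suc n) = vs.span {x * y | x y. x \<in> aug \<and> y \<in> aug_power n}"

lemma aug_power_subspace: "vs.subspace (aug_power n)"
  by (cases n) (simp_all add: subspace_palg)

text \<open>
  Every element of the augmentation ideal has weights at least one, and weights add under
  multiplication.
\<close>

lemma aug_power_weight: "x \<in> aug_power n \<Longrightarrow> x \<in> palg \<and> (\<forall>M\<in>supp (co x). int n \<le> sum_mset M)"
proof (induction n arbitrary: x)
  case 0
  then show ?case using positive_sum by (auto simp: palg_def)
next
  case (Suc n)
  define T where "T k = {x \<in> palg. \<forall>M\<in>supp (co x). int k \<le> sum_mset M}" for k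
  have sub: "vs.subspace (T k)" for k
    unfolding vs.subspace_def
  proof (intro conjI ballI allI)
    show "0 \<in> T k" by (simp add: T_def)
  next
    fix x y assume "x \<in> T k" "y \<in> T k"
    then show "x + y \<in> T k"
      using subsetD[OF Poly_Mapping.keys_add[of "co x" "co y"]] by (auto simp: T_def palg_alg)
  next
    fix c x assume "x \<in> T k"
    then show "scal c * x \<in> T k"
      using subsetD[OF supp_cst_mult[of c "co x"]] by (auto simp: T_def palg_alg)
  qed
  have "x * y \<in> T (Suc n)" if "x \<in> aug" "y \<in> aug_power n" for x y
  proof -
    have x: "supp (co x) \<subseteq> {M. positive M \<and> M \<noteq> {#}}" "x \<in> alg"
      using that(1) by (auto simp: aug_def palg_def eps_def in_keys_iff)
    have y: "supp (co y) \<subseteq> {M. positive M \<and> int n \<le> sum_mset M}" "y \<in> alg"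
      using Suc.IH[OF that(2)] by (auto simp: palg_def)
    have "emb p * emb q \<in> T (Suc n)" if "supp q \<subseteq> {M. positive M \<and> int n \<le> sum_mset M}" "supp p \<subseteq> {M. positive M \<and> M \<noteq> {#}}" for p q
      using that(2)
    proof (induction p rule: supp_induct)
      case (single M r)
      from that(1) show ?case
      proof (induction q rule: supp_induct)
        case (single M' s)
        let ?w = "sorted_list_of_multiset M @ sorted_list_of_multiset M'"
        have "word ?w \<in> palg"
          using single \<open>M \<in> _\<close> by (intro palg_word) (auto simp: positive_def)
        moreover have "int (Suc n) \<le> sum_mset K" if "K \<in> supp (co (word ?w))" for K
        proof -
          have "sum_mset K = sum_list ?w" using that by (simp only: co_word nf_weight)
          then show ?thesis using positive_sum[of M] single \<open>M \<in> _\<close> by simp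
        qed
        ultimately have "word ?w \<in> T (Suc n)" unfolding T_def by blast
        then show ?case unfolding single_eq_cst_mon emb_simps smon_mult
          by (rule vs.subspace_scale[OF sub])
      qed (auto simp: distrib_left intro: vs.subspace_0[OF sub] vs.subspace_add[OF sub])
    qed (auto simp: distrib_right intro: vs.subspace_0[OF sub] vs.subspace_add[OF sub])
    from this[OF y(1) x(1)] show ?thesis using x y by simp
  qed
  then have "{x * y | x y. x \<in> aug \<and> y \<in> aug_power n} \<subseteq> T (Suc n)" by blast
  then have "aug_power (Suc n) \<subseteq> T (Suc n)" using vs.span_minimal[OF _ sub] by simp
  then show ?case using Suc.prems by (auto simp: T_def)
qed

lemma gen_aug: "0 < i \<Longrightarrow> gen i \<in> aug"
  by (simp add: aug_def palg_gen)

lemma word_aug_power: "\<forall>i\<in>set w. 0 < i \<Longrightarrow> n \<le> length w \<Longrightarrow> word w \<in> aug_power n"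
proof (induction n arbitrary: w)
  case 0
  then show ?case by (simp add: palg_word)
next
  case (Suc n)
  then obtain i v where "w = i # v" by (cases w) auto
  then show ?case using Suc gen_aug[of i] by (auto intro!: vs.span_base)
qed

definition words12 :: "int list set" where
  "words12 = {w. set w \<subseteq> {1, 2}}"

lemma span12_mult: "x \<in> vs.span (word ` words12) \<Longrightarrow> y \<in> vs.span (word ` words12) \<Longrightarrow> x * y \<in> vs.span (word ` words12)"
proof (induction x rule: vs.span_induct_alt)
  case (step c x z)
  then obtain w where w: "x = word w" "w \<in> words12" by auto
  from step.prems have "x * y \<in> vs.span (word ` words12)"
  proof (induction y rule: vs.span_induct_alt)
    case (step d y y')
    then obtain v where v: "y = word v" "v \<in> words12" by auto
    have "word (w @ v) \<in> vs.span (word ` words12)"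
      using w v by (intro vs.span_base imageI) (auto simp: words12_def)
    then have "scal d * (x * y) \<in> vs.span (word ` words12)" using w v by (intro vs.span_scale) simp
    also have "scal d * (x * y) = x * (scal d * y)"
      using scal_word[of d w] by (simp add: w) (simp flip: mult.assoc)
    finally show ?case using step by (simp add: distrib_left vs.span_add)
  qed (simp add: vs.span_zero)
  then show ?case using step by (simp add: distrib_right mult.assoc vs.span_add vs.span_scale)
qed (simp add: vs.span_zero)

lemma gen_span12: "gen (int (Suc n)) \<in> vs.span (word ` words12)"
proof (induction n rule: less_induct)
  case (less n)
  have base: "gen i \<in> vs.span (word ` words12)" if "i = 1 \<or> i = 2" for i
    using that word_simps(2)[of i "[]"] by (intro vs.span_base image_eqI[of _ _ "[i]"]) (auto simp: words12_def)
  consider "n = 0" | "n = 1" | k where "n = Suc (Suc k)" by (cases n; cases "n - 1") auto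
  then show ?case
  proof cases
    case (3 k)
    let ?n = "int (Suc (Suc k))"
    have IH: "gen ?n \<in> vs.span (word ` words12)" using less.IH[of "Suc k"] 3 by simp
    have "comm (gen 1) (gen ?n) = of_int (?n - 1) * gen (int (Suc n))"
      using comm_gen[of 1 ?n] 3 by (simp add: cocyc_def add.commute)
    then have "scal (of_int (?n - 1)) * gen (int (Suc n)) = comm (gen 1) (gen ?n)" by (simp only: scal_of_int)
    moreover have "comm (gen 1) (gen ?n) \<in> vs.span (word ` words12)"
      unfolding comm_def by (intro vs.span_diff span12_mult IH base) auto
    ultimately have "scal (of_int (?n - 1)) * gen (int (Suc n)) \<in> vs.span (word ` words12)" by (simp only:)
    then have "scal (inverse (of_int (?n - 1))) * (scal (of_int (?n - 1)) * gen (int (Suc n))) \<in> vs.span (word ` words12)"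
      by (rule vs.span_scale)
    also have "scal (inverse (of_int (?n - 1))) * (scal (of_int (?n - 1)) * gen (int (Suc n))) =
        scal (inverse (of_int (?n - 1)) * of_int (?n - 1)) * gen (int (Suc n))"
      by (simp only: scal_mult mult.assoc)
    also have "inverse (of_int (?n - 1)) * of_int (?n - 1) = (1 :: 'k)"
      by (rule left_inverse) (subst of_int_eq_0_iff, simp)
    finally show ?thesis by (simp only: scal_1 mult_1_left)
  qed (use base in auto)
qed

text \<open>
  Since $[e_1, e_n] = (n - 1) e_{n+1}$, the positive part is generated by $e_1$ and $e_2$.
\<close>

lemma palg_span12: "x \<in> palg \<Longrightarrow> x \<in> vs.span (word ` words12)"
proof (induction x rule: palg_induct)
  case (smon M r)
  have "word w \<in> vs.span (word ` words12)" if "\<forall>i\<in>set w. 0 < i" for w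
    using that
  proof (induction w)
    case Nil
    show ?case by (rule vs.span_base, rule image_eqI[of _ _ "[]"]) (auto simp: words12_def)
  next
    case (Cons i w)
    then have "i = int (Suc (nat i - 1))" by simp
    then have "gen i \<in> vs.span (word ` words12)" using gen_span12 by metis
    then show ?case using Cons by (simp add: span12_mult)
  qed
  then show ?case using smon by (intro vs.span_scale) (simp add: positive_def)
qed (auto intro: vs.span_zero vs.span_add)

text \<open>
  Long words in $e_1$ and $e_2$ lie in \<open>aug_power n\<close>, so this power has finite
  codimension and the kernel of \<open>g\<close> is contained in it. For all \<open>n\<close>
  together the weights leave no room for a nonzero element.
\<close>

theorem augmented_epi_injective:
  assumes g: "\<And>x. x \<in> palg \<Longrightarrow> g x \<in> palg"
    and add: "\<And>x y. x \<in> palg \<Longrightarrow> y \<in> palg \<Longrightarrow> g (x + y) = g x + g y"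
    and mult: "\<And>x y. x \<in> palg \<Longrightarrow> y \<in> palg \<Longrightarrow> g (x * y) = g x * g y"
    and sc: "\<And>a x. x \<in> palg \<Longrightarrow> g (scal a * x) = scal a * g x"
    and surj: "palg \<subseteq> g ` palg"
    and aug: "\<And>x. x \<in> aug \<Longrightarrow> g x \<in> aug"
    and x: "x \<in> palg" "g x = 0"
  shows "x = 0"
proof -
  have power: "g ` aug_power n \<subseteq> aug_power n" for n
  proof (induction n)
    case 0
    show ?case using g by auto
  next
    case (Suc n)
    let ?S = "{x * y | x y. x \<in> aug \<and> y \<in> aug_power n}"
    have S: "?S \<subseteq> palg" using aug_power_weight by (auto simp: aug_def)
    have "y \<in> palg \<and> g y \<in> aug_power (Suc n)" if "y \<in> vs.span ?S" for y
      using that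
    proof (induction y rule: vs.span_induct_alt)
      case base
      have "g 0 = 0" using sc[of 0 0] by simp
      then show ?case by (simp add: vs.span_zero)
    next
      case (step c y z)
      then obtain p q where y: "y = p * q" "p \<in> aug" "q \<in> aug_power n" by auto
      have pq: "p \<in> palg" "q \<in> palg" using y aug_power_weight by (auto simp: aug_def)
      have "g y = g p * g q" using pq by (simp add: y mult)
      then have "g y \<in> ?S" using y Suc aug by blast
      then have "scal c * g y \<in> vs.span ?S" by (intro vs.span_scale vs.span_base)
      then show ?case using step pq y by (simp add: add sc vs.span_add)
    qed
    then show ?case by auto
  qed
  have "x \<in> aug_power n" for n
  proof (rule vs.surjective_preimage_finite_codim[where V = palg and g = g])
    let ?B = "word ` {w. set w \<subseteq> {1, 2} \<and> length w < n}"
    show "vs.subspace palg" "vs.subspace (aug_power n)" by (rule subspace_palg aug_power_subspace)+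
    show "aug_power n \<subseteq> palg" using aug_power_weight by blast
    show "finite ?B"
    proof (rule finite_imageI, rule finite_subset)
      show "finite {w. set w \<subseteq> {1, 2 :: int} \<and> length w \<le> n}" by (rule finite_lists_length_le) simp
    qed auto
    show "?B \<subseteq> palg" by (auto intro!: palg_word)
    have "word ` words12 \<subseteq> aug_power n \<union> ?B"
      using word_aug_power[of _ n] by (force simp: words12_def)
    from vs.span_mono[OF this] show "palg \<subseteq> vs.span (aug_power n \<union> ?B)" using palg_span12 by blast
    show "g ` palg = palg" using g surj by auto
    show "g ` aug_power n \<subseteq> aug_power n" by (rule power)
    show "g x \<in> aug_power n" unfolding x(2) by (rule vs.subspace_0[OF aug_power_subspace])
  qed (use add sc x in auto)
  then have large: "int n \<le> sum_mset M" if "M \<in> supp (co x)" for n M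
    using aug_power_weight that by blast
  have "M \<notin> supp (co x)" for M
  proof
    assume "M \<in> supp (co x)"
    from large[OF this, of "Suc (nat (sum_mset M))"] show False by arith
  qed
  then have "supp (co x) = {}" by blast
  then have "co x = 0" by simp
  then show ?thesis using palg_alg[OF x(1)] by (metis emb_co emb_simps(1))
qed

end

section \<open>Representations of presented algebras\<close>

lemma free_word_zero [simp]: "letters 0 = []" "letters (v + w) = letters v @ letters w"
  by (simp_all add: zero_free_word_def plus_free_word_def)

lemma map_scale_eq_cst: "Poly_Mapping.map ((*) a) p = cst (a :: 'k::field) * (p :: 'b::monoid_add \<Rightarrow>\<^sub>0 'k)"
  by (rule poly_mapping_eqI) simp

lemma free_algebra_sel [simp]:
  "monoid.mult (free_algebra X) = (*)" "monoid.one (free_algebra X) = 1" "ring.zero (free_algebra X) = 0" "ring.add (free_algebra X) = (+)"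
  "module.smult (free_algebra X) = (\<lambda>a p. cst a * p)"
  by (simp_all add: free_algebra_def map_scale_eq_cst fun_eq_iff)

lemma free_carrier_iff: "p \<in> carrier (free_algebra X) \<longleftrightarrow> (\<forall>w\<in>supp p. set (letters w) \<subseteq> X)"
  by (simp add: free_algebra_def)

lemma free_carrier [simp]:
  fixes X :: "'x set" and p q :: "'x free_word \<Rightarrow>\<^sub>0 'k::field"
  defines "FC \<equiv> carrier (free_algebra X :: ('k, 'x free_word \<Rightarrow>\<^sub>0 'k) module)"
  shows "0 \<in> FC" "1 \<in> FC" "p \<in> FC \<Longrightarrow> q \<in> FC \<Longrightarrow> p + q \<in> FC" "p \<in> FC \<Longrightarrow> q \<in> FC \<Longrightarrow> p * q \<in> FC"
    and "p \<in> FC \<Longrightarrow> - p \<in> FC" "p \<in> FC \<Longrightarrow> q \<in> FC \<Longrightarrow> p - q \<in> FC" "cst a \<in> FC" "x \<in> X \<Longrightarrow> letter x \<in> FC"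
proof -
  interpret F: ring "free_algebra X :: ('k, 'x free_word \<Rightarrow>\<^sub>0 'k) module" by (rule ring_free_algebra)
  show "0 \<in> FC" "1 \<in> FC" using F.zero_closed F.one_closed by (simp_all add: FC_def)
  show "p \<in> FC \<Longrightarrow> q \<in> FC \<Longrightarrow> p + q \<in> FC" using F.a_closed[of p q] by (simp add: FC_def)
  show "p \<in> FC \<Longrightarrow> q \<in> FC \<Longrightarrow> p * q \<in> FC" using F.m_closed[of p q] by (simp add: FC_def)
  have um: "r \<in> FC \<Longrightarrow> - r \<in> FC" for r by (simp add: free_carrier_iff FC_def)
  then show "p \<in> FC \<Longrightarrow> - p \<in> FC" .
  show "p \<in> FC \<Longrightarrow> q \<in> FC \<Longrightarrow> p - q \<in> FC" using F.a_closed[of p "- q"] um[of q] by (simp add: FC_def)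
  show "cst a \<in> FC" by (simp add: free_carrier_iff cst_def FC_def)
  show "x \<in> X \<Longrightarrow> letter x \<in> FC" by (simp add: free_carrier_iff letter_def FC_def)
qed

lemma free_word_eq_prod: "Poly_Mapping.single (Word xs) 1 = prod_list (map letter xs)"
proof (induction xs)
  case Nil
  show ?case by (simp flip: zero_free_word_def)
next
  case (Cons x xs)
  have "Word (x # xs) = Word [x] + Word xs" by (simp add: plus_free_word_def)
  then show ?case by (simp only: list.map prod_list.Cons Cons[symmetric]) (simp add: letter_def mult_single)
qed

lemma free_carrier_induct [consumes 1, case_names zero word add]:
  assumes "p \<in> carrier (free_algebra X)" "P 0"
    "\<And>xs r. set xs \<subseteq> X \<Longrightarrow> P (cst r * prod_list (map letter xs))"
    "\<And>p q. P p \<Longrightarrow> P q \<Longrightarrow> P (p + q)"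
  shows "P p"
proof (rule supp_induct[of p "{w. set (letters w) \<subseteq> X}"])
  show "supp p \<subseteq> {w. set (letters w) \<subseteq> X}" using assms(1) by (auto simp: free_carrier_iff)
  fix w :: "'a free_word" and r :: 'b assume "w \<in> {w. set (letters w) \<subseteq> X}"
  moreover obtain xs where "w = Word xs" by (cases w)
  moreover have "Poly_Mapping.single (Word xs) r = cst r * prod_list (map letter xs)"
    by (simp add: cst_mult_single flip: free_word_eq_prod)
  ultimately show "P (Poly_Mapping.single w r)" using assms(3) by simp
qed (use assms in auto)

lemma ideal_free_algebra_iff:
  fixes J :: "('x free_word \<Rightarrow>\<^sub>0 'k::field) set"
  shows "ideal J (free_algebra X) \<longleftrightarrow> J \<subseteq> carrier (free_algebra X) \<and> 0 \<in> J \<and> (\<forall>p\<in>J. \<forall>q\<in>J. p + q \<in> J) \<and>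
    (\<forall>p\<in>J. \<forall>q\<in>carrier (free_algebra X). q * p \<in> J \<and> p * q \<in> J)" (is "?L \<longleftrightarrow> ?R")
proof
  assume ?L
  then interpret J: ideal J "free_algebra X" .
  have "J \<subseteq> carrier (free_algebra X)" using J.a_subset .
  then show ?R
    using additive_subgroup.zero_closed[OF J.additive_subgroup_axioms]
      additive_subgroup.a_closed[OF J.additive_subgroup_axioms] J.I_l_closed J.I_r_closed by simp
next
  assume R: ?R
  interpret F: ring "free_algebra X :: ('k, 'x free_word \<Rightarrow>\<^sub>0 'k) module" by (rule ring_free_algebra)
  have uminus: "- p \<in> J" if "p \<in> J" for p
  proof -
    have "- 1 * p \<in> J" using R that free_carrier(5)[OF free_carrier(2)] by blast
    then show ?thesis by simp
  qed
  have inv: "inv\<^bsub>add_monoid (free_algebra X)\<^esub> p = - p" if "p \<in> J" for p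
  proof -
    have "p \<in> carrier (free_algebra X)" using R that by blast
    then have "a_inv (free_algebra X) p = - p" by (intro F.minus_equality) simp_all
    then show ?thesis by (simp add: a_inv_def)
  qed
  show ?L
  proof (rule idealI[OF F.ring_axioms])
    show "subgroup J (add_monoid (free_algebra X))"
      by (rule subgroup.intro) (use R inv uminus in \<open>simp_all add: subset_iff\<close>)
  qed (use R in simp_all)
qed

text \<open>
  The homomorphism from the free algebra that is given by \<open>j\<close> on letters and by
  \<open>\<eta>\<close> on scalars.
\<close>

definition word_hom :: "('k \<Rightarrow> 'a::ring_1) \<Rightarrow> ('g \<Rightarrow> 'a) \<Rightarrow> ('g free_word \<Rightarrow>\<^sub>0 'k::field) \<Rightarrow> 'a" where
  "word_hom \<eta> j p = ext_sum (\<lambda>w r. \<eta> r * prod_list (map j (letters w))) p"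

locale word_rep =
  fixes \<eta> :: "'k::field \<Rightarrow> 'a::ring_1" and j :: "'g \<Rightarrow> 'a"
  assumes \<eta>_add: "\<eta> (a + b) = \<eta> a + \<eta> b" and \<eta>_mult: "\<eta> (a * b) = \<eta> a * \<eta> b" and \<eta>_1: "\<eta> 1 = 1"
    and \<eta>_comm: "\<eta> a * j x = j x * \<eta> a"
begin

abbreviation "H \<equiv> word_hom \<eta> j"

lemma \<eta>_0 [simp]: "\<eta> 0 = 0"
  using \<eta>_add[of 0 0] by simp

lemma H_add [simp]: "H (p + q) = H p + H q"
  unfolding word_hom_def by (rule ext_sum_add) (simp_all add: \<eta>_add distrib_right)

lemma H_0 [simp]: "H 0 = 0"
  by (simp add: word_hom_def)

lemma H_single: "H (Poly_Mapping.single w r) = \<eta> r * prod_list (map j (letters w))"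
  unfolding word_hom_def by (rule ext_sum_single) simp

lemma \<eta>_word: "\<eta> a * prod_list (map j xs) = prod_list (map j xs) * \<eta> a"
proof (induction xs)
  case (Cons x xs)
  have "\<eta> a * (j x * prod_list (map j xs)) = j x * (\<eta> a * prod_list (map j xs))"
    by (simp add: \<eta>_comm flip: mult.assoc)
  then show ?case by (simp add: Cons mult.assoc)
qed simp

lemma H_mult [simp]: "H (p * q) = H p * H q"
proof (induction p rule: poly_mapping_linear_induct)
  case (single v r)
  show ?case
  proof (induction q rule: poly_mapping_linear_induct)
    case (single w s)
    have "\<eta> r * (\<eta> s * prod_list (map j (letters v))) * prod_list (map j (letters w))
        = \<eta> r * (prod_list (map j (letters v)) * \<eta> s) * prod_list (map j (letters w))"
      by (simp only: \<eta>_word)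
    then show ?case by (simp add: mult_single H_single \<eta>_mult mult.assoc)
  qed (simp_all add: distrib_left)
qed (simp_all add: distrib_right)

lemma H_uminus [simp]: "H (- p) = - H p"
  using H_add[of p "- p"] by (simp add: eq_neg_iff_add_eq_0 add.commute)

lemma H_diff [simp]: "H (p - q) = H p - H q"
  using H_add[of p "- q"] by simp

lemma H_cst [simp]: "H (cst a) = \<eta> a"
  by (simp add: cst_def H_single)

lemma H_1 [simp]: "H 1 = 1"
  using H_cst[of 1] by (simp add: \<eta>_1)

lemma H_letter [simp]: "H (letter x) = j x"
  by (simp add: letter_def H_single \<eta>_1)

lemma H_prod: "H (prod_list ps) = prod_list (map H ps)"
  by (induction ps) simp_all

lemma H_kills_ideal:
  assumes "S \<subseteq> carrier (free_algebra X)" "\<And>p. p \<in> S \<Longrightarrow> H p = 0"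
    and "p \<in> Idl\<^bsub>free_algebra X\<^esub> S"
  shows "H p = 0"
proof -
  interpret F: ring "free_algebra X :: ('k, 'g free_word \<Rightarrow>\<^sub>0 'k) module" by (rule ring_free_algebra)
  have "ideal {p \<in> carrier (free_algebra X). H p = 0} (free_algebra X)"
    unfolding ideal_free_algebra_iff by auto
  then have "Idl\<^bsub>free_algebra X\<^esub> S \<subseteq> {p \<in> carrier (free_algebra X). H p = 0}"
    by (rule F.genideal_minimal) (use assms in auto)
  then show ?thesis using assms(3) by blast
qed

end

lemma (in lie_algebra) env_relations_carrier: "env_relations L \<subseteq> carrier (free_algebra (carrier L))"
  unfolding env_relations_def map_scale_eq_cst
  by (auto intro!: free_carrier bracket_closed subspace_add[OF subspace_carrier] subspace_scale[OF subspace_carrier])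

lemma (in lie_algebra) env_ideal: "ideal (env_ideal L) (free_algebra (carrier L))"
  unfolding env_ideal_def by (rule ring.genideal_ideal[OF ring_free_algebra env_relations_carrier])

lemma (in lie_algebra) env_relations_subset: "env_relations L \<subseteq> env_ideal L"
  unfolding env_ideal_def by (rule ring.genideal_self[OF ring_free_algebra env_relations_carrier])

text \<open>
  A homomorphism from an algebra given as a record into a ring in the sense of the type classes. The
  last clauses say that the scalar multiplication of the record comes from multiples of its unit,
  which \<open>\<eta>\<close> records in the target.
\<close>

definition rep_of :: "('k, 'b) module \<Rightarrow> ('k \<Rightarrow> 'a::ring_1) \<Rightarrow> ('b \<Rightarrow> 'a) \<Rightarrow> bool" where
  "rep_of A \<eta> h \<longleftrightarrow> ring A \<and>
    (\<forall>x\<in>carrier A. \<forall>y\<in>carrier A. h (x \<oplus>\<^bsub>A\<^esub> y) = h x + h y \<and> h (x \<otimes>\<^bsub>A\<^esub> y) = h x * h y) \<and> h \<one>\<^bsub>A\<^esub> = 1 \<and>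
    (\<forall>a. a \<odot>\<^bsub>A\<^esub> \<one>\<^bsub>A\<^esub> \<in> carrier A \<and> h (a \<odot>\<^bsub>A\<^esub> \<one>\<^bsub>A\<^esub>) = \<eta> a) \<and>
    (\<forall>a. \<forall>x\<in>carrier A. a \<odot>\<^bsub>A\<^esub> x = (a \<odot>\<^bsub>A\<^esub> \<one>\<^bsub>A\<^esub>) \<otimes>\<^bsub>A\<^esub> x)"

lemma rep_ofD:
  assumes "rep_of A \<eta> h"
  shows "x \<in> carrier A \<Longrightarrow> y \<in> carrier A \<Longrightarrow> h (x \<oplus>\<^bsub>A\<^esub> y) = h x + h y"
    and "x \<in> carrier A \<Longrightarrow> y \<in> carrier A \<Longrightarrow> h (x \<otimes>\<^bsub>A\<^esub> y) = h x * h y"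
    and "h \<one>\<^bsub>A\<^esub> = 1" and "a \<odot>\<^bsub>A\<^esub> \<one>\<^bsub>A\<^esub> \<in> carrier A" and "h (a \<odot>\<^bsub>A\<^esub> \<one>\<^bsub>A\<^esub>) = \<eta> a"
    and "x \<in> carrier A \<Longrightarrow> a \<odot>\<^bsub>A\<^esub> x = (a \<odot>\<^bsub>A\<^esub> \<one>\<^bsub>A\<^esub>) \<otimes>\<^bsub>A\<^esub> x" and "ring A"
  using assms unfolding rep_of_def by blast+

lemma rep_of_diff:
  assumes rep: "rep_of A \<eta> h" and xy: "x \<in> carrier A" "y \<in> carrier A"
  shows "h (x \<ominus>\<^bsub>A\<^esub> y) = h x - h y"
proof -
  interpret A: ring A by (rule rep_ofD(7)[OF rep])
  have "h ((x \<ominus>\<^bsub>A\<^esub> y) \<oplus>\<^bsub>A\<^esub> y) = h (x \<ominus>\<^bsub>A\<^esub> y) + h y"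
    using xy by (intro rep_ofD(1)[OF rep]) simp_all
  moreover have "(x \<ominus>\<^bsub>A\<^esub> y) \<oplus>\<^bsub>A\<^esub> y = x" using xy by (simp add: A.minus_eq A.add.m_assoc A.l_neg)
  ultimately show ?thesis by simp
qed

text \<open>
  The map induced on cosets: \<open>h\<close> is constant on them.
\<close>

definition quot_rep :: "('b \<Rightarrow> 'a) \<Rightarrow> 'b set \<Rightarrow> 'a" where
  "quot_rep h X = the_elem (h ` X)"

lemma (in word_rep) rep_of_free: "rep_of (free_algebra X) \<eta> H"
  by (simp add: rep_of_def ring_free_algebra)

lemma rep_of_quot:
  assumes rep: "rep_of A \<eta> h" and I: "ideal I A" and h0: "\<And>x. x \<in> I \<Longrightarrow> h x = 0"
  shows "rep_of (quot_alg A I) \<eta> (quot_rep h)"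
    and "\<And>x. x \<in> carrier A \<Longrightarrow> quot_rep h (I +>\<^bsub>A\<^esub> x) = h x"
    and "carrier (quot_alg A I) = (\<lambda>x. I +>\<^bsub>A\<^esub> x) ` carrier A"
    and "\<And>x y. x \<in> carrier A \<Longrightarrow> y \<in> carrier A \<Longrightarrow>
      (I +>\<^bsub>A\<^esub> x) \<oplus>\<^bsub>quot_alg A I\<^esub> (I +>\<^bsub>A\<^esub> y) = I +>\<^bsub>A\<^esub> (x \<oplus>\<^bsub>A\<^esub> y)"
    and "\<And>x y. x \<in> carrier A \<Longrightarrow> y \<in> carrier A \<Longrightarrow>
      (I +>\<^bsub>A\<^esub> x) \<otimes>\<^bsub>quot_alg A I\<^esub> (I +>\<^bsub>A\<^esub> y) = I +>\<^bsub>A\<^esub> (x \<otimes>\<^bsub>A\<^esub> y)"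
    and "\<one>\<^bsub>quot_alg A I\<^esub> = I +>\<^bsub>A\<^esub> \<one>\<^bsub>A\<^esub>"
    and "\<And>a x. x \<in> carrier A \<Longrightarrow> a \<odot>\<^bsub>quot_alg A I\<^esub> (I +>\<^bsub>A\<^esub> x) = I +>\<^bsub>A\<^esub> (a \<odot>\<^bsub>A\<^esub> x)"
proof -
  interpret I: ideal I A by fact
  note r = rep_ofD(1-5)[OF rep]
  have coset: "I +>\<^bsub>A\<^esub> x = (\<lambda>i. i \<oplus>\<^bsub>A\<^esub> x) ` I" for x by (auto simp: a_r_coset_def')
  show q: "quot_rep h (I +>\<^bsub>A\<^esub> x) = h x" if "x \<in> carrier A" for x
  proof -
    have "h ` (I +>\<^bsub>A\<^esub> x) = {h x}"
    proof (intro equalityI subsetI)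
      fix y assume "y \<in> h ` (I +>\<^bsub>A\<^esub> x)"
      then obtain i where "i \<in> I" "y = h (i \<oplus>\<^bsub>A\<^esub> x)" unfolding coset by auto
      then show "y \<in> {h x}" using r h0 that I.a_Hcarr by simp
    next
      fix y assume "y \<in> {h x}"
      then show "y \<in> h ` (I +>\<^bsub>A\<^esub> x)" using I.a_rcos_self[OF that] by auto
    qed
    then show ?thesis by (simp add: quot_rep_def)
  qed
  show carr: "carrier (quot_alg A I) = (\<lambda>x. I +>\<^bsub>A\<^esub> x) ` carrier A"
    by (auto simp: quot_alg_def FactRing_def A_RCOSETS_def')
  show add: "(I +>\<^bsub>A\<^esub> x) \<oplus>\<^bsub>quot_alg A I\<^esub> (I +>\<^bsub>A\<^esub> y) = I +>\<^bsub>A\<^esub> (x \<oplus>\<^bsub>A\<^esub> y)"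
    and mult: "(I +>\<^bsub>A\<^esub> x) \<otimes>\<^bsub>quot_alg A I\<^esub> (I +>\<^bsub>A\<^esub> y) = I +>\<^bsub>A\<^esub> (x \<otimes>\<^bsub>A\<^esub> y)"
    if "x \<in> carrier A" "y \<in> carrier A" for x y
    using that by (simp_all add: quot_alg_def FactRing_def I.a_rcos_sum I.rcoset_mult_add)
  show one: "\<one>\<^bsub>quot_alg A I\<^esub> = I +>\<^bsub>A\<^esub> \<one>\<^bsub>A\<^esub>"
    by (simp add: quot_alg_def FactRing_def)
  show smult: "a \<odot>\<^bsub>quot_alg A I\<^esub> (I +>\<^bsub>A\<^esub> x) = I +>\<^bsub>A\<^esub> (a \<odot>\<^bsub>A\<^esub> x)" if x: "x \<in> carrier A" for a x
  proof -
    let ?e = "a \<odot>\<^bsub>A\<^esub> \<one>\<^bsub>A\<^esub>"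
    have e: "?e \<in> carrier A" using r by simp
    have "I +>\<^bsub>A\<^esub> (a \<odot>\<^bsub>A\<^esub> y) = I +>\<^bsub>A\<^esub> (a \<odot>\<^bsub>A\<^esub> x)" if "y \<in> I +>\<^bsub>A\<^esub> x" for y
    proof -
      have y: "y \<in> carrier A" using that I.a_r_coset_subset_G[OF I.a_subset x] by blast
      have eq: "I +>\<^bsub>A\<^esub> y = I +>\<^bsub>A\<^esub> x" using I.a_repr_independence[OF that x I.a_subgroup] by simp
      have "I +>\<^bsub>A\<^esub> (?e \<otimes>\<^bsub>A\<^esub> y) = I +>\<^bsub>A\<^esub> (?e \<otimes>\<^bsub>A\<^esub> x)"
        using I.rcoset_mult_add[OF e y] I.rcoset_mult_add[OF e x] eq by simp
      then show ?thesis by (simp only: rep_ofD(6)[OF rep x, of a] rep_ofD(6)[OF rep y, of a])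
    qed
    then have "(\<Union>y\<in>I +>\<^bsub>A\<^esub> x. I +>\<^bsub>A\<^esub> (a \<odot>\<^bsub>A\<^esub> y)) = I +>\<^bsub>A\<^esub> (a \<odot>\<^bsub>A\<^esub> x)"
      using I.a_rcos_self[OF x] by blast
    then show ?thesis by (simp add: quot_alg_def)
  qed
  have scl: "a \<odot>\<^bsub>A\<^esub> x \<in> carrier A" if "x \<in> carrier A" for a x
    unfolding rep_ofD(6)[OF rep that, of a] by (rule I.m_closed[OF r(4) that])
  show "rep_of (quot_alg A I) \<eta> (quot_rep h)"
    unfolding rep_of_def carr one ball_simps
  proof (intro conjI ballI allI ring_quot_alg[OF I])
    fix x y assume xy: "x \<in> carrier A" "y \<in> carrier A"
    show "quot_rep h ((I +>\<^bsub>A\<^esub> x) \<oplus>\<^bsub>quot_alg A I\<^esub> (I +>\<^bsub>A\<^esub> y)) = quot_rep h (I +>\<^bsub>A\<^esub> x) + quot_rep h (I +>\<^bsub>A\<^esub> y)"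
      using xy by (simp add: add q r)
    show "quot_rep h ((I +>\<^bsub>A\<^esub> x) \<otimes>\<^bsub>quot_alg A I\<^esub> (I +>\<^bsub>A\<^esub> y)) = quot_rep h (I +>\<^bsub>A\<^esub> x) * quot_rep h (I +>\<^bsub>A\<^esub> y)"
      using xy by (simp add: mult q r)
  next
    show "quot_rep h (I +>\<^bsub>A\<^esub> \<one>\<^bsub>A\<^esub>) = 1" by (simp add: q r)
    fix a
    show "a \<odot>\<^bsub>quot_alg A I\<^esub> (I +>\<^bsub>A\<^esub> \<one>\<^bsub>A\<^esub>) \<in> (\<lambda>x. I +>\<^bsub>A\<^esub> x) ` carrier A"
      unfolding smult[OF I.one_closed] by (intro imageI r)
    show "quot_rep h (a \<odot>\<^bsub>quot_alg A I\<^esub> (I +>\<^bsub>A\<^esub> \<one>\<^bsub>A\<^esub>)) = \<eta> a"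
      unfolding smult[OF I.one_closed] by (simp add: q r)
    fix x assume x: "x \<in> carrier A"
    show "a \<odot>\<^bsub>quot_alg A I\<^esub> (I +>\<^bsub>A\<^esub> x) = (a \<odot>\<^bsub>quot_alg A I\<^esub> (I +>\<^bsub>A\<^esub> \<one>\<^bsub>A\<^esub>)) \<otimes>\<^bsub>quot_alg A I\<^esub> (I +>\<^bsub>A\<^esub> x)"
      unfolding smult[OF I.one_closed] smult[OF x] mult[OF r(4) x] rep_ofD(6)[OF rep x, of a] ..
  qed
qed

lemma quot_rep_inj:
  assumes rep: "rep_of A \<eta> h" and I: "ideal I A" and h0: "\<And>x. x \<in> carrier A \<Longrightarrow> h x = 0 \<longleftrightarrow> x \<in> I"
  shows "inj_on (quot_rep h) (carrier (quot_alg A I))"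
proof (rule inj_onI)
  interpret I: ideal I A by fact
  have h0': "\<And>x. x \<in> I \<Longrightarrow> h x = 0" using h0 I.a_Hcarr by blast
  have q: "quot_rep h (I +>\<^bsub>A\<^esub> x) = h x" if "x \<in> carrier A" for x
    by (rule rep_of_quot(2)[OF rep I h0' that])
  have carr: "carrier (quot_alg A I) = (\<lambda>x. I +>\<^bsub>A\<^esub> x) ` carrier A"
    by (rule rep_of_quot(3)[OF rep I h0'])
  fix X Y assume XY: "X \<in> carrier (quot_alg A I)" "Y \<in> carrier (quot_alg A I)" "quot_rep h X = quot_rep h Y"
  then obtain x y where x: "x \<in> carrier A" "X = I +>\<^bsub>A\<^esub> x" and y: "y \<in> carrier A" "Y = I +>\<^bsub>A\<^esub> y" unfolding carr by blast
  have "h (x \<ominus>\<^bsub>A\<^esub> y) = 0" using XY x y q rep_of_diff[OF rep x(1) y(1)] by simp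
  then have "x \<ominus>\<^bsub>A\<^esub> y \<in> I" using h0[of "x \<ominus>\<^bsub>A\<^esub> y"] x y by simp
  then show "X = Y" using I.quotient_eq_iff_same_a_r_cos[OF I x(1) y(1)] x y by simp
qed

text \<open>
  A faithful representation carries the question of injectivity over to the image, where
  calculations take place in a ring of the type class.
\<close>

lemma epi_iso_transfer:
  assumes rep: "rep_of R \<eta> \<Theta>" and inj: "inj_on \<Theta> (carrier R)"
    and hopf: "\<And>F. (\<And>x. x \<in> \<Theta> ` carrier R \<Longrightarrow> F x \<in> \<Theta> ` carrier R) \<Longrightarrow>
      (\<And>x y. x \<in> \<Theta> ` carrier R \<Longrightarrow> y \<in> \<Theta> ` carrier R \<Longrightarrow> F (x + y) = F x + F y) \<Longrightarrow>
      (\<And>x y. x \<in> \<Theta> ` carrier R \<Longrightarrow> y \<in> \<Theta> ` carrier R \<Longrightarrow> F (x * y) = F x * F y) \<Longrightarrow>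
      F 1 = 1 \<Longrightarrow> (\<And>a. F (\<eta> a) = \<eta> a) \<Longrightarrow> (\<And>y. y \<in> \<Theta> ` carrier R \<Longrightarrow> \<exists>x\<in>\<Theta> ` carrier R. F x = y) \<Longrightarrow>
      (\<And>x. x \<in> \<Theta> ` carrier R \<Longrightarrow> F x = 0 \<Longrightarrow> x = 0)"
    and f: "f \<in> alg_epi R R"
  shows "f \<in> alg_iso R R"
proof -
  note r = rep_ofD(1-5)[OF rep]
  interpret R: ring R by (rule rep_ofD(7)[OF rep])
  have f_hom: "f \<in> ring_hom R R" and f_sc: "\<And>a x. x \<in> carrier R \<Longrightarrow> f (a \<odot>\<^bsub>R\<^esub> x) = a \<odot>\<^bsub>R\<^esub> f x"
    and f_surj: "f ` carrier R = carrier R"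
    using f by (auto simp: alg_epi_def alg_hom_def)
  define F where "F y = \<Theta> (f (inv_into (carrier R) \<Theta> y))" for y
  have F: "F (\<Theta> x) = \<Theta> (f x)" if "x \<in> carrier R" for x
    using that inj by (simp add: F_def)
  have fc: "f x \<in> carrier R" if "x \<in> carrier R" for x using f_surj that by blast
  have closed: "F x \<in> \<Theta> ` carrier R" if x: "x \<in> \<Theta> ` carrier R" for x
  proof -
    obtain p where "p \<in> carrier R" "x = \<Theta> p" using x by blast
    then show ?thesis using F fc by simp
  qed
  have add: "F (x + y) = F x + F y" if xy: "x \<in> \<Theta> ` carrier R" "y \<in> \<Theta> ` carrier R" for x y
  proof -
    obtain p q where pq: "p \<in> carrier R" "x = \<Theta> p" "q \<in> carrier R" "y = \<Theta> q" using xy by blast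
    then have "F (x + y) = \<Theta> (f (p \<oplus>\<^bsub>R\<^esub> q))" using F[of "p \<oplus>\<^bsub>R\<^esub> q"] r(1)[of p q] by simp
    also have "f (p \<oplus>\<^bsub>R\<^esub> q) = f p \<oplus>\<^bsub>R\<^esub> f q" using f_hom pq by (simp add: ring_hom_add)
    finally show ?thesis using pq F fc r(1)[of "f p" "f q"] by simp
  qed
  have mult: "F (x * y) = F x * F y" if xy: "x \<in> \<Theta> ` carrier R" "y \<in> \<Theta> ` carrier R" for x y
  proof -
    obtain p q where pq: "p \<in> carrier R" "x = \<Theta> p" "q \<in> carrier R" "y = \<Theta> q" using xy by blast
    then have "F (x * y) = \<Theta> (f (p \<otimes>\<^bsub>R\<^esub> q))" using F[of "p \<otimes>\<^bsub>R\<^esub> q"] r(2)[of p q] by simp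
    also have "f (p \<otimes>\<^bsub>R\<^esub> q) = f p \<otimes>\<^bsub>R\<^esub> f q" using f_hom pq by (simp add: ring_hom_mult)
    finally show ?thesis using pq F fc r(2)[of "f p" "f q"] by simp
  qed
  have one: "F 1 = 1" using F[of "\<one>\<^bsub>R\<^esub>"] r(3) ring_hom_one[OF f_hom] by simp
  have scalar: "F (\<eta> a) = \<eta> a" for a
    using F[OF r(4)[of a]] r(5)[of a] f_sc[of "\<one>\<^bsub>R\<^esub>" a] ring_hom_one[OF f_hom] by simp
  have surj: "\<exists>x\<in>\<Theta> ` carrier R. F x = y" if y: "y \<in> \<Theta> ` carrier R" for y
  proof -
    obtain q where q: "q \<in> carrier R" "y = \<Theta> q" using y by blast
    obtain p where p: "p \<in> carrier R" "q = f p" using q f_surj by blast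
    show ?thesis
    proof (rule bexI)
      show "F (\<Theta> p) = y" using F p q by simp
    qed (rule imageI, rule p)
  qed
  have kernel: "x = 0" if "x \<in> \<Theta> ` carrier R" "F x = 0" for x
    by (rule hopf[OF closed add mult one scalar surj that])
  have "inj_on f (carrier R)"
  proof (rule inj_onI)
    fix x y assume xy: "x \<in> carrier R" "y \<in> carrier R" "f x = f y"
    have d: "x \<ominus>\<^bsub>R\<^esub> y \<in> carrier R" using xy by simp
    have \<Theta>d: "\<Theta> (x \<ominus>\<^bsub>R\<^esub> y) = \<Theta> x - \<Theta> y" by (rule rep_of_diff[OF rep xy(1,2)])
    have "F (\<Theta> (x \<ominus>\<^bsub>R\<^esub> y) + \<Theta> y) = F (\<Theta> (x \<ominus>\<^bsub>R\<^esub> y)) + F (\<Theta> y)"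
      by (rule add) (rule imageI, fact)+
    then have "F (\<Theta> (x \<ominus>\<^bsub>R\<^esub> y)) = 0" using F xy by (simp add: \<Theta>d)
    then have "\<Theta> (x \<ominus>\<^bsub>R\<^esub> y) = 0" by (rule kernel[OF imageI[OF d]])
    then have "\<Theta> x = \<Theta> y" by (simp add: \<Theta>d)
    then show "x = y" using inj xy by (simp add: inj_on_eq_iff)
  qed
  then show ?thesis using f f_surj by (simp add: alg_iso_def alg_epi_def bij_betw_def)
qed

lemma rep_of_kernel_ideal:
  assumes rep: "rep_of A \<eta> h"
  shows "ideal {x \<in> carrier A. h x = 0} A"
proof -
  interpret A: ring A by (rule rep_ofD(7)[OF rep])
  note r = rep_ofD[OF rep]
  have "h (\<zero>\<^bsub>A\<^esub> \<oplus>\<^bsub>A\<^esub> \<zero>\<^bsub>A\<^esub>) = h \<zero>\<^bsub>A\<^esub> + h \<zero>\<^bsub>A\<^esub>" by (intro r A.zero_closed)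
  then have 0: "h \<zero>\<^bsub>A\<^esub> = 0" by simp
  have inv: "h (\<ominus>\<^bsub>A\<^esub> x) = - h x" if "x \<in> carrier A" for x
    using rep_of_diff[OF rep A.zero_closed that] that 0 by (simp add: A.minus_eq)
  show ?thesis
  proof (rule idealI[OF A.ring_axioms])
    show "subgroup {x \<in> carrier A. h x = 0} (add_monoid A)"
      by (rule subgroup.intro) (use r(1) 0 inv in \<open>auto simp: a_inv_def\<close>)
  qed (use r(2) in auto)
qed

text \<open>
  Applying an operator to the unit of the symmetric algebra sends a word to its normal form, so this
  evaluation serves as \<open>sbl\<close>.
\<close>

lemma sym_vir_pbw:
  fixes \<delta> :: "'z::{idom, ring_char_0}"
  shows "vir_pbw sym_scale (sym_gen \<delta>) \<delta> (\<lambda>x. app x 1)"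
proof
  show "low (length w) (app (prod_list (map (sym_gen \<delta>) w)) 1 - mon (mset w))" for w
    using nf_leading[of _ \<delta> w] by (auto simp: app_sym_gen_word low_def)
qed (rule sym_scale_hom sym_scale_gen sym_gen_rel | simp)+

section \<open>Kernels of representations of enveloping algebras\<close>

text \<open>
  The situation in which the kernel of a representation of the free algebra on a Lie algebra is
  known to contain an ideal \<open>J\<close>, and \<open>J\<close> contains enough relations to sort
  words. The polynomials \<open>lift i\<close> and \<open>coeff_lift r\<close> represent $e_i$ and
  the coefficient \<open>r\<close>. For the central quotients \<open>J\<close> is larger than the
  ideal that defines the enveloping algebra.
\<close>

locale env_model = vir_pbw scal gen \<delta> sbl + word_rep \<eta> j
  for scal :: "'z::{idom, ring_char_0} \<Rightarrow> 'a::ring_1" and gen \<delta> sbl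
    and \<eta> :: "'k::field_char_0 \<Rightarrow> 'a" and j :: "('b \<Rightarrow>\<^sub>0 'k) \<Rightarrow> 'a" +
  fixes L :: "('k, 'b \<Rightarrow>\<^sub>0 'k) lie_alg" and basis :: "'b set" and J :: "(('b \<Rightarrow>\<^sub>0 'k) free_word \<Rightarrow>\<^sub>0 'k) set"
    and inc :: "'k \<Rightarrow> 'z" and coeff_lift :: "'z \<Rightarrow> ('b \<Rightarrow>\<^sub>0 'k) free_word \<Rightarrow>\<^sub>0 'k"
    and X :: "int set" and lift :: "int \<Rightarrow> ('b \<Rightarrow>\<^sub>0 'k) free_word \<Rightarrow>\<^sub>0 'k"
  assumes carrier_L: "carrier L = {x. supp x \<subseteq> basis}"
    and scale_L: "lie_scale L = (\<lambda>a. Poly_Mapping.map ((*) a))"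
    and ideal_J: "ideal J (free_algebra (carrier L))" and rel_J: "env_relations L \<subseteq> J"
    and H_J: "p \<in> J \<Longrightarrow> H p = 0"
    and coeff_lift_hom: "coeff_lift (r + s) = coeff_lift r + coeff_lift s"
      "coeff_lift (r * s) = coeff_lift r * coeff_lift s"
    and coeff_lift_inc: "coeff_lift (inc a) = cst a" and inc_1: "inc 1 = 1"
    and coeff_lift_carrier: "coeff_lift r \<in> carrier (free_algebra (carrier L))"
    and lift_carrier: "i \<in> X \<Longrightarrow> lift i \<in> carrier (free_algebra (carrier L))"
    and X_add: "m \<in> X \<Longrightarrow> n \<in> X \<Longrightarrow> m + n \<in> X"
    and coeff_lift_comm: "i \<in> X \<Longrightarrow> coeff_lift r * lift i - lift i * coeff_lift r \<in> J"
    and lift_rel: "m \<in> X \<Longrightarrow> n \<in> X \<Longrightarrow> lift n * lift m -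
      (lift m * lift n + coeff_lift (of_int (m - n)) * lift (m + n) + coeff_lift (cocyc \<delta> n m)) \<in> J"
    and basis_lift: "b \<in> basis \<Longrightarrow> (\<exists>i\<in>X. letter (Poly_Mapping.single b 1) = lift i) \<or>
      (\<exists>r. letter (Poly_Mapping.single b 1) - coeff_lift r \<in> J)"
    and H_coeff_lift: "H (coeff_lift r) = scal r" and H_lift: "i \<in> X \<Longrightarrow> H (lift i) = gen i"
begin

abbreviation "FC \<equiv> carrier (free_algebra (carrier L) :: ('k, ('b \<Rightarrow>\<^sub>0 'k) free_word \<Rightarrow>\<^sub>0 'k) module)"

lemma J_closed:
  "J \<subseteq> FC" "0 \<in> J" "p \<in> J \<Longrightarrow> q \<in> J \<Longrightarrow> p + q \<in> J"
  "p \<in> J \<Longrightarrow> q \<in> FC \<Longrightarrow> q * p \<in> J" "p \<in> J \<Longrightarrow> q \<in> FC \<Longrightarrow> p * q \<in> J"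
  using ideal_J unfolding ideal_free_algebra_iff by blast+

lemma J_uminus: "p \<in> J \<Longrightarrow> - p \<in> J"
  using J_closed(4)[of p "- 1"] by simp

definition eqJ :: "(('b \<Rightarrow>\<^sub>0 'k) free_word \<Rightarrow>\<^sub>0 'k) \<Rightarrow> (('b \<Rightarrow>\<^sub>0 'k) free_word \<Rightarrow>\<^sub>0 'k) \<Rightarrow> bool" (infix \<open>\<approx>\<close> 50) where
  "p \<approx> q \<longleftrightarrow> p - q \<in> J"

lemma eqJ_refl [simp]: "p \<approx> p"
  by (simp add: eqJ_def J_closed)

lemma eqJ_sym: "p \<approx> q \<Longrightarrow> q \<approx> p"
  using J_uminus[of "p - q"] by (simp add: eqJ_def)

lemma eqJ_trans [trans]: "p \<approx> q \<Longrightarrow> q \<approx> r \<Longrightarrow> p \<approx> r"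
  using J_closed(3)[of "p - q" "q - r"] by (simp add: eqJ_def)

lemma eqJ_add: "p \<approx> q \<Longrightarrow> p' \<approx> q' \<Longrightarrow> p + p' \<approx> q + q'"
  using J_closed(3)[of "p - q" "p' - q'"] by (simp add: eqJ_def add_diff_add)

lemma eqJ_left: "p \<approx> q \<Longrightarrow> r \<in> FC \<Longrightarrow> r * p \<approx> r * q"
  using J_closed(4)[of "p - q" r] by (simp add: eqJ_def right_diff_distrib)

lemma eqJ_right: "p \<approx> q \<Longrightarrow> r \<in> FC \<Longrightarrow> p * r \<approx> q * r"
  using J_closed(5)[of "p - q" r] by (simp add: eqJ_def left_diff_distrib)

lemma coeff_lift_simps [simp]: "coeff_lift 1 = 1" "coeff_lift 0 = 0"
  using coeff_lift_inc[of 1] coeff_lift_hom(1)[of 0 0] by (simp_all add: inc_1)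

definition lword :: "int list \<Rightarrow> ('b \<Rightarrow>\<^sub>0 'k) free_word \<Rightarrow>\<^sub>0 'k" where
  "lword w = prod_list (map lift w)"

lemma lword_simps [simp]: "lword [] = 1" "lword (i # w) = lift i * lword w" "lword (v @ w) = lword v * lword w"
  by (simp_all add: lword_def)

lemma lword_carrier: "set w \<subseteq> X \<Longrightarrow> lword w \<in> FC"
  by (induction w) (simp_all add: lift_carrier)

lemma coeff_lift_lword: "set w \<subseteq> X \<Longrightarrow> coeff_lift r * lword w \<approx> lword w * coeff_lift r"
proof (induction w)
  case (Cons i w)
  have "coeff_lift r * lift i \<approx> lift i * coeff_lift r" using coeff_lift_comm[of i r] Cons.prems by (simp add: eqJ_def)
  then have "(coeff_lift r * lift i) * lword w \<approx> (lift i * coeff_lift r) * lword w"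
    by (rule eqJ_right) (use Cons.prems lword_carrier in auto)
  also have "(lift i * coeff_lift r) * lword w = lift i * (coeff_lift r * lword w)" by (simp add: mult.assoc)
  also have "\<dots> \<approx> lift i * (lword w * coeff_lift r)"
    by (rule eqJ_left) (use Cons lift_carrier in auto)
  finally show ?case by (simp add: mult.assoc)
qed simp

definition lin_lift :: "'z sym \<Rightarrow> ('b \<Rightarrow>\<^sub>0 'k) free_word \<Rightarrow>\<^sub>0 'k" where
  "lin_lift q = ext_sum (\<lambda>M r. coeff_lift r * lword (sorted_list_of_multiset M)) q"

lemma lin_lift_simps [simp]:
  "lin_lift 0 = 0" "lin_lift (p + q) = lin_lift p + lin_lift q" "lin_lift (cst r * mon M) = coeff_lift r * lword (sorted_list_of_multiset M)"
  unfolding lin_lift_def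
  by (simp, rule ext_sum_add, simp_all add: coeff_lift_hom distrib_right flip: single_eq_cst_mon)

lemma lin_lift_cst: "lin_lift (cst r * q) = coeff_lift r * lin_lift q"
proof (induction q rule: sym_induct)
  case (mon M s)
  have "cst r * (cst s * mon M) = cst (r * s) * mon M" by (simp add: mult.assoc)
  then show ?case by (simp only: lin_lift_simps coeff_lift_hom mult.assoc)
qed (simp_all add: distrib_left)

lemma lin_lift_mon: "lin_lift (mon M) = lword (sorted_list_of_multiset M)"
  using lin_lift_simps(3)[of 1 M] by simp

text \<open>
  The rewriting steps that compute the normal form are consequences of the relations in
  \<open>J\<close>.
\<close>

lemma lword_eqJ_lin_lift: "set w \<subseteq> X \<Longrightarrow> lword w \<approx> lin_lift (nf \<delta> w)"
proof (induction w rule: sorting_induct[where \<delta> = \<delta>])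
  case (sorted w)
  then show ?case by (simp add: nf_sorted lin_lift_mon sorted_list_of_multiset_mset sorted_sort_id)
next
  case (descent u b a v)
  have X: "a \<in> X" "b \<in> X" "set u \<subseteq> X" "set v \<subseteq> X" "a + b \<in> X" using descent.prems X_add by auto
  note carr = lword_carrier[OF X(3)] lword_carrier[OF X(4)]
  let ?c = "coeff_lift (of_int (a - b))" and ?k = "coeff_lift (cocyc \<delta> b a)"
  have "lift b * lift a \<approx> lift a * lift b + ?c * lift (a + b) + ?k"
    using lift_rel[OF X(1,2)] by (simp add: eqJ_def)
  then have "lword u * (lift b * lift a) * lword v \<approx> lword u * (lift a * lift b + ?c * lift (a + b) + ?k) * lword v"
    by (intro eqJ_right eqJ_left carr)
  also have "\<dots> = lword (u @ a # b # v) + ((lword u * ?c) * (lift (a + b) * lword v) + (lword u * ?k) * lword v)"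
    by (simp add: distrib_left distrib_right mult.assoc)
  also have "\<dots> \<approx> lword (u @ a # b # v) + ((?c * lword u) * (lift (a + b) * lword v) + (?k * lword u) * lword v)"
    by (intro eqJ_add eqJ_refl eqJ_right eqJ_sym[OF coeff_lift_lword] X carr free_carrier lift_carrier)
  also have "\<dots> = lword (u @ a # b # v) + (?c * lword (u @ (a + b) # v) + ?k * lword (u @ v))"
    by (simp add: mult.assoc)
  also have "\<dots> \<approx> lin_lift (nf \<delta> (u @ a # b # v)) + (?c * lin_lift (nf \<delta> (u @ (a + b) # v)) + ?k * lin_lift (nf \<delta> (u @ v)))"
    by (intro eqJ_add eqJ_left coeff_lift_carrier descent.IH) (use X in auto)
  also have "\<dots> = lin_lift (nf \<delta> (u @ b # a # v))"
    unfolding descent.hyps(3) nf_bracket_def lin_lift_simps cst_of_int[symmetric] lin_lift_cst ..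
  finally show ?case by (simp add: mult.assoc)
qed

definition XM :: "int multiset set" where
  "XM = {M. set_mset M \<subseteq> X}"

lemma lin_lift_carrier: "supp q \<subseteq> XM \<Longrightarrow> lin_lift q \<in> FC"
proof (induction q rule: supp_induct)
  case (single M r)
  then show ?case unfolding single_eq_cst_mon lin_lift_simps
    by (intro free_carrier coeff_lift_carrier lword_carrier) (auto simp: XM_def)
qed simp_all

definition normal :: "(('b \<Rightarrow>\<^sub>0 'k) free_word \<Rightarrow>\<^sub>0 'k) \<Rightarrow> bool" where
  "normal p \<longleftrightarrow> (\<exists>q. supp q \<subseteq> XM \<and> p \<approx> lin_lift q)"

lemma normal_0: "normal 0"
  unfolding normal_def by (rule exI[of _ 0]) simp

lemma normal_add: "normal p \<Longrightarrow> normal p' \<Longrightarrow> normal (p + p')"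
proof -
  assume "normal p" "normal p'"
  then obtain q q' where q: "supp q \<subseteq> XM" "p \<approx> lin_lift q" "supp q' \<subseteq> XM" "p' \<approx> lin_lift q'" by (auto simp: normal_def)
  then show "normal (p + p')" unfolding normal_def
    using Poly_Mapping.keys_add[of q q'] eqJ_add[OF q(2,4)] by (intro exI[of _ "q + q'"]) auto
qed

lemma normal_eqJ: "p \<approx> p' \<Longrightarrow> normal p' \<Longrightarrow> normal p"
  unfolding normal_def using eqJ_trans by blast

lemma normal_coeff_lift: "normal p \<Longrightarrow> normal (coeff_lift r * p)"
proof -
  assume "normal p"
  then obtain q where q: "supp q \<subseteq> XM" "p \<approx> lin_lift q" by (auto simp: normal_def)
  then show ?thesis unfolding normal_def
    using supp_cst_mult[of r q] eqJ_left[OF q(2) coeff_lift_carrier[of r]]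
    by (intro exI[of _ "cst r * q"]) (auto simp: lin_lift_cst)
qed

lemma normal_lift: "i \<in> X \<Longrightarrow> normal p \<Longrightarrow> normal (lift i * p)"
proof -
  assume i: "i \<in> X" and "normal p"
  then obtain q where q: "supp q \<subseteq> XM" "p \<approx> lin_lift q" by (auto simp: normal_def)
  from q(1) have "normal (lift i * lin_lift q)"
  proof (induction q rule: supp_induct)
    case (single M r)
    then have M: "set (sorted_list_of_multiset M) \<subseteq> X" by (auto simp: XM_def)
    let ?w = "i # sorted_list_of_multiset M"
    have "(lift i * coeff_lift r) * lword (sorted_list_of_multiset M) \<approx> (coeff_lift r * lift i) * lword (sorted_list_of_multiset M)"
      by (rule eqJ_right[OF eqJ_sym lword_carrier[OF M]]) (simp add: eqJ_def coeff_lift_comm[OF i])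
    also have "\<dots> = coeff_lift r * lword ?w" by (simp add: mult.assoc)
    finally have 1: "lift i * lin_lift (Poly_Mapping.single M r) \<approx> coeff_lift r * lword ?w"
      unfolding single_eq_cst_mon lin_lift_simps by (simp add: mult.assoc)
    have "set ?w \<subseteq> X" using i M by simp
    then have "lword ?w \<approx> lin_lift (nf \<delta> ?w)" "supp (nf \<delta> ?w) \<subseteq> XM"
      using lword_eqJ_lin_lift[of ?w] nf_letters[of X ?w _ \<delta>] X_add by (auto simp: XM_def)
    then have "normal (lword ?w)" unfolding normal_def by blast
    then show ?case using normal_eqJ[OF 1] normal_coeff_lift by blast
  qed (simp_all add: normal_0 normal_add distrib_left)
  then show ?thesis using normal_eqJ[OF eqJ_left[OF q(2) lift_carrier[OF i]]] by blast
qed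

lemma letter_add: "x \<in> carrier L \<Longrightarrow> y \<in> carrier L \<Longrightarrow> letter (x + y) \<approx> letter x + letter y"
proof -
  assume "x \<in> carrier L" "y \<in> carrier L"
  then have "letter (x + y) - letter x - letter y \<in> env_relations L"
    unfolding env_relations_def by blast
  then show ?thesis using rel_J by (auto simp: eqJ_def diff_diff_eq)
qed

lemma letter_scale: "x \<in> carrier L \<Longrightarrow> letter (Poly_Mapping.map ((*) a) x) \<approx> cst a * letter x"
proof -
  assume "x \<in> carrier L"
  then have "letter (lie_scale L a x) - Poly_Mapping.map ((*) a) (letter x) \<in> env_relations L"
    unfolding env_relations_def by blast
  then show ?thesis using rel_J by (auto simp: eqJ_def scale_L map_scale_eq_cst)
qed

lemma normal_letter:
  assumes x: "x \<in> carrier L" and p: "p \<in> FC" "normal p"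
  shows "normal (letter x * p)"
proof -
  from x have "supp x \<subseteq> basis" by (simp add: carrier_L)
  then have "x \<in> carrier L \<and> normal (letter x * p)"
  proof (induction x rule: supp_induct)
    case zero
    have 0: "0 \<in> carrier L" by (simp add: carrier_L)
    have "Poly_Mapping.map ((*) 0) (0 :: 'b \<Rightarrow>\<^sub>0 'k) = 0" by (rule poly_mapping_eqI) simp
    then have "letter 0 \<approx> cst 0 * letter 0" using letter_scale[OF 0, of 0] by simp
    then have "letter 0 * p \<approx> 0" using eqJ_right[OF _ p(1), of "letter 0" 0] by simp
    then show ?case using normal_eqJ[OF _ normal_0] 0 by blast
  next
    case (single b a)
    let ?e = "Poly_Mapping.single b (1 :: 'k)"
    have e: "?e \<in> carrier L" using single by (simp add: carrier_L)
    have sc: "Poly_Mapping.single b a = Poly_Mapping.map ((*) a) ?e"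
      by (rule poly_mapping_eqI) (simp add: lookup_single when_def)
    have "normal (letter ?e * p)"
      using basis_lift[OF single]
    proof (elim disjE bexE exE)
      fix i assume "i \<in> X" "letter ?e = lift i"
      then show ?thesis using normal_lift[OF _ p(2)] by simp
    next
      fix r assume "letter ?e - coeff_lift r \<in> J"
      then have "letter ?e * p \<approx> coeff_lift r * p" by (intro eqJ_right p) (simp add: eqJ_def)
      then show ?thesis by (rule normal_eqJ) (rule normal_coeff_lift[OF p(2)])
    qed
    then have "normal (cst a * (letter ?e * p))" using normal_coeff_lift[of _ "inc a"] by (simp add: coeff_lift_inc)
    moreover have "letter (Poly_Mapping.single b a) * p \<approx> cst a * (letter ?e * p)"
      unfolding sc using eqJ_right[OF letter_scale[OF e, of a] p(1)] by (simp add: mult.assoc)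
    moreover have "Poly_Mapping.single b a \<in> carrier L" using single by (simp add: carrier_L)
    ultimately show ?case using normal_eqJ by blast
  next
    case (add x y)
    then have "x + y \<in> carrier L"
      using Poly_Mapping.keys_add[of x y] by (auto simp: carrier_L)
    moreover have "letter (x + y) * p \<approx> letter x * p + letter y * p"
      using eqJ_right[OF letter_add[of x y] p(1)] add by (simp add: distrib_right)
    ultimately show ?case using normal_eqJ normal_add add by blast
  qed
  then show ?thesis ..
qed

lemma normal_1: "normal 1"
  unfolding normal_def by (rule exI[of _ "mon {#}"]) (auto simp: lin_lift_mon XM_def supp_mon simp del: mon_empty)

lemma normal_carrier: "p \<in> FC \<Longrightarrow> normal p"
proof (induction p rule: free_carrier_induct)
  case (word xs r)
  have "prod_list (map letter xs) \<in> FC \<and> normal (prod_list (map letter xs) :: ('b \<Rightarrow>\<^sub>0 'k) free_word \<Rightarrow>\<^sub>0 'k)"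
    using word by (induction xs) (auto intro: normal_1 normal_letter)
  then show ?case using normal_coeff_lift[of _ "inc r"] by (simp add: coeff_lift_inc)
qed (auto intro: normal_0 normal_add)

lemma H_lin_lift: "supp q \<subseteq> XM \<Longrightarrow> H (lin_lift q) = emb q"
proof (induction q rule: supp_induct)
  case (single M r)
  have "H (lword w) = word w" if "set w \<subseteq> X" for w
    using that by (induction w) (auto simp: H_lift)
  then have "H (lword (sorted_list_of_multiset M)) = smon M" using single by (simp add: XM_def)
  then show ?case unfolding single_eq_cst_mon lin_lift_simps emb_simps by (simp add: H_coeff_lift)
qed simp_all

lemma H_eqJ: "p \<approx> q \<Longrightarrow> H p = H q"
  using H_J[of "p - q"] by (simp add: eqJ_def)

text \<open>
  Modulo \<open>J\<close> every element is a combination of sorted words, and the images of the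
  sorted words are linearly independent.
\<close>

theorem H_kernel: "p \<in> FC \<Longrightarrow> H p = 0 \<longleftrightarrow> p \<in> J"
proof
  assume "p \<in> FC" "H p = 0"
  then obtain q where q: "supp q \<subseteq> XM" "p \<approx> lin_lift q" using normal_carrier by (auto simp: normal_def)
  then have "emb q = 0" using H_lin_lift H_eqJ \<open>H p = 0\<close> by metis
  then have "q = 0" by (rule emb_eq_0)
  then show "p \<in> J" using q by (simp add: eqJ_def)
qed (rule H_J)

theorem H_image: "H ` FC = emb ` {q. supp q \<subseteq> XM}"
proof (intro equalityI subsetI)
  fix x assume "x \<in> H ` FC"
  then obtain p where p: "p \<in> FC" "x = H p" by blast
  then obtain q where q: "supp q \<subseteq> XM" "p \<approx> lin_lift q" using normal_carrier by (auto simp: normal_def)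
  then have "x = emb q" using p H_lin_lift H_eqJ by metis
  then show "x \<in> emb ` {q. supp q \<subseteq> XM}" using q by blast
next
  fix x assume "x \<in> emb ` {q. supp q \<subseteq> XM}"
  then obtain q where "supp q \<subseteq> XM" "x = emb q" by blast
  then show "x \<in> H ` FC" using H_lin_lift lin_lift_carrier by (metis imageI)
qed

end

lemma word_hom_env_ideal:
  fixes L :: "('k::field, 'g::ab_group_add) lie_alg" and j :: "'g \<Rightarrow> 'a::ring_1"
  assumes wr: "word_rep \<eta> j" and L: "lie_algebra L"
    and add: "\<And>x y. x \<in> carrier L \<Longrightarrow> y \<in> carrier L \<Longrightarrow> j (x + y) = j x + j y"
    and sc: "\<And>a x. x \<in> carrier L \<Longrightarrow> j (lie_scale L a x) = \<eta> a * j x"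
    and br: "\<And>x y. x \<in> carrier L \<Longrightarrow> y \<in> carrier L \<Longrightarrow> j (lie_bracket L x y) = comm (j x) (j y)"
    and p: "p \<in> env_ideal L"
  shows "word_hom \<eta> j p = 0"
proof -
  interpret word_rep \<eta> j by fact
  interpret lie_algebra L by fact
  show ?thesis
  proof (rule H_kills_ideal[OF env_relations_carrier _ p[unfolded env_ideal_def]])
    fix p assume "p \<in> env_relations L"
    then show "H p = 0"
      unfolding env_relations_def map_scale_eq_cst by (auto simp: add sc br comm_def)
  qed
qed

section \<open>The Virasoro algebra\<close>

text \<open>
  Both coefficient rings for the Virasoro algebra at once; \<open>c0\<close> is the value of the
  central element.
\<close>

locale vir_model =
  fixes inc :: "'k::field_char_0 \<Rightarrow> 'z::{idom, ring_char_0}" and c0 :: 'z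
  assumes inc_add: "inc (a + b) = inc a + inc b" and inc_mult: "inc (a * b) = inc a * inc b" and inc_1: "inc 1 = 1"
begin

definition dl :: 'z where
  "dl = inc (1 / 12) * c0"

definition vgen :: "vir_basis \<Rightarrow> 'z sym endo" where
  "vgen b = (case b of E i \<Rightarrow> sym_gen dl i | C \<Rightarrow> sym_scale c0)"

definition eta :: "'k \<Rightarrow> 'z sym endo" where
  "eta a = sym_scale (inc a)"

definition vj :: "(vir_basis \<Rightarrow>\<^sub>0 'k) \<Rightarrow> 'z sym endo" where
  "vj x = ext_sum (\<lambda>b r. eta r * vgen b) x"

sublocale P: vir_pbw sym_scale "sym_gen dl" dl "\<lambda>x. app x 1"
  by (rule sym_vir_pbw)

lemma inc_0: "inc 0 = 0"
  using inc_add[of 0 0] by simp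

lemma inc_of_int: "inc (of_int n) = of_int n"
proof -
  have nat: "inc (of_nat m) = of_nat m" for m by (induction m) (simp_all add: inc_0 inc_1 inc_add)
  have "inc (- a) = - inc a" for a using inc_add[of a "- a"] by (simp add: inc_0 eq_neg_iff_add_eq_0 add.commute)
  then show ?thesis using nat by (cases n rule: int_cases2) simp_all
qed

lemma inc_of_int_div: "inc (of_int n / 12) * c0 = of_int n * dl"
  using inc_mult[of "of_int n" "1 / 12"] by (simp add: dl_def inc_of_int mult.assoc)

lemma cocyc_dl: "cocyc dl m n = inc (if m + n = 0 then of_int (m ^ 3 - m) / 12 else 0) * c0"
  by (simp add: cocyc_def inc_0 inc_of_int_div add.commute del: of_int_diff)

lemma eta_hom: "eta (a + b) = eta a + eta b" "eta (a * b) = eta a * eta b" "eta 1 = 1" "eta 0 = 0"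
  by (simp_all add: eta_def inc_add inc_mult inc_1 inc_0 sym_scale_hom)

lemma scale_commute: "sym_scale r * sym_scale s = sym_scale s * (sym_scale r :: 'z sym endo)"
  by (simp only: sym_scale_hom(2)[symmetric] mult.commute)

lemma scale_vgen: "sym_scale r * vgen b = vgen b * sym_scale r"
  by (cases b) (simp_all add: vgen_def sym_scale_gen scale_commute)

lemma vj_add: "vj (x + y) = vj x + vj y"
  unfolding vj_def by (rule ext_sum_add) (simp_all add: eta_hom distrib_right)

lemma vj_0: "vj 0 = 0"
  by (simp add: vj_def)

lemma vj_single: "vj (Poly_Mapping.single b a) = eta a * vgen b"
  unfolding vj_def by (rule ext_sum_single) (simp add: eta_hom)

lemma map_scale_add: "Poly_Mapping.map ((*) (a::'k)) (x + y) = Poly_Mapping.map ((*) a) x + Poly_Mapping.map ((*) a) (y :: 'b \<Rightarrow>\<^sub>0 'k)"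
  by (rule poly_mapping_eqI) (simp add: lookup_add distrib_left)

lemma map_scale_single: "Poly_Mapping.map ((*) (a::'k)) (Poly_Mapping.single b r) = Poly_Mapping.single b (a * r)"
  by (rule poly_mapping_eqI) (simp add: lookup_single when_def)

lemma vj_scale: "vj (Poly_Mapping.map ((*) a) x) = eta a * vj x"
proof (induction x rule: poly_mapping_linear_induct)
  case zero
  have "Poly_Mapping.map ((*) a) (0 :: vir_basis \<Rightarrow>\<^sub>0 'k) = 0" by (rule poly_mapping_eqI) simp
  then show ?case by (simp add: vj_0)
next
  case (single b r)
  show ?case unfolding map_scale_single vj_single eta_hom by (simp only: mult.assoc)
qed (simp add: map_scale_add vj_add distrib_left)

sublocale word_rep eta vj
proof
  show "eta a * vj x = vj x * eta a" for a x
  proof (induction x rule: poly_mapping_linear_induct)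
    case (single b r)
    have "eta a * (eta r * vgen b) = eta r * (eta a * vgen b)"
      using scale_commute[of "inc a" "inc r"] by (simp only: eta_def mult.assoc[symmetric])
    then show ?case using scale_vgen[of "inc a" b] by (simp only: vj_single eta_def mult.assoc)
  qed (simp_all add: vj_0 vj_add distrib_left distrib_right)
qed (simp_all add: eta_hom)

lemma vj_struct: "vj (vir_struct b b') = comm (vgen b) (vgen b')"
proof (cases b)
  case b: (E m)
  show ?thesis
  proof (cases b')
    case b': (E n)
    have "comm (vgen b) (vgen b') = sym_scale (of_int (n - m)) * sym_gen dl (m + n) + sym_scale (cocyc dl m n)"
      using sym_gen_rel[of dl m n] by (simp add: b b' comm_def vgen_def add.commute)
    also have "sym_scale (cocyc dl m n) = eta (if m + n = 0 then of_int (m ^ 3 - m) / 12 else 0) * vgen C"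
      unfolding cocyc_dl eta_def vgen_def sym_scale_hom by simp
    also have "sym_scale (of_int (n - m)) * sym_gen dl (m + n) = eta (of_int (n - m)) * vgen (E (m + n))"
      unfolding eta_def inc_of_int vgen_def by simp
    finally show ?thesis by (simp only: b b' vir_struct.simps vj_add vj_single)
  next
    case C
    then show ?thesis using scale_vgen[of c0 "E m"] by (simp add: b vj_0 comm_def vgen_def)
  qed
next
  case C
  then show ?thesis using scale_vgen[of c0 b'] by (simp add: vj_0 comm_def vgen_def)
qed

lemma vj_bracket: "vj (bilinear_ext vir_struct x y) = comm (vj x) (vj y)"
proof (induction x rule: poly_mapping_linear_induct)
  case (single b r)
  show ?case
  proof (induction y rule: poly_mapping_linear_induct)
    case (single b' s)
    have c: "eta r * vgen b * (eta s * vgen b') = eta r * eta s * (vgen b * vgen b')" for r s b b'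
      using scale_vgen[of "inc s" b] by (simp add: eta_def mult.assoc) (simp add: mult.assoc[symmetric])
    have es: "eta s * eta r = eta r * eta s" by (simp only: eta_hom(2)[symmetric] mult.commute)
    have "comm (eta r * vgen b) (eta s * vgen b') = eta r * eta s * comm (vgen b) (vgen b')"
      by (simp only: comm_def c es right_diff_distrib)
    then show ?case by (simp add: bilinear_ext_single vj_scale vj_struct vj_single eta_hom)
  qed (simp_all add: vj_0 vj_add comm_simps bilinear_ext_add_right)
qed (simp_all add: vj_0 vj_add comm_simps bilinear_ext_add_left)

lemma virasoro_sel [simp]:
  "carrier virasoro = UNIV" "lie_scale virasoro = (\<lambda>a. Poly_Mapping.map ((*) a))"
  "lie_bracket virasoro = bilinear_ext vir_struct"
  by (simp_all add: virasoro_def)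

lemma H_env_ideal: "p \<in> env_ideal virasoro \<Longrightarrow> H p = 0"
  by (rule word_hom_env_ideal[OF word_rep_axioms lie_algebra_virasoro])
    (simp_all add: vj_add vj_scale vj_bracket)

abbreviation "vletter b \<equiv> letter (Poly_Mapping.single b (1 :: 'k))"

lemma vir_env_model:
  fixes J :: "((vir_basis \<Rightarrow>\<^sub>0 'k) free_word \<Rightarrow>\<^sub>0 'k) set"
  assumes J: "ideal J (free_algebra UNIV)" "env_relations virasoro \<subseteq> J" "\<And>p. p \<in> J \<Longrightarrow> H p = 0"
    and cl: "\<And>r s. cl (r + s) = cl r + cl s" "\<And>r s. cl (r * s) = cl r * cl s" "\<And>a. cl (inc a) = cst a"
    and cl_comm: "\<And>r i. cl r * vletter (E i) - vletter (E i) * cl r \<in> J"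
    and cl_c0: "cl c0 - vletter C \<in> J" and H_cl: "\<And>r. H (cl r) = sym_scale r"
  shows "env_model sym_scale (sym_gen dl) dl (\<lambda>x. app x 1) eta vj virasoro UNIV J inc cl UNIV (\<lambda>i. vletter (E i))"
proof (intro env_model.intro env_model_axioms.intro P.vir_pbw_axioms word_rep_axioms)
  note Jc = J(1)[unfolded ideal_free_algebra_iff]
  have univ: "p \<in> carrier (free_algebra UNIV)" for p :: "(vir_basis \<Rightarrow>\<^sub>0 'k) free_word \<Rightarrow>\<^sub>0 'k"
    by (simp add: free_carrier_iff)
  have add: "p + q \<in> J" if "p \<in> J" "q \<in> J" for p q using Jc that by blast
  have left: "q * p \<in> J" if "p \<in> J" for p q using Jc that univ by blast
  show "vletter (E n) * vletter (E m) - (vletter (E m) * vletter (E n) + cl (of_int (m - n)) * vletter (E (m + n))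
      + cl (cocyc dl n m)) \<in> J" for m n
  proof -
    let ?k = "if n + m = 0 then of_int (n ^ 3 - n) / 12 else (0 :: 'k)"
    let ?s1 = "Poly_Mapping.single (E (n + m)) (of_int (m - n) :: 'k)" and ?s2 = "Poly_Mapping.single C ?k"
    have br: "bilinear_ext vir_struct (Poly_Mapping.single (E n) 1) (Poly_Mapping.single (E m) 1) = ?s1 + ?s2"
      unfolding bilinear_ext_single by (rule poly_mapping_eqI) simp
    have sc: "letter (Poly_Mapping.single b a) - cst a * vletter b \<in> J" for a :: 'k and b
    proof -
      have "letter (lie_scale virasoro a (Poly_Mapping.single b 1)) - Poly_Mapping.map ((*) a) (vletter b) \<in> env_relations virasoro"
        unfolding env_relations_def virasoro_sel by blast
      then show ?thesis using J(2) by (auto simp: map_scale_single map_scale_eq_cst)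
    qed
    have "letter (?s1 + ?s2) - letter ?s1 - letter ?s2 \<in> env_relations virasoro"
      unfolding env_relations_def virasoro_sel by blast
    moreover have "vletter (E n) * vletter (E m) - vletter (E m) * vletter (E n) - letter (?s1 + ?s2) \<in> env_relations virasoro"
      unfolding br[symmetric] env_relations_def virasoro_sel by blast
    ultimately have r: "letter (?s1 + ?s2) - letter ?s1 - letter ?s2 \<in> J"
        "vletter (E n) * vletter (E m) - vletter (E m) * vletter (E n) - letter (?s1 + ?s2) \<in> J"
      using J(2) by auto
    have "cl (of_int (m - n)) = cst (of_int (m - n))" using cl(3)[of "of_int (m - n)"] by (simp only: inc_of_int)
    moreover have "cl (cocyc dl n m) = cst ?k * cl c0" unfolding cocyc_dl cl(2,3) ..
    ultimately have eq: "vletter (E n) * vletter (E m) - (vletter (E m) * vletter (E n) + cl (of_int (m - n)) * vletter (E (m + n))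
      + cl (cocyc dl n m)) = (vletter (E n) * vletter (E m) - vletter (E m) * vletter (E n) - letter (?s1 + ?s2))
        + (letter (?s1 + ?s2) - letter ?s1 - letter ?s2) + (letter ?s1 - cst (of_int (m - n)) * vletter (E (n + m)))
        + (letter ?s2 - cst ?k * vletter C) + cst (- ?k) * (cl c0 - vletter C)"
      by (simp only: add.commute[of n m] cst_simps right_diff_distrib) (simp add: algebra_simps del: cst_of_int of_int_diff)
    show ?thesis unfolding eq by (intro add r sc left cl_c0)
  qed
  show "b \<in> UNIV \<Longrightarrow> (\<exists>i\<in>UNIV. vletter b = vletter (E i)) \<or> (\<exists>r. vletter b - cl r \<in> J)" for b
  proof (cases b)
    case C
    have "- 1 * (cl c0 - vletter C) \<in> J" by (rule left[OF cl_c0])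
    then show ?thesis using C by auto
  qed auto
  show "H (vletter (E i)) = sym_gen dl i" for i
    by (simp add: vj_single eta_hom vgen_def)
qed (use J cl cl_comm H_cl inc_1 in \<open>simp_all add: free_carrier_iff\<close>)

lemma vir_hopfian:
  assumes rep: "rep_of R eta \<Theta>" and inj: "inj_on \<Theta> (carrier R)" and img: "\<Theta> ` carrier R = P.alg"
    and sep: "\<And>g r. inj_on g {\<chi>. ring_point \<chi> \<and> (\<forall>a. \<chi> (inc a) = (a::'k))} \<Longrightarrow>
      g ` {\<chi>. ring_point \<chi> \<and> (\<forall>a. \<chi> (inc a) = a)} \<subseteq> {\<chi>. ring_point \<chi> \<and> (\<forall>a. \<chi> (inc a) = a)} \<Longrightarrow>
      (\<And>\<chi>. \<chi> \<in> {\<chi>. ring_point \<chi> \<and> (\<forall>a. \<chi> (inc a) = a)} \<Longrightarrow> g \<chi> r = 0) \<Longrightarrow> r = 0"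
    and f: "f \<in> alg_epi R R"
  shows "f \<in> alg_iso R R"
proof (rule epi_iso_transfer[OF rep inj _ f], unfold img)
  fix F x
  assume F: "\<And>x. x \<in> P.alg \<Longrightarrow> F x \<in> P.alg" "\<And>x y. x \<in> P.alg \<Longrightarrow> y \<in> P.alg \<Longrightarrow> F (x + y) = F x + F y"
    "\<And>x y. x \<in> P.alg \<Longrightarrow> y \<in> P.alg \<Longrightarrow> F (x * y) = F x * F y" "F 1 = 1" "\<And>a. F (eta a) = eta a"
    "\<And>y. y \<in> P.alg \<Longrightarrow> \<exists>x\<in>P.alg. F x = y" and x: "x \<in> P.alg" "F x = 0"
  interpret ep: vir_epi sym_scale "sym_gen dl" dl "\<lambda>x. app x 1" F
    by unfold_locales (use F in auto)
  show "x = 0"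
  proof (rule ep.epi_injective[of inc])
    show "F (sym_scale (inc a)) = sym_scale (inc a)" for a using F(5)[of a] by (simp only: eta_def)
  qed (fact x | rule sep; assumption)+
qed

end

text \<open>
  Evaluation of a polynomial at a central element of a noncommutative ring.
\<close>

definition const_eval :: "'r::ring_1 \<Rightarrow> ('k::field \<Rightarrow> 'r) \<Rightarrow> 'k poly \<Rightarrow> 'r" where
  "const_eval c \<eta> p = fold_coeffs (\<lambda>a t. \<eta> a + c * t) p 0"

lemma const_eval_0 [simp]: "const_eval c \<eta> 0 = 0"
  by (simp add: const_eval_def)

lemma const_eval_pCons: "\<eta> 0 = 0 \<Longrightarrow> const_eval c \<eta> (pCons a p) = \<eta> a + c * const_eval c \<eta> p"
  by (cases "p = 0 \<and> a = 0") (auto simp: const_eval_def)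

lemma const_eval_hom:
  assumes \<eta>: "\<eta> 0 = 0" "\<And>a b. \<eta> (a + b) = \<eta> a + \<eta> b" "\<And>a b. \<eta> (a * b) = \<eta> a * \<eta> b" "\<And>a. \<eta> a * c = c * \<eta> a"
  shows "const_eval c \<eta> (p + q) = const_eval c \<eta> p + const_eval c \<eta> q"
    and "const_eval c \<eta> (p * q) = const_eval c \<eta> p * const_eval c \<eta> q"
proof -
  note pc = const_eval_pCons[where \<eta> = \<eta>, OF \<eta>(1)]
  show add: "const_eval c \<eta> (p + q) = const_eval c \<eta> p + const_eval c \<eta> q" for p q
    by (induction p q rule: poly_induct2) (simp_all add: pc \<eta> algebra_simps)
  have sm: "const_eval c \<eta> (smult a q) = \<eta> a * const_eval c \<eta> q" for a q
  proof (induction q rule: pCons_induct)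
    case (pCons b q)
    have "\<eta> a * (c * const_eval c \<eta> q) = c * (\<eta> a * const_eval c \<eta> q)"
      by (simp only: mult.assoc[symmetric] \<eta>(4))
    then show ?case using pCons by (simp add: pc \<eta>(3) distrib_left)
  qed simp
  show "const_eval c \<eta> (p * q) = const_eval c \<eta> p * const_eval c \<eta> q"
    by (induction p rule: pCons_induct) (simp_all add: pc add sm \<eta>(1) distrib_right mult.assoc)
qed

lemma ring_point_poly:
  fixes \<chi> :: "'k::field poly \<Rightarrow> 'k"
  assumes "ring_point \<chi>" "\<And>a. \<chi> [:a:] = a"
  shows "\<chi> p = poly p (\<chi> [:0, 1:])"
proof (induction p rule: pCons_induct)
  case (pCons a p)
  have "pCons a p = [:a:] + [:0, 1:] * p" by simp
  then have "\<chi> (pCons a p) = \<chi> [:a:] + \<chi> [:0, 1:] * \<chi> p" by (simp only: ring_pointD[OF assms(1)])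
  then show ?case using pCons by (simp add: assms(2))
qed (simp add: ring_pointD[OF assms(1)])

text \<open>
  The points of \<open>K[c]\<close> over \<open>K\<close> are the evaluations. An injective self-map
  of this infinite set has infinite image, and a nonzero polynomial has only finitely many roots.
\<close>

lemma poly_points_separate:
  fixes r :: "'k::field_char_0 poly"
  defines "pts \<equiv> {\<chi> :: 'k poly \<Rightarrow> 'k. ring_point \<chi> \<and> (\<forall>a. \<chi> [:a:] = a)}"
  assumes "inj_on g pts" "g ` pts \<subseteq> pts" "\<And>\<chi>. \<chi> \<in> pts \<Longrightarrow> g \<chi> r = 0"
  shows "r = 0"
proof (rule ccontr)
  assume r: "r \<noteq> 0"
  define ev :: "'k \<Rightarrow> 'k poly \<Rightarrow> 'k" where "ev k = (\<lambda>p. poly p k)" for k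
  have ev: "range ev \<subseteq> pts" by (auto simp: pts_def ring_point_def ev_def)
  have "inj ev"
  proof (rule injI)
    fix k l :: 'k assume "ev k = ev l"
    from fun_cong[OF this, of "[:0, 1:]"] show "k = l" by (simp add: ev_def)
  qed
  have "infinite pts"
  proof
    assume "finite pts"
    with ev have "finite (range ev)" by (rule finite_subset)
    from finite_imageD[OF this \<open>inj ev\<close>] show False using infinite_UNIV_char_0[where 'a = 'k] by simp
  qed
  have inf: "infinite (g ` pts)"
  proof
    assume "finite (g ` pts)"
    from finite_imageD[OF this assms(2)] show False using \<open>infinite pts\<close> by simp
  qed
  have "(\<lambda>\<chi>. \<chi> [:0, 1:]) ` g ` pts \<subseteq> {k. poly r k = 0}"
  proof
    fix k assume "k \<in> (\<lambda>\<chi>. \<chi> [:0, 1:]) ` g ` pts"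
    then obtain \<chi> where \<chi>: "\<chi> \<in> pts" "k = g \<chi> [:0, 1:]" by blast
    have "g \<chi> \<in> pts" using \<chi>(1) assms(3) by blast
    then have "g \<chi> r = poly r k" unfolding \<chi>(2)
      using ring_point_poly[of "g \<chi>" r] by (simp add: pts_def)
    then show "k \<in> {k. poly r k = 0}" using assms(4)[OF \<chi>(1)] by simp
  qed
  then have "finite ((\<lambda>\<chi>. \<chi> [:0, 1:]) ` g ` pts)" using poly_roots_finite[OF r] by (rule finite_subset)
  moreover have "inj_on (\<lambda>\<chi>. \<chi> [:0, 1:]) (g ` pts)"
  proof (rule inj_onI)
    fix \<chi> \<psi> assume *: "\<chi> \<in> g ` pts" "\<psi> \<in> g ` pts" "\<chi> [:0, 1:] = \<psi> [:0, 1:]"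
    then have "\<chi> \<in> pts" "\<psi> \<in> pts" using assms(3) by blast+
    then have "ring_point \<chi>" "\<And>a. \<chi> [:a:] = a" "ring_point \<psi>" "\<And>a. \<psi> [:a:] = a" by (simp_all add: pts_def)
    then have "\<chi> p = \<psi> p" for p
      using ring_point_poly[of \<chi> p] ring_point_poly[of \<psi> p] *(3) by simp
    then show "\<chi> = \<psi>" by (rule ext)
  qed
  ultimately show False using inf finite_imageD[of "\<lambda>\<chi>. \<chi> [:0, 1:]" "g ` pts"] by simp
qed

interpretation vp: vir_model "\<lambda>a. [:a:] :: 'k::field_char_0 poly" "[:0, 1:]"
  by standard simp_all

lemma virasoro_carrier_free: "p \<in> carrier (free_algebra (UNIV :: 'x set))"
  by (simp add: free_carrier_iff)

abbreviation central_letter :: "(vir_basis \<Rightarrow>\<^sub>0 'k::field_char_0) free_word \<Rightarrow>\<^sub>0 'k" where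
  "central_letter \<equiv> letter (Poly_Mapping.single C 1)"

lemma central_letter_comm:
  "central_letter * letter x - letter x * central_letter \<in> env_ideal (virasoro :: ('k::field_char_0, _) lie_alg)"
proof -
  interpret L: lie_algebra "virasoro :: ('k, _) lie_alg" by (rule lie_algebra_virasoro)
  note J = L.env_ideal[unfolded vp.virasoro_sel ideal_free_algebra_iff]
  have br: "lie_bracket virasoro (Poly_Mapping.single C 1) x = (0 :: vir_basis \<Rightarrow>\<^sub>0 'k)"
    unfolding vp.virasoro_sel by (rule poly_mapping_eqI)
      (simp add: lookup_bilinear_ext[OF finite_keys finite_keys subset_refl subset_refl])
  have mem: "\<And>y z. letter (y + z) - letter y - letter z \<in> env_relations (virasoro :: ('k, _) lie_alg)"
    "letter (Poly_Mapping.single C 1) * letter x - letter x * letter (Poly_Mapping.single C 1)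
        - letter (lie_bracket virasoro (Poly_Mapping.single C 1) x) \<in> env_relations (virasoro :: ('k, _) lie_alg)"
    unfolding env_relations_def vp.virasoro_sel by blast+
  from mem(1)[of 0 0] have "- letter 0 \<in> env_ideal (virasoro :: ('k, _) lie_alg)"
    using L.env_relations_subset by auto
  then have "- 1 * - letter 0 \<in> env_ideal (virasoro :: ('k, _) lie_alg)" using J virasoro_carrier_free by blast
  moreover have "central_letter * letter x - letter x * central_letter - letter 0 \<in> env_ideal (virasoro :: ('k, _) lie_alg)"
    using mem(2) L.env_relations_subset unfolding br by blast
  ultimately have "central_letter * letter x - letter x * central_letter - letter 0 + - 1 * - letter 0
      \<in> env_ideal (virasoro :: ('k, _) lie_alg)" using J by blast
  then show ?thesis by simp
qed

lemma cst_central: "cst a * p = p * (cst a :: 'x free_word \<Rightarrow>\<^sub>0 'k::comm_ring_1)"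
proof (induction p rule: poly_mapping_linear_induct)
  case (single w r)
  show ?case by (simp add: cst_def mult_single mult.commute)
qed (simp_all add: distrib_left distrib_right)

abbreviation "poly_lift \<equiv> const_eval central_letter cst"

lemma poly_lift_hom:
  "poly_lift (p + q) = poly_lift p + poly_lift q" "poly_lift (p * q) = poly_lift p * poly_lift q"
  by (rule const_eval_hom, simp, simp, simp, rule cst_central)+

lemma vp_env_model:
  "env_model sym_scale (sym_gen vp.dl) vp.dl (\<lambda>x. app x 1) vp.eta vp.vj virasoro UNIV
    (env_ideal (virasoro :: ('k::field_char_0, _) lie_alg)) (\<lambda>a. [:a:]) poly_lift UNIV (\<lambda>i. letter (Poly_Mapping.single (E i) 1))"
proof (rule vp.vir_env_model)
  interpret L: lie_algebra "virasoro :: ('k, _) lie_alg" by (rule lie_algebra_virasoro)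
  let ?J = "env_ideal (virasoro :: ('k, _) lie_alg)"
  show J: "ideal ?J (free_algebra UNIV)" using L.env_ideal by simp
  note Jc = J[unfolded ideal_free_algebra_iff]
  show "env_relations virasoro \<subseteq> ?J" by (rule L.env_relations_subset)
  show "vp.H p = 0" if "p \<in> ?J" for p using that by (rule vp.H_env_ideal)
  show c: "poly_lift [:a:] = cst a" for a by (simp add: const_eval_pCons)
  show "poly_lift [:0, 1:] - central_letter \<in> ?J" using Jc by (simp add: const_eval_pCons)
  show "poly_lift r * letter (Poly_Mapping.single (E i) 1) - letter (Poly_Mapping.single (E i) 1) * poly_lift r \<in> ?J" for r i
  proof (induction r rule: pCons_induct)
    case 0
    show ?case using Jc by simp
  next
    case (pCons a r)
    let ?e = "letter (Poly_Mapping.single (E i) 1) :: (vir_basis \<Rightarrow>\<^sub>0 'k) free_word \<Rightarrow>\<^sub>0 'k"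
    have eq: "(cst a + central_letter * poly_lift r) * ?e - ?e * (cst a + central_letter * poly_lift r) =
        central_letter * (poly_lift r * ?e - ?e * poly_lift r) + (central_letter * ?e - ?e * central_letter) * poly_lift r"
      using cst_central[of a ?e] by (simp add: algebra_simps)
    have "central_letter * (poly_lift r * ?e - ?e * poly_lift r) \<in> ?J" using Jc pCons(2) virasoro_carrier_free by blast
    moreover have "(central_letter * ?e - ?e * central_letter) * poly_lift r \<in> ?J"
      using Jc central_letter_comm virasoro_carrier_free by blast
    ultimately show ?case using Jc unfolding const_eval_pCons[of cst, OF cst_simps(1)] eq by blast
  qed
  show "vp.H (poly_lift r) = sym_scale r" for r
  proof (induction r rule: pCons_induct)
    case 0
    show ?case using vp.P.scal_0 by simp
  next
    case (pCons a r)
    have "vp.H (poly_lift (pCons a r)) = vp.eta a + vp.vj (Poly_Mapping.single C 1) * sym_scale r"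
      by (simp only: const_eval_pCons[of cst, OF cst_simps(1)] vp.H_add vp.H_mult vp.H_cst vp.H_letter pCons(2))
    also have "vp.vj (Poly_Mapping.single C 1) = sym_scale [:0, 1:]"
      by (simp only: vp.vj_single vp.eta_hom vp.vgen_def vir_basis.case mult_1_left)
    also have "vp.eta a + sym_scale [:0, 1:] * sym_scale r = sym_scale ([:a:] + [:0, 1:] * r)"
      by (simp only: vp.eta_def sym_scale_hom)
    finally show ?case by simp
  qed
qed (rule poly_lift_hom)+

lemma env_rep:
  fixes L :: "('a::field, 'b::ab_group_add) lie_alg"
  assumes L: "lie_algebra L" and wr: "word_rep \<eta> j"
    and ker: "\<And>p. p \<in> carrier (free_algebra (carrier L)) \<Longrightarrow> word_hom \<eta> j p = 0 \<longleftrightarrow> p \<in> env_ideal L"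
  shows "rep_of (univ_env L) \<eta> (quot_rep (word_hom \<eta> j))"
    and "inj_on (quot_rep (word_hom \<eta> j)) (carrier (univ_env L))"
    and "quot_rep (word_hom \<eta> j) ` carrier (univ_env L) = word_hom \<eta> j ` carrier (free_algebra (carrier L))"
proof -
  interpret lie_algebra L by fact
  interpret word_rep \<eta> j by fact
  have zero: "H p = 0" if "p \<in> env_ideal L" for p
    using ker[of p] that env_ideal unfolding ideal_free_algebra_iff by blast
  let ?F = "free_algebra (carrier L) :: ('a, 'b free_word \<Rightarrow>\<^sub>0 'a) module"
  show "rep_of (univ_env L) \<eta> (quot_rep H)" unfolding univ_env_def
    by (rule rep_of_quot(1)[OF rep_of_free env_ideal zero])
  show "inj_on (quot_rep H) (carrier (univ_env L))"
    unfolding univ_env_def by (rule quot_rep_inj[OF rep_of_free env_ideal ker])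
  have val: "quot_rep H (env_ideal L +>\<^bsub>?F\<^esub> p) = H p" if "p \<in> carrier ?F" for p
    by (rule rep_of_quot(2)[OF rep_of_free env_ideal zero that])
  have carr: "carrier (univ_env L) = (\<lambda>p. env_ideal L +>\<^bsub>?F\<^esub> p) ` carrier ?F"
    unfolding univ_env_def by (rule rep_of_quot(3)[OF rep_of_free env_ideal zero])
  show "quot_rep H ` carrier (univ_env L) = H ` carrier ?F"
    unfolding carr image_image by (rule image_cong) (simp_all add: val)
qed

theorem virasoro_hopfian:
  assumes "f \<in> alg_epi (univ_env (virasoro :: ('k::field_char_0, _) lie_alg)) (univ_env virasoro)"
  shows "f \<in> alg_iso (univ_env virasoro) (univ_env virasoro)"
proof -
  interpret env_model sym_scale "sym_gen vp.dl" vp.dl "\<lambda>x. app x 1" vp.eta vp.vj virasoro UNIV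
    "env_ideal (virasoro :: ('k, _) lie_alg)" "\<lambda>a. [:a:]" poly_lift UNIV "\<lambda>i. letter (Poly_Mapping.single (E i) 1)"
    by (rule vp_env_model)
  note er = env_rep[OF lie_algebra_virasoro vp.word_rep_axioms H_kernel]
  show ?thesis
  proof (rule vp.vir_hopfian[OF er(1,2) _ _ assms])
    show "quot_rep vp.H ` carrier (univ_env (virasoro :: ('k, _) lie_alg)) = vp.P.alg"
      using er(3) unfolding H_image by (simp add: XM_def vp.P.alg_def)
    fix g and r :: "'k poly"
    assume "inj_on g {\<chi>. ring_point \<chi> \<and> (\<forall>a. \<chi> [:a:] = (a::'k))}"
      "g ` {\<chi>. ring_point \<chi> \<and> (\<forall>a. \<chi> [:a:] = a)} \<subseteq> {\<chi>. ring_point \<chi> \<and> (\<forall>a. \<chi> [:a:] = a)}"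
      "\<And>\<chi>. \<chi> \<in> {\<chi>. ring_point \<chi> \<and> (\<forall>a. \<chi> [:a:] = a)} \<Longrightarrow> g \<chi> r = 0"
    then show "r = 0" by (rule poly_points_separate)
  qed
qed

section \<open>Central quotients of the Virasoro algebra\<close>

text \<open>
  The quotient is formed in two steps, first by the enveloping ideal and then by the ideal of $c -
  \kappa$. The set \<open>J\<close> in the proof is the preimage of the second ideal in the free
  algebra. Over \<open>K\<close> there is only one point of the coefficient ring, so separation of
  coefficients is trivial.
\<close>

theorem virasoro_at_hopfian:
  fixes \<kappa> :: "'k::field_char_0"
  assumes f: "f \<in> alg_epi (univ_env_vir_at \<kappa>) (univ_env_vir_at \<kappa>)"
  shows "f \<in> alg_iso (univ_env_vir_at \<kappa>) (univ_env_vir_at \<kappa>)"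
proof -
  interpret vk: vir_model "\<lambda>a :: 'k. a" \<kappa> by standard simp_all
  interpret L: lie_algebra "virasoro :: ('k, _) lie_alg" by (rule lie_algebra_virasoro)
  let ?V = "virasoro :: ('k, _) lie_alg"
  let ?F = "free_algebra UNIV :: ('k, (vir_basis \<Rightarrow>\<^sub>0 'k) free_word \<Rightarrow>\<^sub>0 'k) module"
  let ?U = "univ_env ?V" and ?I = "env_ideal ?V"
  let ?cs = "\<lambda>p. ?I +>\<^bsub>?F\<^esub> p"
  have idI: "ideal ?I ?F" using L.env_ideal by simp
  have U: "?U = quot_alg ?F ?I" by (simp add: univ_env_def)
  have mem: "p \<in> carrier ?F" for p by (rule virasoro_carrier_free)
  note rf = vk.rep_of_free[of UNIV]
  have zero: "vk.H p = 0" if "p \<in> ?I" for p using that by (rule vk.H_env_ideal)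
  let ?h = "quot_rep vk.H"
  have rep1: "rep_of ?U vk.eta ?h" unfolding U by (rule rep_of_quot(1)[OF rf idI zero])
  have val: "?h (?cs p) = vk.H p" for p by (rule rep_of_quot(2)[OF rf idI zero mem])
  have carrU: "carrier ?U = range ?cs"
  proof -
    have "carrier (quot_alg ?F ?I) = ?cs ` carrier ?F" by (rule rep_of_quot(3)[OF rf idI zero])
    also have "carrier ?F = UNIV" using mem by blast
    finally show ?thesis unfolding U .
  qed
  have add: "?cs p \<oplus>\<^bsub>?U\<^esub> ?cs q = ?cs (p + q)" for p q
    unfolding U by (simp add: rep_of_quot(4)[OF rf idI zero mem mem])
  have mult: "?cs p \<otimes>\<^bsub>?U\<^esub> ?cs q = ?cs (p * q)" for p q
    unfolding U by (simp add: rep_of_quot(5)[OF rf idI zero mem mem])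
  have scalar: "a \<odot>\<^bsub>?U\<^esub> \<one>\<^bsub>?U\<^esub> = ?cs (cst a)" for a
    unfolding U by (simp add: rep_of_quot(6)[OF rf idI zero] rep_of_quot(7)[OF rf idI zero mem])
  interpret U: ring ?U by (rule rep_ofD(7)[OF rep1])
  have csU: "?cs p \<in> carrier ?U" for p unfolding carrU by blast
  have zeroU: "?cs 0 = \<zero>\<^bsub>?U\<^esub>"
  proof -
    have "?cs 0 \<oplus>\<^bsub>?U\<^esub> ?cs 0 = ?cs 0" unfolding add by simp
    then show ?thesis using U.add.r_cancel_one[OF csU csU, of 0 0] by simp
  qed
  let ?g = "vir_c \<ominus>\<^bsub>?U\<^esub> (\<kappa> \<odot>\<^bsub>?U\<^esub> \<one>\<^bsub>?U\<^esub>)"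
  have c: "vir_c = ?cs central_letter" by (simp add: vir_c_def env_incl_def)
  have g: "?g = ?cs (central_letter - cst \<kappa>)"
  proof -
    have e: "vir_c = ?cs (central_letter - cst \<kappa>) \<oplus>\<^bsub>?U\<^esub> ?cs (cst \<kappa>)" unfolding c add by simp
    show ?thesis unfolding scalar e U.minus_eq using csU by (simp add: U.add.m_assoc U.r_neg)
  qed
  let ?K = "Idl\<^bsub>?U\<^esub> {?g}"
  have gU: "{?g} \<subseteq> carrier ?U" unfolding g using csU by simp
  have idK: "ideal ?K ?U" by (rule U.genideal_ideal[OF gU])
  have vj_C: "vk.vj (Poly_Mapping.single C 1) = sym_scale \<kappa>"
    by (simp add: vk.vj_single vk.eta_hom vk.vgen_def)
  have "?h ?g = 0" unfolding g val by (simp add: vj_C vk.eta_def)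
  then have K0: "?h x = 0" if "x \<in> ?K" for x
    using U.genideal_minimal[OF rep_of_kernel_ideal[OF rep1], of "{?g}"] gU that by blast
  define J where "J = {p. ?cs p \<in> ?K}"
  have K_add: "x \<oplus>\<^bsub>?U\<^esub> y \<in> ?K" if "x \<in> ?K" "y \<in> ?K" for x y
    using additive_subgroup.a_closed[OF ideal.axioms(1)[OF idK] that] .
  have J: "ideal J ?F"
    unfolding ideal_free_algebra_iff
  proof (intro conjI ballI)
    show "J \<subseteq> carrier ?F" using mem by blast
    show "0 \<in> J" unfolding J_def mem_Collect_eq zeroU using additive_subgroup.zero_closed[OF ideal.axioms(1)[OF idK]] by simp
    fix p assume p: "p \<in> J"
    show "p + q \<in> J" if "q \<in> J" for q using K_add p that unfolding J_def by (simp flip: add)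
    show "q * p \<in> J" "p * q \<in> J" for q
      using ideal.I_l_closed[OF idK _ csU[of q], of "?cs p"] ideal.I_r_closed[OF idK _ csU[of q], of "?cs p"] p
      unfolding J_def by (simp_all add: mult)
  qed
  note Jc = J[unfolded ideal_free_algebra_iff]
  have I_J: "?I \<subseteq> J"
  proof
    fix p assume "p \<in> ?I"
    then have "?cs p = ?cs 0"
      using ring.a_rcos_zero[OF ring_free_algebra idI, of p] ring.a_rcos_zero[OF ring_free_algebra idI, of 0]
      additive_subgroup.zero_closed[OF ideal.axioms(1)[OF idI]] by simp
    moreover have "?cs 0 \<in> ?K" using Jc unfolding J_def by blast
    ultimately show "p \<in> J" unfolding J_def mem_Collect_eq by (simp only:)
  qed
  have HJ: "vk.H p = 0" if "p \<in> J" for p using K0[of "?cs p"] that unfolding val J_def by simp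
  interpret env_model sym_scale "sym_gen vk.dl" vk.dl "\<lambda>x. app x 1" vk.eta vk.vj virasoro UNIV
    J "\<lambda>a. a" cst UNIV "\<lambda>i. letter (Poly_Mapping.single (E i) 1)"
  proof (rule vk.vir_env_model[OF J _ HJ])
    show "env_relations virasoro \<subseteq> J" using L.env_relations_subset I_J by blast
    have "?g \<in> ?K" using U.genideal_self[OF gU] by blast
    then have "central_letter - cst \<kappa> \<in> J" unfolding J_def mem_Collect_eq by (simp only: g)
    then have "- 1 * (central_letter - cst \<kappa>) \<in> J" using Jc mem[of "- 1"] by blast
    then show "cst \<kappa> - central_letter \<in> J" by simp
    show "cst r * letter (Poly_Mapping.single (E i) 1) - letter (Poly_Mapping.single (E i) 1) * cst r \<in> J" for r i
      using Jc cst_central[of r "letter (Poly_Mapping.single (E i) 1)"] by (metis diff_self)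
  qed (simp_all add: vk.eta_def)
  have ker: "?h x = 0 \<longleftrightarrow> x \<in> ?K" if "x \<in> carrier ?U" for x
  proof -
    obtain p where "x = ?cs p" using \<open>x \<in> carrier ?U\<close> unfolding carrU by blast
    then show ?thesis using H_kernel[of p] mem by (simp add: val J_def)
  qed
  let ?R = "quot_alg ?U ?K"
  have R: "univ_env_vir_at \<kappa> = ?R" by (simp add: univ_env_vir_at_def)
  have rep2: "rep_of ?R vk.eta (quot_rep ?h)" by (rule rep_of_quot(1)[OF rep1 idK K0])
  have inj: "inj_on (quot_rep ?h) (carrier ?R)" by (rule quot_rep_inj[OF rep1 idK ker])
  have val2: "quot_rep ?h (?K +>\<^bsub>?U\<^esub> x) = ?h x" if "x \<in> carrier ?U" for x
    by (rule rep_of_quot(2)[OF rep1 idK K0 that])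
  have carrR: "carrier ?R = (\<lambda>x. ?K +>\<^bsub>?U\<^esub> x) ` carrier ?U" by (rule rep_of_quot(3)[OF rep1 idK K0])
  have "quot_rep ?h ` carrier ?R = ?h ` carrier ?U"
    unfolding carrR image_image by (rule image_cong) (simp_all add: val2)
  also have "\<dots> = range vk.H" unfolding carrU image_image val ..
  also have "\<dots> = vk.H ` carrier (free_algebra (carrier ?V))" using mem by auto
  also have "\<dots> = vk.P.alg" unfolding H_image by (simp add: XM_def vk.P.alg_def)
  finally have img: "quot_rep ?h ` carrier ?R = vk.P.alg" .
  show ?thesis unfolding R
  proof (rule vk.vir_hopfian[OF rep2 inj img _ f[unfolded R]])
    fix g :: "('k \<Rightarrow> 'k) \<Rightarrow> ('k \<Rightarrow> 'k)" and r :: 'k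
    let ?P = "{\<chi> :: 'k \<Rightarrow> 'k. ring_point \<chi> \<and> (\<forall>a. \<chi> a = a)}"
    assume g: "g ` ?P \<subseteq> ?P" "\<And>\<chi>. \<chi> \<in> ?P \<Longrightarrow> g \<chi> r = 0"
    have id: "(\<lambda>a. a) \<in> ?P" by (simp add: ring_point_def)
    then have "g (\<lambda>a. a) \<in> ?P" using g(1) by blast
    then show "r = 0" using g(2)[OF id] by simp
  qed
qed

section \<open>The positive Witt algebra\<close>

text \<open>
  The representation of $W_+$ by $e_n \mapsto e_n - t_n$, for a linear form \<open>t\<close>.
\<close>

definition witt_map :: "(nat \<Rightarrow> 'k::field_char_0) \<Rightarrow> (nat \<Rightarrow>\<^sub>0 'k) \<Rightarrow> 'k sym endo" where
  "witt_map t x = ext_sum (\<lambda>n r. sym_scale r * (sym_gen 0 (int n) - sym_scale (t n))) x"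

text \<open>
  The condition that the linear form \<open>t\<close> vanishes on brackets.
\<close>

definition witt_character :: "(nat \<Rightarrow> 'k::field_char_0) \<Rightarrow> bool" where
  "witt_character t \<longleftrightarrow> (\<forall>m n. 1 \<le> m \<longrightarrow> 1 \<le> n \<longrightarrow> (of_nat n - of_nat m) * t (m + n) = 0)"

lemma sym_scale_0: "sym_scale (0 :: 'z::{idom, ring_char_0}) = 0"
  by (rule vir_pbw.scal_0[OF sym_vir_pbw])

lemma witt_carrier: "carrier witt_pos = {x. supp x \<subseteq> {1..}}"
  by (simp add: witt_pos_def)

lemma witt_sel [simp]:
  "lie_scale witt_pos = (\<lambda>a. Poly_Mapping.map ((*) a))"
  "lie_bracket witt_pos = bilinear_ext (\<lambda>i j. Poly_Mapping.single (i + j) (of_nat j - of_nat i))"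
  by (simp_all add: witt_pos_def)

lemma witt_map_add: "witt_map t (x + y) = witt_map t x + witt_map t y"
  unfolding witt_map_def by (rule ext_sum_add) (simp_all add: sym_scale_hom sym_scale_0 distrib_right)

lemma witt_map_0: "witt_map t 0 = 0"
  by (simp add: witt_map_def)

lemma witt_map_single: "witt_map t (Poly_Mapping.single n r) = sym_scale r * (sym_gen 0 (int n) - sym_scale (t n))"
  unfolding witt_map_def by (rule ext_sum_single) (simp add: sym_scale_0)

lemma commuting_scalars:
  fixes r s x y :: "'a::semigroup_mult"
  assumes "x * s = s * x"
  shows "r * x * (s * y) = r * s * (x * y)"
proof -
  have "r * x * (s * y) = r * (x * s) * y" by (simp only: mult.assoc)
  then show ?thesis by (simp only: assms mult.assoc)
qed

lemma sym_scale_comm: "sym_scale r * sym_scale s = sym_scale s * (sym_scale r :: 'z::comm_ring_1 sym endo)"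
  by (simp only: sym_scale_hom(2)[symmetric] mult.commute)

lemma sym_scale_witt: "sym_scale a * (sym_gen 0 i - sym_scale s) = (sym_gen 0 i - sym_scale s) * sym_scale a"
  using sym_scale_gen[of a 0 i] sym_scale_comm[of a s] by (simp add: left_diff_distrib right_diff_distrib)

lemma witt_map_scale: "witt_map t (Poly_Mapping.map ((*) a) x) = sym_scale a * witt_map t x"
proof (induction x rule: poly_mapping_linear_induct)
  case zero
  have "Poly_Mapping.map ((*) a) (0 :: nat \<Rightarrow>\<^sub>0 'a) = 0" by (rule poly_mapping_eqI) simp
  then show ?case by (simp add: witt_map_0)
next
  case (single n r)
  have "Poly_Mapping.map ((*) a) (Poly_Mapping.single n r) = Poly_Mapping.single n (a * r)"
    by (rule poly_mapping_eqI) (simp add: lookup_single when_def)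
  then show ?case by (simp only: witt_map_single sym_scale_hom mult.assoc)
next
  case (add x y)
  have "Poly_Mapping.map ((*) a) (x + y) = Poly_Mapping.map ((*) a) x + Poly_Mapping.map ((*) a) y"
    by (rule poly_mapping_eqI) (simp add: lookup_add distrib_left)
  then show ?case using add by (simp add: witt_map_add distrib_left)
qed

lemma word_rep_witt: "word_rep sym_scale (witt_map t)"
proof
  show "sym_scale a * witt_map t x = witt_map t x * sym_scale a" for a x
  proof (induction x rule: poly_mapping_linear_induct)
    case (single n r)
    show ?case unfolding witt_map_single
      using sym_scale_witt[of a "int n" "t n"] sym_scale_comm[of a r] by (simp only: mult.assoc[symmetric]) (simp only: mult.assoc)
  qed (simp_all add: witt_map_0 witt_map_add distrib_left distrib_right)
qed (simp_all add: sym_scale_hom)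

lemma witt_map_bracket:
  assumes t: "witt_character t" and xy: "supp x \<subseteq> {1..}" "supp y \<subseteq> {1..}"
  shows "witt_map t (lie_bracket witt_pos x y) = comm (witt_map t x) (witt_map t y)"
  using xy(1) unfolding witt_sel
proof (induction x rule: supp_induct)
  case (single m r)
  from xy(2) show ?case
  proof (induction y rule: supp_induct)
    case (single n s)
    let ?d = "of_nat n - of_nat m :: 'a"
    let ?x = "sym_gen 0 (int m) - sym_scale (t m)" and ?y = "sym_gen 0 (int n) - sym_scale (t n)"
    have d: "?d = of_int (int n - int m)" by simp
    have pos: "int n + int m \<noteq> 0" using single by auto
    have "?d * t (m + n) = 0" using t \<open>m \<in> _\<close> single by (auto simp: witt_character_def)
    then have "sym_scale ?d * sym_scale (t (m + n)) = 0" by (simp only: sym_scale_hom(2)[symmetric] sym_scale_0)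
    moreover have "sym_gen 0 (int m) * sym_gen 0 (int n) - sym_gen 0 (int n) * sym_gen 0 (int m)
        = sym_scale ?d * sym_gen 0 (int (m + n))"
      using sym_gen_rel[of "0 :: 'a" "int m" "int n"] pos
      unfolding d by (simp add: cocyc_def sym_scale_0 add.commute del: of_int_diff)
    ultimately have "comm ?x ?y = sym_scale ?d * (sym_gen 0 (int (m + n)) - sym_scale (t (m + n)))"
      using sym_scale_gen[of "t m" "0 :: 'a" "int n"] sym_scale_gen[of "t n" "0 :: 'a" "int m"] sym_scale_comm[of "t m" "t n"]
      by (simp add: comm_def left_diff_distrib right_diff_distrib)
    moreover have "comm (sym_scale r * ?x) (sym_scale s * ?y) = sym_scale (r * s) * comm ?x ?y"
    proof -
      have c: "sym_scale r * ?x * (sym_scale s * ?y) = sym_scale (r * s) * (?x * ?y)"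
        unfolding sym_scale_hom by (rule commuting_scalars) (rule sym_scale_witt[symmetric])
      have c': "sym_scale s * ?y * (sym_scale r * ?x) = sym_scale (r * s) * (?y * ?x)"
        unfolding sym_scale_hom sym_scale_comm[of r s] by (rule commuting_scalars) (rule sym_scale_witt[symmetric])
      show ?thesis unfolding comm_def c c' by (simp only: right_diff_distrib)
    qed
    ultimately show ?case
      by (simp only: bilinear_ext_single witt_map_scale witt_map_single sym_scale_hom mult.assoc)
  qed (simp_all add: witt_map_0 witt_map_add comm_simps bilinear_ext_add_right)
qed (simp_all add: witt_map_0 witt_map_add comm_simps bilinear_ext_add_left)

lemma witt_env_ideal: "witt_character t \<Longrightarrow> p \<in> env_ideal witt_pos \<Longrightarrow> word_hom sym_scale (witt_map t) p = 0"
  by (rule word_hom_env_ideal[OF word_rep_witt lie_algebra_witt_pos _ _ witt_map_bracket])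
    (simp_all add: witt_map_add witt_map_scale witt_carrier)

abbreviation wletter :: "int \<Rightarrow> (nat \<Rightarrow>\<^sub>0 'k::field_char_0) free_word \<Rightarrow>\<^sub>0 'k" where
  "wletter i \<equiv> letter (Poly_Mapping.single (nat i) 1)"

lemma witt_letter: "0 < i \<Longrightarrow> word_hom sym_scale (witt_map t) (wletter i) = sym_gen 0 i - sym_scale (t (nat i))"
  by (simp add: word_rep.H_letter[OF word_rep_witt] witt_map_single sym_scale_hom)

lemma witt_env_model:
  "env_model sym_scale (sym_gen 0) 0 (\<lambda>x. app x 1) sym_scale (witt_map (\<lambda>_. 0)) witt_pos {1..}
    (env_ideal (witt_pos :: ('k::field_char_0, _) lie_alg)) (\<lambda>a. a) cst {0<..} wletter"
proof (intro env_model.intro env_model_axioms.intro sym_vir_pbw word_rep_witt)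
  interpret L: lie_algebra "witt_pos :: ('k, _) lie_alg" by (rule lie_algebra_witt_pos)
  let ?J = "env_ideal (witt_pos :: ('k, _) lie_alg)" and ?F = "free_algebra (carrier (witt_pos :: ('k, _) lie_alg))"
  show J: "ideal ?J ?F" by (rule L.env_ideal)
  note Jc = J[unfolded ideal_free_algebra_iff]
  show "env_relations witt_pos \<subseteq> ?J" by (rule L.env_relations_subset)
  show "word_hom sym_scale (witt_map (\<lambda>_. 0)) p = 0" if "p \<in> ?J" for p
    using that by (intro witt_env_ideal) (simp_all add: witt_character_def)
  show carr: "wletter i \<in> carrier ?F" if "i \<in> {0<..}" for i using that by (intro free_carrier) (auto simp: witt_carrier)
  show "cst r * wletter i - wletter i * cst r \<in> ?J" for r :: 'k and i
    using Jc cst_central[of r "wletter i"] by simp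
  show "wletter n * wletter m - (wletter m * wletter n + cst (of_int (m - n)) * wletter (m + n) + cst (cocyc 0 n m)) \<in> ?J"
    if mn: "m \<in> {0<..}" "n \<in> {0<..}" for m n
  proof -
    let ?e = "\<lambda>i. Poly_Mapping.single (nat i) (1 :: 'k)" and ?d = "of_int (m - n) :: 'k"
    have e: "?e i \<in> carrier witt_pos" if "i \<in> {0<..}" for i using that by (auto simp: witt_carrier)
    have d: "of_nat (nat m) - of_nat (nat n) = ?d" using mn by (simp add: of_nat_nat)
    have br: "lie_bracket witt_pos (?e n) (?e m) = lie_scale witt_pos ?d (?e (m + n))"
      using mn d by (auto intro!: poly_mapping_eqI simp: bilinear_ext_single lookup_single when_def nat_add_distrib add.commute)
    have mn': "m + n \<in> {0<..}" using mn by simp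
    have "letter (?e n) * letter (?e m) - letter (?e m) * letter (?e n) - letter (lie_bracket witt_pos (?e n) (?e m)) \<in> env_relations witt_pos"
      unfolding env_relations_def using e[OF mn(1)] e[OF mn(2)] by blast
    moreover have "letter (lie_scale witt_pos ?d (?e (m + n))) - Poly_Mapping.map ((*) ?d) (letter (?e (m + n))) \<in> env_relations witt_pos"
      unfolding env_relations_def using e[OF mn'] by blast
    ultimately have "(letter (?e n) * letter (?e m) - letter (?e m) * letter (?e n) - letter (lie_bracket witt_pos (?e n) (?e m)))
        + (letter (lie_scale witt_pos ?d (?e (m + n))) - Poly_Mapping.map ((*) ?d) (letter (?e (m + n)))) \<in> ?J"
      using Jc L.env_relations_subset by blast
    moreover have "cocyc 0 n m = (0 :: 'k)" by (simp add: cocyc_def)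
    ultimately show ?thesis unfolding br map_scale_eq_cst by (simp add: algebra_simps del: of_int_diff cst_of_int)
  qed
  show "b \<in> {1..} \<Longrightarrow> (\<exists>i\<in>{0<..}. letter (Poly_Mapping.single b 1) = wletter i) \<or> (\<exists>r. letter (Poly_Mapping.single b 1) - cst r \<in> ?J)" for b
    by (intro disjI1 bexI[of _ "int b"]) auto
  show "word_hom sym_scale (witt_map (\<lambda>_. 0)) (wletter i) = sym_gen 0 i" if "i \<in> {0<..}" for i
    using that by (simp add: witt_letter sym_scale_0)
  show "word_hom sym_scale (witt_map (\<lambda>_. 0)) (cst r) = sym_scale r" for r
    by (rule word_rep.H_cst[OF word_rep_witt])
qed (simp_all add: witt_carrier)

text \<open>
  The values of the augmentation on the images $F(e_n)$ form a character \<open>t\<close>. The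
  translation $e_n \mapsto e_n - t_n$ exists by the universal property of the enveloping algebra, is
  surjective, and composed with \<open>F\<close> it preserves the augmentation, so
  \<open>augmented_epi_injective\<close> applies to the composite.
\<close>

theorem witt_pos_hopfian:
  assumes f: "f \<in> alg_epi (univ_env (witt_pos :: ('k::field_char_0, _) lie_alg)) (univ_env witt_pos)"
  shows "f \<in> alg_iso (univ_env witt_pos) (univ_env witt_pos)"
proof -
  interpret env_model sym_scale "sym_gen 0" 0 "\<lambda>x. app x 1" sym_scale "witt_map (\<lambda>_. 0)" witt_pos "{1..}"
    "env_ideal (witt_pos :: ('k, _) lie_alg)" "\<lambda>a. a" cst "{0<..}" wletter
    by (rule witt_env_model)
  interpret P: vir_pbw_field "sym_scale :: 'k \<Rightarrow> 'k sym endo" "sym_gen 0" 0 "\<lambda>x. app x 1"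
    by (intro vir_pbw_field.intro sym_vir_pbw)
  have XM: "XM = {M. positive M}" by (auto simp: XM_def positive_def)
  have img: "H ` FC = P.palg"
  proof -
    have "emb ` {q. supp q \<subseteq> XM} = P.palg"
    proof (intro equalityI subsetI)
      fix x assume "x \<in> P.palg"
      then have "x = emb (co x)" "supp (co x) \<subseteq> XM" by (auto simp: P.palg_def XM)
      then show "x \<in> emb ` {q. supp q \<subseteq> XM}" by blast
    qed (auto simp: P.palg_def XM)
    then show ?thesis unfolding H_image .
  qed
  note er = env_rep[OF lie_algebra_witt_pos word_rep_axioms H_kernel]
  have er3: "quot_rep H ` carrier (univ_env witt_pos) = P.palg" using er(3) img by simp
  show ?thesis
  proof (rule epi_iso_transfer[OF er(1,2) _ f], unfold er3)
    fix F x
    assume F: "\<And>x. x \<in> P.palg \<Longrightarrow> F x \<in> P.palg" "\<And>x y. x \<in> P.palg \<Longrightarrow> y \<in> P.palg \<Longrightarrow> F (x + y) = F x + F y"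
      "\<And>x y. x \<in> P.palg \<Longrightarrow> y \<in> P.palg \<Longrightarrow> F (x * y) = F x * F y" "F 1 = 1" "\<And>a. F (sym_scale a) = sym_scale a"
      "\<And>y. y \<in> P.palg \<Longrightarrow> \<exists>x\<in>P.palg. F x = y" and x: "x \<in> P.palg" "F x = 0"
    have scal_palg: "sym_scale a \<in> P.palg" for a using P.palg_scal[OF P.palg_1, of a] by simp
    have F_scale: "F (sym_scale a * y) = sym_scale a * F y" if "y \<in> P.palg" for a y
      using F(3)[OF scal_palg that] F(5) by simp
    have F_diff: "F (y - z) = F y - F z" if "y \<in> P.palg" "z \<in> P.palg" for y z
      using F(2)[of "y - z" z] that by simp
    define t where "t n = P.eps (F (sym_gen 0 (int n)))" for n
    have t: "witt_character t" unfolding witt_character_def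
    proof (intro allI impI)
      fix m n :: nat assume "1 \<le> m" "1 \<le> n"
      then have g: "sym_gen (0 :: 'k) (int m) \<in> P.palg" "sym_gen 0 (int n) \<in> P.palg" "sym_gen 0 (int (m + n)) \<in> P.palg"
        by (auto intro!: P.palg_gen simp del: of_nat_add)
      have "int n + int m \<noteq> 0" using \<open>1 \<le> m\<close> by simp
      then have "sym_gen (0 :: 'k) (int m) * sym_gen 0 (int n) = sym_gen 0 (int n) * sym_gen 0 (int m)
          + sym_scale (of_nat n - of_nat m) * sym_gen 0 (int (m + n) :: int)"
        using sym_gen_rel[of "0 :: 'k" "int m" "int n"] by (simp add: cocyc_def sym_scale_0 add.commute)
      then have "F (sym_gen 0 (int m) * sym_gen 0 (int n)) = F (sym_gen 0 (int n) * sym_gen 0 (int m)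
          + sym_scale (of_nat n - of_nat m) * sym_gen 0 (int (m + n)))" by (rule arg_cong)
      then have "F (sym_gen 0 (int m)) * F (sym_gen 0 (int n)) = F (sym_gen 0 (int n)) * F (sym_gen 0 (int m))
          + sym_scale (of_nat n - of_nat m) * F (sym_gen 0 (int (m + n)))"
        using g by (simp only: F(2,3) F_scale P.palg_mult P.palg_scal)
      then have "P.eps (F (sym_gen 0 (int m)) * F (sym_gen 0 (int n))) = P.eps (F (sym_gen 0 (int n)) * F (sym_gen 0 (int m))
          + sym_scale (of_nat n - of_nat m) * F (sym_gen 0 (int (m + n))))" by (rule arg_cong)
      then have "t m * t n = t n * t m + (of_nat n - of_nat m) * t (m + n)"
        using F(1)[OF g(1)] F(1)[OF g(2)] F(1)[OF g(3)]
        by (simp only: P.eps_mult P.eps_simps P.palg_alg P.palg_mult P.palg_scal t_def)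
      then show "(of_nat n - of_nat m) * t (m + n) = 0" by simp
    qed
    interpret T: word_rep "sym_scale :: 'k \<Rightarrow> 'k sym endo" "witt_map t" by (rule word_rep_witt)
    have T_letter: "T.H (wletter i) = sym_gen 0 i - sym_scale (t (nat i))" if "0 < i" for i by (rule witt_letter[OF that])
    have wcarr: "wletter i \<in> FC" if "0 < i" for i using lift_carrier[of i] that by simp
    define \<tau> where "\<tau> y = T.H (SOME p. p \<in> FC \<and> H p = y)" for y
    have \<tau>: "\<tau> (H p) = T.H p" if "p \<in> FC" for p
    proof -
      define q where "q = (SOME q. q \<in> FC \<and> H q = H p)"
      have q: "q \<in> FC \<and> H q = H p" unfolding q_def by (rule someI[of _ p]) (simp add: that)
      then have "H (q - p) = 0" by simp
      then have "q - p \<in> env_ideal witt_pos" using H_kernel[of "q - p"] q that free_carrier(6) by blast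
      then have "T.H (q - p) = 0" by (rule witt_env_ideal[OF t])
      then show ?thesis by (simp add: \<tau>_def flip: q_def)
    qed
    have lift: "\<exists>p\<in>FC. H p = y" if "y \<in> P.palg" for y
    proof -
      have "y \<in> H ` FC" unfolding img by (rule that)
      then show ?thesis by blast
    qed
    have T_palg: "T.H p \<in> P.palg" if "p \<in> FC" for p
      using that
    proof (induction p rule: free_carrier_induct)
      case (word xs r)
      have single: "witt_map t z \<in> P.palg" if "z \<in> carrier witt_pos" for z
      proof -
        from that have "supp z \<subseteq> {1..}" by (simp add: witt_carrier)
        then show ?thesis
          by (induction z rule: supp_induct)
            (auto simp: witt_map_0 witt_map_add witt_map_single intro!: P.palg_scal P.palg_diff P.palg_gen scal_palg)
      qed
      have "prod_list (map (witt_map t) xs) \<in> P.palg" using word by (induction xs) (auto simp: single)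
      then show ?case by (simp add: T.H_prod comp_def)
    qed simp_all
    have T_surj: "\<exists>p\<in>FC. T.H p = y" if "y \<in> P.palg" for y
      using that
    proof (induction y rule: P.palg_induct)
      case (smon M r)
      have "\<exists>p\<in>FC. T.H p = word w" if "\<forall>i\<in>set w. 0 < i" for w
        using that
      proof (induction w)
        case Nil
        then show ?case by (intro bexI[of _ 1]) simp_all
      next
        case (Cons i w)
        then obtain p where p: "p \<in> FC" "T.H p = word w" by auto
        have "T.H (wletter i + cst (t (nat i))) = sym_gen 0 i" using Cons.prems T_letter[of i] by simp
        then have "T.H ((wletter i + cst (t (nat i))) * p) = word (i # w)" by (simp only: T.H_mult p word_simps)
        moreover have "(wletter i + cst (t (nat i))) * p \<in> FC" using p Cons.prems wcarr[of i] by simp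
        ultimately show ?case by blast
      qed
      from this[of "sorted_list_of_multiset M"] smon obtain p where "p \<in> FC" "T.H p = smon M"
        by (auto simp: positive_def)
      then show ?case by (intro bexI[of _ "cst r * p"]) simp_all
    next
      case (add y z)
      then obtain p q where "p \<in> FC" "T.H p = y" "q \<in> FC" "T.H q = z" by blast
      then show ?case by (intro bexI[of _ "p + q"]) simp_all
    qed (rule bexI[of _ 0], simp_all)
    define g where "g = (\<lambda>y. F (\<tau> y))"
    have gH: "g (H p) = F (T.H p)" if "p \<in> FC" for p by (simp add: g_def \<tau> that)
    have eps_g: "P.eps (g y) = P.eps y" if "y \<in> P.palg" for y
      using that
    proof (induction y rule: P.palg_induct)
      case zero
      show ?case using gH[of 0] F(5)[of 0] by (simp add: sym_scale_0)
    next
      case (smon M r)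
      have "\<exists>p\<in>FC. H p = word w \<and> P.eps (F (T.H p)) = P.eps (word w)" if "\<forall>i\<in>set w. 0 < i" for w
        using that
      proof (induction w)
        case Nil
        show ?case by (intro bexI[of _ 1]) (simp_all add: F(4))
      next
        case (Cons i w)
        then obtain p where p: "p \<in> FC" "H p = word w" "P.eps (F (T.H p)) = P.eps (word w)" by auto
        have i: "0 < i" using Cons.prems by simp
        have "P.eps (F (T.H (wletter i))) = 0"
          using i F(1)[OF P.palg_gen[OF i]] by (simp add: T_letter F_diff P.palg_gen scal_palg F(5) P.palg_alg t_def del: T.H_letter)
        then have "P.eps (F (T.H (wletter i * p))) = 0"
          using wcarr[OF i] p(1) by (simp add: F(1,3) T_palg P.eps_mult del: T.H_letter)
        moreover have "H (wletter i * p) = word (i # w)" using i p H_lift[of i] by simp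
        moreover have "P.eps (word (i # w)) = 0" using Cons.prems P.eps_word[of "i # w"] by simp
        ultimately show ?case using wcarr[OF i] p(1) by (intro bexI[of _ "wletter i * p"]) simp_all
      qed
      from this[of "sorted_list_of_multiset M"] smon obtain p
        where p: "p \<in> FC" "H p = smon M" "P.eps (F (T.H p)) = P.eps (smon M)" by (auto simp: positive_def)
      have "g (H (cst r * p)) = F (T.H (cst r * p))" using p(1) by (intro gH) simp
      then have "g (H (cst r * p)) = sym_scale r * F (T.H p)" using p(1) by (simp add: T_palg F_scale)
      then have "g (sym_scale r * smon M) = sym_scale r * F (T.H p)" by (simp add: p)
      then show ?case using p F(1)[OF T_palg[OF p(1)]] by (simp add: P.palg_alg)
    next
      case (add y z)
      obtain p q where pq: "p \<in> FC" "H p = y" "q \<in> FC" "H q = z"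
        using lift[OF add.hyps(1)] lift[OF add.hyps(2)] by blast
      have "g (y + z) = g y + g z" using gH[of "p + q"] gH[of p] gH[of q] pq by (simp add: F(2) T_palg)
      moreover have "g y \<in> P.palg" "g z \<in> P.palg" using gH[of p] gH[of q] pq F(1) T_palg by simp_all
      ultimately show ?case using add by (simp add: P.palg_alg)
    qed
    have g_palg: "g z \<in> P.palg" if z: "z \<in> P.palg" for z
    proof -
      obtain p where "p \<in> FC" "H p = z" using lift[OF z] by blast
      then show ?thesis using gH[of p] F(1)[OF T_palg] by simp
    qed
    have g_inj: "y = 0" if "y \<in> P.palg" "g y = 0" for y
    proof (rule P.augmented_epi_injective[of g])
      show "y \<in> P.palg" "g y = 0" by (rule that)+
      show "g z \<in> P.palg" if "z \<in> P.palg" for z by (rule g_palg[OF that])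
      show "g (u + v) = g u + g v" if uv: "u \<in> P.palg" "v \<in> P.palg" for u v
      proof -
        obtain p q where "p \<in> FC" "H p = u" "q \<in> FC" "H q = v"
          using lift[OF uv(1)] lift[OF uv(2)] by blast
        then show ?thesis using gH[of "p + q"] gH[of p] gH[of q] by (simp add: F(2) T_palg)
      qed
      show "g (u * v) = g u * g v" if uv: "u \<in> P.palg" "v \<in> P.palg" for u v
      proof -
        obtain p q where "p \<in> FC" "H p = u" "q \<in> FC" "H q = v"
          using lift[OF uv(1)] lift[OF uv(2)] by blast
        then show ?thesis using gH[of "p * q"] gH[of p] gH[of q] by (simp add: F(3) T_palg)
      qed
      show "g (sym_scale a * v) = sym_scale a * g v" if v: "v \<in> P.palg" for a v
      proof -
        obtain q where "q \<in> FC" "H q = v" using lift[OF v] by blast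
        then show ?thesis using gH[of "cst a * q"] gH[of q] by (simp add: F_scale T_palg)
      qed
      show "P.palg \<subseteq> g ` P.palg"
      proof
        fix z assume "z \<in> P.palg"
        then obtain y where y: "y \<in> P.palg" "F y = z" using F(6) by blast
        then obtain p where "p \<in> FC" "T.H p = y" using T_surj by blast
        then have "z = g (H p)" "H p \<in> P.palg" using y gH[of p] img by auto
        then show "z \<in> g ` P.palg" by blast
      qed
      show "g z \<in> P.aug" if "z \<in> P.aug" for z
        using that eps_g[of z] g_palg[of z] by (simp add: P.aug_def)
    qed
    obtain p where p: "p \<in> FC" "T.H p = x" using T_surj[OF x(1)] by blast
    then have "g (H p) = 0" "H p \<in> P.palg" using gH[of p] x img by auto
    then have "H p = 0" using g_inj by blast
    then have "p \<in> env_ideal witt_pos" using H_kernel[OF p(1)] by simp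
    then show "x = 0" using witt_env_ideal[OF t] p(2) by simp
  qed
qed

theorem proposition1p6:
  fixes \<kappa> :: "'k::field_char_0"
  shows "(\<forall>f \<in> alg_epi (univ_env (witt_pos :: ('k, nat \<Rightarrow>\<^sub>0 'k) lie_alg)) (univ_env witt_pos).
            f \<in> alg_iso (univ_env witt_pos) (univ_env witt_pos)) \<and>
         (\<forall>f \<in> alg_epi (univ_env (virasoro :: ('k, vir_basis \<Rightarrow>\<^sub>0 'k) lie_alg)) (univ_env virasoro).
            f \<in> alg_iso (univ_env virasoro) (univ_env virasoro)) \<and>
         (\<forall>f \<in> alg_epi (univ_env_vir_at \<kappa>) (univ_env_vir_at \<kappa>).
            f \<in> alg_iso (univ_env_vir_at \<kappa>) (univ_env_vir_at \<kappa>))"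
  by (intro conjI ballI witt_pos_hopfian virasoro_hopfian virasoro_at_hopfian)

end
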